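(* Let $R(\mathbf{Z})$ be a relation, $\mathbf{Y}\subseteq\mathbf{Z}$ and $\mathcal{X}\subseteq 2^{\mathbf{Y}}$. The Exact Decomposition Algorithm (described in the context) computes a partitioning $\bigcup_{\mathbf{X}\in\mathcal{X}}R^{\mathbf{X}}=R$ (into pairwise disjoint subrelations) in $O(|R|^2)$ time (data complexity) such that $DC_{R^{\mathbf{X}}}(\mathbf{X},\mathbf{Y},d)$ holds for every $\mathbf{X}\in\mathcal{X}$, where $d=PC_R(\mathcal{X},\mathbf{Y})$.
   Context: A relation $R(\mathbf{Z})$ is a finite set of tuples over a finite set of variables $\mathbf{Z}$; $\pi$ and $\sigma$ denote projection and selection. If $\mathbf{y}$ is a tuple over a superset of $\mathbf{X}$, then $\sigma_{\mathbf{X}=\mathbf{y}}R$ denotes the tuples of $R$ agreeing with $\mathbf{y}$ on $\mathbf{X}$. For $\mathbf{X}\subseteq\mathbf{Y}\subseteq\mathbf{Z}$, the degree constraint $DC_R(\mathbf{X},\mathbf{Y},d)$ asserts $\max_{\mathbf{x}}|\pi_{\mathbf{Y}}\sigma_{\mathbf{X}=\mathbf{x}}R|\le d$ (maximum over all assignments $\mathbf{x}$ of values to $\mathbf{X}$), and $DC_R(\mathbf{X},\mathbf{Y})$ denotes the least $d$ for which it holds. For $\mathcal{X}\subseteq 2^{\mathbf{Y}}$, $PC_R(\mathcal{X},\mathbf{Y})$ denotes $\min_{(R^{\mathbf{X}})_{\mathbf{X}\in\mathcal{X}}}\max_{\mathbf{X}\in\mathcal{X}}DC_{R^{\mathbf{X}}}(\mathbf{X},\mathbf{Y})$,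 the minimum being over all families of pairwise disjoint (possibly empty) subrelations whose union is $R$. Augmenting path: let $(R^{\mathbf{X}})_{\mathbf{X}\in\mathcal{X}}$ be pairwise disjoint subsets of $R$ and $\mathbf{y}_0\in\pi_{\mathbf{Y}}R\setminus\pi_{\mathbf{Y}}\bigcup_{\mathbf{X}\in\mathcal{X}}R^{\mathbf{X}}$. An augmenting path is a sequence $(\mathbf{y}_1,\dots,\mathbf{y}_m,\mathbf{X}_1,\dots,\mathbf{X}_{m+1})$, $m\ge 0$, such that: (1) $\mathbf{X}_i\in\mathcal{X}$ for $i=1,\dots,m+1$; (2) $\mathbf{y}_i\in\pi_{\mathbf{Y}}R^{\mathbf{X}_i}$ for $i=1,\dots,m$; (3) $\mathbf{y}_i$ agrees with $\mathbf{y}_{i-1}$ on $\mathbf{X}_i$ for $i=1,\dots,m$; (4) $|\pi_{\mathbf{Y}}\sigma_{\mathbf{X}_{m+1}=\mathbf{y}_m}R^{\mathbf{X}_{m+1}}|<\max_{\mathbf{X}\in\mathcal{X}}DC_{R^{\mathbf{X}}}(\mathbf{X},\mathbf{Y})$. Exact Decomposition Algorithm on input $(R,\mathcal{X},\mathbf{Y})$: set $d\gets 0$ and $R^{\mathbf{X}}\gets\emptyset$ for all $\mathbf{X}\in\mathcal{X}$. For each $\mathbf{y}_0\in\pi_{\mathbf{Y}}R$: if an augmenting path (for the current $(R^{\mathbf{X}})_{\mathbf{X}}$ and $\mathbf{y}_0$) exists, take a shortest one $(\mathbf{y}_1,\dots,\mathbf{y}_m,\mathbf{X}_1,\dots,\mathbf{X}_{m+1})$;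 for $i=m,\dots,1$ move the tuples $\sigma_{\mathbf{Y}=\mathbf{y}_i}R^{\mathbf{X}_i}$ from $R^{\mathbf{X}_i}$ to $R^{\mathbf{X}_{i+1}}$; then add $\sigma_{\mathbf{Y}=\mathbf{y}_0}R$ to $R^{\mathbf{X}_1}$. If no augmenting path exists, set $d\gets d+1$ and add $\sigma_{\mathbf{Y}=\mathbf{y}_0}R$ to $R^{\mathbf{X}}$ for an arbitrary $\mathbf{X}\in\mathcal{X}$. In either case then remove $\sigma_{\mathbf{Y}=\mathbf{y}_0}R$ from $R$. Return $(R^{\mathbf{X}})_{\mathbf{X}\in\mathcal{X}}$ and $d$. The runtime statement means that the algorithm can be implemented to run within that time. "Data complexity" means that $\mathbf{Z},\mathbf{Y},\mathcal{X}$ are regarded as fixed, so hidden constants may depend on them but not on the contents of $R$. *)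

theory Defs
  imports Complex_Main "HOL-Library.Landau_Symbols" "HOL-Library.Disjoint_Sets"
begin

section \<open>Relations and degree constraints\<close>

text \<open>A tuple over a set of variables \<open>X\<close> is a partial map with domain \<open>X\<close>.\<close>

type_synonym ('v, 'a) tuple = "'v \<rightharpoonup> 'a"
type_synonym ('v, 'a) rel = "('v, 'a) tuple set"
type_synonym ('v, 'a) family = "'v set \<Rightarrow> ('v, 'a) rel"

definition relation :: "'v set \<Rightarrow> ('v, 'a) rel \<Rightarrow> bool" where
  "relation Z R \<longleftrightarrow> finite R \<and> (\<forall>t\<in>R. dom t = Z)"

definition proj :: "'v set \<Rightarrow> ('v, 'a) rel \<Rightarrow> ('v, 'a) rel" where
  "proj Y R = (\<lambda>t. t |` Y) ` R"

definition agree :: "'v set \<Rightarrow> ('v, 'a) tuple \<Rightarrow> ('v, 'a) tuple \<Rightarrow> bool" where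
  "agree X s t \<longleftrightarrow> (\<forall>v\<in>X. s v = t v)"

definition sel :: "'v set \<Rightarrow> ('v, 'a) tuple \<Rightarrow> ('v, 'a) rel \<Rightarrow> ('v, 'a) rel" where
  "sel X y R = {t \<in> R. agree X t y}"

definition degree_constraint :: "('v, 'a) rel \<Rightarrow> 'v set \<Rightarrow> 'v set \<Rightarrow> nat \<Rightarrow> bool" where
  "degree_constraint R X Y d \<longleftrightarrow> (\<forall>x. dom x = X \<longrightarrow> card (proj Y (sel X x R)) \<le> d)"

definition DC :: "('v, 'a) rel \<Rightarrow> 'v set \<Rightarrow> 'v set \<Rightarrow> nat" where
  "DC R X Y = (LEAST d. degree_constraint R X Y d)"

definition max_DC :: "('v, 'a) family \<Rightarrow> 'v set set \<Rightarrow> 'v set \<Rightarrow> nat" where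
  "max_DC P \<X> Y = Max ((\<lambda>X. DC (P X) X Y) ` \<X>)"

definition is_partitioning :: "('v, 'a) rel \<Rightarrow> 'v set set \<Rightarrow> ('v, 'a) family \<Rightarrow> bool" where
  "is_partitioning R \<X> P \<longleftrightarrow> disjoint_family_on P \<X> \<and> (\<Union>X\<in>\<X>. P X) = R"

text \<open>For \<open>\<X> \<noteq> {}\<close> this is the infimum of a nonempty set of natural numbers, hence a minimum.\<close>

definition PC :: "('v, 'a) rel \<Rightarrow> 'v set set \<Rightarrow> 'v set \<Rightarrow> nat" where
  "PC R \<X> Y = Inf {max_DC P \<X> Y | P. is_partitioning R \<X> P}"

section \<open>The Exact Decomposition Algorithm\<close>

text \<open>Lists count from 0: with \<open>ys = [y\<^sub>1, \<dots>, y\<^sub>m]\<close> and \<open>Xs = [X\<^sub>1, \<dots>, X\<^sub>m\<^sub>+\<^sub>1]\<close>, the entry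
  \<open>Xs ! i\<close> is the set with index \<open>i + 1\<close>, \<open>ys ! i\<close> the tuple with index \<open>i + 1\<close>, and
  \<open>(y0 # ys) ! i\<close> the tuple with index \<open>i\<close>.\<close>

definition augmenting_path ::
  "'v set set \<Rightarrow> 'v set \<Rightarrow> ('v, 'a) family \<Rightarrow> ('v, 'a) tuple \<Rightarrow>
    ('v, 'a) tuple list \<Rightarrow> 'v set list \<Rightarrow> bool" where
  "augmenting_path \<X> Y P y0 ys Xs \<longleftrightarrow>
     length Xs = Suc (length ys) \<and>
     set Xs \<subseteq> \<X> \<and>
     (\<forall>i<length ys. ys ! i \<in> proj Y (P (Xs ! i))) \<and>
     (\<forall>i<length ys. agree (Xs ! i) (ys ! i) ((y0 # ys) ! i)) \<and>
     card (proj Y (sel (last Xs) (last (y0 # ys)) (P (last Xs)))) < max_DC P \<X> Y"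

definition shortest_augmenting_path ::
  "'v set set \<Rightarrow> 'v set \<Rightarrow> ('v, 'a) family \<Rightarrow> ('v, 'a) tuple \<Rightarrow>
    ('v, 'a) tuple list \<Rightarrow> 'v set list \<Rightarrow> bool" where
  "shortest_augmenting_path \<X> Y P y0 ys Xs \<longleftrightarrow>
     augmenting_path \<X> Y P y0 ys Xs \<and>
     (\<forall>ys' Xs'. augmenting_path \<X> Y P y0 ys' Xs' \<longrightarrow> length ys \<le> length ys')"

definition add_to :: "'v set \<Rightarrow> ('v, 'a) rel \<Rightarrow> ('v, 'a) family \<Rightarrow> ('v, 'a) family" where
  "add_to X S P = P(X := P X \<union> S)"

definition move ::
  "'v set \<Rightarrow> ('v, 'a) tuple \<Rightarrow> 'v set \<Rightarrow> 'v set \<Rightarrow> ('v, 'a) family \<Rightarrow> ('v, 'a) family" where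
  "move Y y A B P = (let S = sel Y y (P A) in add_to B S (P(A := P A - S)))"

text \<open>\<open>foldr\<close> performs the moves from the far end of the path towards \<open>y0\<close>.\<close>

definition shift_along ::
  "'v set \<Rightarrow> ('v, 'a) tuple list \<Rightarrow> 'v set list \<Rightarrow> ('v, 'a) family \<Rightarrow> ('v, 'a) family" where
  "shift_along Y ys Xs P =
     foldr (\<lambda>i. move Y (ys ! i) (Xs ! i) (Xs ! Suc i)) [0..<length ys] P"

text \<open>A state consists of the remaining part of the input relation, the current family and \<open>d\<close>.\<close>

type_synonym ('v, 'a) state = "('v, 'a) rel \<times> ('v, 'a) family \<times> nat"

inductive eda_iteration ::
  "'v set set \<Rightarrow> 'v set \<Rightarrow> ('v, 'a) tuple \<Rightarrow> ('v, 'a) state \<Rightarrow> ('v, 'a) state \<Rightarrow> bool"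
  for \<X> Y y0 where
  augment: "shortest_augmenting_path \<X> Y P y0 ys Xs \<Longrightarrow> S = sel Y y0 R \<Longrightarrow>
    eda_iteration \<X> Y y0 (R, P, d) (R - S, add_to (hd Xs) S (shift_along Y ys Xs P), d)"
| grow: "\<nexists>ys Xs. augmenting_path \<X> Y P y0 ys Xs \<Longrightarrow> X \<in> \<X> \<Longrightarrow> S = sel Y y0 R \<Longrightarrow>
    eda_iteration \<X> Y y0 (R, P, d) (R - S, add_to X S P, d + 1)"

text \<open>A complete run: \<open>y0s\<close> is the order in which the loop visits the projection of \<open>R\<close> to \<open>Y\<close>,
  and \<open>ss ! k\<close> is the state after \<open>k\<close> iterations.\<close>

definition eda_run ::
  "('v, 'a) rel \<Rightarrow> 'v set set \<Rightarrow> 'v set \<Rightarrow> ('v, 'a) tuple list \<Rightarrow> ('v, 'a) state list \<Rightarrow> bool" where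
  "eda_run R \<X> Y y0s ss \<longleftrightarrow>
     distinct y0s \<and> set y0s = proj Y R \<and>
     length ss = Suc (length y0s) \<and>
     ss ! 0 = (R, (\<lambda>_. {}), 0) \<and>
     (\<forall>k<length y0s. eda_iteration \<X> Y (y0s ! k) (ss ! k) (ss ! Suc k))"

section \<open>A unit-cost random access machine\<close>

text \<open>Running time is measured on a random access machine whose memory is divided into arrays of
  natural numbers and whose programs are finite structured programs. The only arithmetic operations
  are successor and predecessor, so that numbers grow by at most a constant in each step and no
  computation can be hidden in large numbers. Expressions are nested to a depth fixed by the
  program, so each step takes a constant number of elementary operations.\<close>

datatype 'v array = Column 'v | Size | Part "'v set" | Degree | Work nat

type_synonym 'v memory = "'v array \<Rightarrow> nat \<Rightarrow> nat"

datatype 'v expr = Const nat | Read "'v array" "'v expr" | Succ "'v expr" | Pred "'v expr"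

datatype 'v test = Less "'v expr" "'v expr" | Equal "'v expr" "'v expr"

datatype 'v com =
    Write "'v array" "'v expr" "'v expr"
  | Cond "'v test" "'v com list" "'v com list"
  | While "'v test" "'v com list"

fun expr_val :: "'v memory \<Rightarrow> 'v expr \<Rightarrow> nat" where
  "expr_val m (Const c) = c"
| "expr_val m (Read a e) = m a (expr_val m e)"
| "expr_val m (Succ e) = expr_val m e + 1"
| "expr_val m (Pred e) = expr_val m e - 1"

fun test_val :: "'v memory \<Rightarrow> 'v test \<Rightarrow> bool" where
  "test_val m (Less e f) \<longleftrightarrow> expr_val m e < expr_val m f"
| "test_val m (Equal e f) \<longleftrightarrow> expr_val m e = expr_val m f"

text \<open>A configuration consists of the commands still to be executed and the memory; the machine has
  halted when no command is left.\<close>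

type_synonym 'v config = "'v com list \<times> 'v memory"

fun machine_step :: "'v config \<Rightarrow> 'v config" where
  "machine_step ([], m) = ([], m)"
| "machine_step (Write a e f # cs, m) = (cs, m(a := (m a)(expr_val m e := expr_val m f)))"
| "machine_step (Cond b cs1 cs2 # cs, m) = ((if test_val m b then cs1 else cs2) @ cs, m)"
| "machine_step (While b cs1 # cs, m) =
     (if test_val m b then cs1 @ While b cs1 # cs else cs, m)"

definition config_after :: "nat \<Rightarrow> 'v config \<Rightarrow> 'v config" where
  "config_after t c = (machine_step ^^ t) c"

text \<open>The input relation is given as a duplicate-free list of its tuples, stored columnwise, with
  values encoded as natural numbers. All other cells are initially 0.\<close>

fun input_memory :: "('a \<Rightarrow> nat) \<Rightarrow> ('v, 'a) tuple list \<Rightarrow> 'v memory" where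
  "input_memory enc ts (Column v) i =
     (if i < length ts then (case (ts ! i) v of None \<Rightarrow> 0 | Some a \<Rightarrow> enc a) else 0)"
| "input_memory enc ts Size i = (if i = 0 then length ts else 0)"
| "input_memory enc ts (Part X) i = 0"
| "input_memory enc ts Degree i = 0"
| "input_memory enc ts (Work k) i = 0"

text \<open>The memory holds a state of the algorithm: the array \<open>Part X\<close> is the characteristic vector of
  the current subrelation for \<open>X\<close>. The remaining part of the input consists of the tuples
  that are in none of the parts.\<close>

definition represents ::
  "'v set set \<Rightarrow> ('v, 'a) tuple list \<Rightarrow> 'v memory \<Rightarrow> ('v, 'a) state \<Rightarrow> bool" where
  "represents \<X> ts m s \<longleftrightarrow>
     (case s of (R, P, d) \<Rightarrow>
        m Degree 0 = d \<and>
        (\<forall>X\<in>\<X>. \<forall>i<length ts. m (Part X) i = (if ts ! i \<in> P X then 1 else 0)) \<and>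
        R = set ts - (\<Union>X\<in>\<X>. P X))"

text \<open>The computation started in configuration \<open>c\<close> passes, in this order, through memories that
  represent the given states, and halts with the last of them within \<open>n\<close> steps.\<close>

definition carries_out_within ::
  "'v set set \<Rightarrow> ('v, 'a) tuple list \<Rightarrow> 'v config \<Rightarrow> ('v, 'a) state list \<Rightarrow> nat \<Rightarrow> bool" where
  "carries_out_within \<X> ts c ss n \<longleftrightarrow>
     (\<exists>\<tau> :: nat \<Rightarrow> nat. mono \<tau> \<and>
        (\<forall>k<length ss. represents \<X> ts (snd (config_after (\<tau> k) c)) (ss ! k)) \<and>
        fst (config_after (\<tau> (length ss - 1)) c) = [] \<and>
        \<tau> (length ss - 1) \<le> n)"

definition active_domain :: "('v, 'a) rel \<Rightarrow> 'a set" where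
  "active_domain R = (\<Union>t\<in>R. ran t)"

text \<open>The program performs a run of the algorithm on every input relation over \<open>Z\<close>, for every order
  of its tuples and every encoding of its values, in a number of steps bounded in terms of the
  number of tuples. (It may resolve the choices left open by the algorithm in any way.)\<close>

definition implements_eda ::
  "'v com list \<Rightarrow> 'a itself \<Rightarrow> 'v set \<Rightarrow> 'v set \<Rightarrow> 'v set set \<Rightarrow> (nat \<Rightarrow> nat) \<Rightarrow> bool" where
  "implements_eda prog _ Z Y \<X> T \<longleftrightarrow>
     (\<forall>(R :: ('v, 'a) rel) ts enc.
        relation Z R \<and> distinct ts \<and> set ts = R \<and> inj_on enc (active_domain R) \<longrightarrow>
        (\<exists>y0s ss. eda_run R \<X> Y y0s ss \<and>
           carries_out_within \<X> ts (prog, input_memory enc ts) ss (T (card R))))"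

end

theory Submission
  imports Defs "HOL-Library.Nat_Bijection"
begin

text \<open>Optimality: moving tuples along a shortest augmenting path changes the size of a single group, which
  was not full, so \<open>d\<close> stays the value of the partitioning. If there is no augmenting path, then
  every group met by the tuples reachable from \<open>y0\<close> is full and consists of reachable tuples, and counting
  shows that no partitioning has value \<open>d\<close>.

  Running time: in time \<open>O(|R|\<^sup>2)\<close> one tabulates, for each set in \<open>\<X>\<close>, the groups as linked lists.
  Then each iteration takes linear time: a breadth-first search scans each group at most once, and the
  first queue entry with a group that is not full is the end of a shortest augmenting path.\<close>

section \<open>Optimality\<close>

text \<open>Moves transport whole classes of tuples with equal projection to \<open>Y\<close>, so a
  family can be replaced by a map from such projections to sets, and a move becomes an update at one
  point. Augmenting paths compare group sizes with \<open>max_DC\<close> of the current family,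
  while the algorithm keeps a counter; the invariant \<open>tight\<close> makes the two numbers
  equal. Shortest paths matter for correctness too: they repeat no tuple, and so the moves amount to
  one simultaneous reassignment. The lower bound must hold against all partitionings, including
  those that split classes, which is why it is a count by inequalities.

  The machine has neither multiplication nor hashing; groups are therefore named by their last
  tuple, found by comparing all pairs. The linear time of a search is amortised: walking through a
  group is paid for by a potential that counts tuples in groups not yet visited. No distances are
  stored; that parent positions never decrease along the queue replaces them in the proof that the
  path found is shortest.\<close>

lemma agree_sym: "agree X s t \<longleftrightarrow> agree X t s"
  unfolding agree_def by metis

lemma agree_trans: "agree X s t \<Longrightarrow> agree X t u \<Longrightarrow> agree X s u"
  unfolding agree_def by metis

lemma agree_restrict: "X \<subseteq> Y \<Longrightarrow> agree X (s |` Y) t \<longleftrightarrow> agree X s t"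
  unfolding agree_def by (auto simp: restrict_map_def)

lemma agree_iff_restrict_eq: "agree X s t \<longleftrightarrow> s |` X = t |` X"
  unfolding agree_def restrict_map_def by (auto simp: fun_eq_iff)

lemma successively_remove_cycle:
  assumes "successively E (as @ [y] @ bs @ [y] @ cs)"
  shows "successively E (as @ [y] @ cs)"
  using assms by (auto simp: successively_append_iff successively_Cons)

lemma eda_iteration_iff:
  "eda_iteration \<X> Y y0 (R, P, d) s' \<longleftrightarrow>
    (\<exists>ys Xs. shortest_augmenting_path \<X> Y P y0 ys Xs \<and>
      s' = (R - sel Y y0 R, add_to (hd Xs) (sel Y y0 R) (shift_along Y ys Xs P), d)) \<or>
    (\<nexists>ys Xs. augmenting_path \<X> Y P y0 ys Xs) \<and>
    (\<exists>X\<in>\<X>. s' = (R - sel Y y0 R, add_to X (sel Y y0 R) P, d + 1))"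
  by (subst eda_iteration.simps) auto

section \<open>Families as maps from projected tuples to sets, and the value of a family\<close>

locale decomposition =
  fixes Z Y :: "'v set" and \<X> :: "'v set set" and R :: "('v, 'a) rel"
  assumes finite_Z: "finite Z" and Y_sub: "Y \<subseteq> Z" and \<X>_sub: "\<X> \<subseteq> Pow Y"
    and \<X>_nonempty: "\<X> \<noteq> {}" and relation_R: "relation Z R"
begin

abbreviation D :: "('v, 'a) rel" where "D \<equiv> proj Y R"

text \<open>A family whose members are unions of classes \<open>\<sigma>\<^bsub>Y=y\<^esub>R\<close> is encoded by the map sending \<open>y\<close> to the
  index of the member that contains its class.\<close>

definition fam :: "(('v, 'a) tuple \<rightharpoonup> 'v set) \<Rightarrow> ('v, 'a) family" where
  "fam f X = {t \<in> R. f (t |` Y) = Some X}"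

definition members :: "(('v, 'a) tuple \<rightharpoonup> 'v set) \<Rightarrow> 'v set \<Rightarrow> ('v, 'a) tuple \<Rightarrow> ('v, 'a) rel" where
  "members f X y = {z \<in> D. f z = Some X \<and> agree X z y}"

text \<open>The step relation of augmenting paths. No set is recorded on an edge, since
  \<open>z\<close> can only be met in the part that contains it.\<close>

definition link :: "(('v, 'a) tuple \<rightharpoonup> 'v set) \<Rightarrow> ('v, 'a) tuple \<Rightarrow> ('v, 'a) tuple \<Rightarrow> bool" where
  "link f y z \<longleftrightarrow> (\<exists>X\<in>\<X>. f z = Some X \<and> agree X z y)"

definition valid :: "(('v, 'a) tuple \<rightharpoonup> 'v set) \<Rightarrow> bool" where
  "valid f \<longleftrightarrow> dom f \<subseteq> D \<and> ran f \<subseteq> \<X>"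

text \<open>The sets along an augmenting path, except the last, are determined by its tuples.\<close>

definition aug_path ::
  "(('v, 'a) tuple \<rightharpoonup> 'v set) \<Rightarrow> nat \<Rightarrow> ('v, 'a) tuple \<Rightarrow> ('v, 'a) tuple list \<Rightarrow> 'v set \<Rightarrow> bool" where
  "aug_path f d y0 ys X \<longleftrightarrow>
     successively (link f) (y0 # ys) \<and> X \<in> \<X> \<and> card (members f X (last (y0 # ys))) < d"

definition path_sets :: "(('v, 'a) tuple \<rightharpoonup> 'v set) \<Rightarrow> ('v, 'a) tuple list \<Rightarrow> 'v set \<Rightarrow> 'v set list" where
  "path_sets f ys X = map (the \<circ> f) ys @ [X]"

text \<open>All reassignments at once: each tuple takes the set of its successor on the path, and
  the last one takes \<open>X\<close>. For paths without repetitions this is the effect of the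
  successive moves and the final addition of \<open>y0\<close>.\<close>

definition shift_map ::
  "(('v, 'a) tuple \<rightharpoonup> 'v set) \<Rightarrow> ('v, 'a) tuple \<Rightarrow> ('v, 'a) tuple list \<Rightarrow> 'v set \<Rightarrow> (('v, 'a) tuple \<rightharpoonup> 'v set)"
  where "shift_map f y0 ys X = f ++ map_of (zip (y0 # ys) (path_sets f ys X))"

definition bounded :: "(('v, 'a) tuple \<rightharpoonup> 'v set) \<Rightarrow> nat \<Rightarrow> bool" where
  "bounded f d \<longleftrightarrow> (\<forall>X\<in>\<X>. \<forall>y\<in>D. card (members f X y) \<le> d)"

text \<open>The disjunct \<open>d = 0\<close> covers an empty \<open>D\<close>, where no group
  exists that could attain \<open>d\<close>.\<close>

definition tight :: "(('v, 'a) tuple \<rightharpoonup> 'v set) \<Rightarrow> nat \<Rightarrow> bool" where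
  "tight f d \<longleftrightarrow> bounded f d \<and> (d = 0 \<or> (\<exists>X\<in>\<X>. \<exists>y\<in>D. d \<le> card (members f X y)))"

lemma finite_\<X>: "finite \<X>"
  using finite_Z Y_sub \<X>_sub by (meson finite_Pow_iff finite_subset)

lemma finite_R: "finite R"
  using relation_R by (simp add: relation_def)

lemma finite_D: "finite D"
  using finite_R by (simp add: proj_def)

lemma sub_Y: "X \<in> \<X> \<Longrightarrow> X \<subseteq> Y"
  using \<X>_sub by auto

lemma dom_D: "y \<in> D \<Longrightarrow> dom y = Y"
proof -
  assume "y \<in> D"
  then obtain t where "t \<in> R" "y = t |` Y" by (auto simp: proj_def)
  moreover from this have "dom t = Z" using relation_R by (simp add: relation_def)
  ultimately show ?thesis using Y_sub by (simp add: Int_absorb1)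
qed

lemma sel_D: "y \<in> D \<Longrightarrow> sel Y y S = {t \<in> S. t |` Y = y}"
proof -
  assume "y \<in> D"
  then have "y |` Y = y" by (auto simp: proj_def)
  then show ?thesis by (auto simp: sel_def agree_iff_restrict_eq)
qed

lemma finite_members [simp]: "finite (members f X y)"
  using finite_D by (simp add: members_def)

lemma members_cong: "agree X x y \<Longrightarrow> members f X x = members f X y"
  unfolding members_def using agree_trans agree_sym by blast

lemma proj_sel_fam: "X \<in> \<X> \<Longrightarrow> proj Y (sel X y (fam f X)) = members f X y"
  using sub_Y by (auto simp: proj_def sel_def fam_def members_def agree_restrict image_def)

lemma proj_fam: "valid f \<Longrightarrow> y \<in> proj Y (fam f X) \<longleftrightarrow> f y = Some X"
  by (force simp: valid_def proj_def fam_def image_def dom_def)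

text \<open>A nonempty group is the group of any of its members, so among all assignments to
  \<open>X\<close> it suffices to test those coming from \<open>D\<close>.\<close>

lemma degree_constraint_fam:
  assumes "X \<in> \<X>"
  shows "degree_constraint (fam f X) X Y d \<longleftrightarrow> (\<forall>y\<in>D. card (members f X y) \<le> d)"
proof
  assume *: "degree_constraint (fam f X) X Y d"
  show "\<forall>y\<in>D. card (members f X y) \<le> d"
  proof
    fix y assume "y \<in> D"
    then have "dom (y |` X) = X"
      using dom_D sub_Y[OF assms] by auto
    with * have "card (members f X (y |` X)) \<le> d"
      unfolding degree_constraint_def proj_sel_fam[OF assms] by blast
    moreover have "agree X (y |` X) y" by (simp add: agree_restrict agree_def)
    ultimately show "card (members f X y) \<le> d"
      using members_cong by metis
  qed
next
  assume *: "\<forall>y\<in>D. card (members f X y) \<le> d"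
  show "degree_constraint (fam f X) X Y d"
    unfolding degree_constraint_def proj_sel_fam[OF assms]
  proof (intro allI impI)
    fix x :: "('v, 'a) tuple" assume "dom x = X"
    show "card (members f X x) \<le> d"
    proof (cases "members f X x = {}")
      case False
      then obtain z where "z \<in> D" "agree X z x" by (auto simp: members_def)
      then show ?thesis using * members_cong by metis
    qed auto
  qed
qed

text \<open>Finiteness provides an admissible bound, \<open>card (P X)\<close>, so that the
  \<open>LEAST\<close> in \<open>DC\<close> is attained; the rest is monotonicity in
  \<open>d\<close>.\<close>

lemma max_DC_le_iff:
  assumes "\<And>X. X \<in> \<X> \<Longrightarrow> finite (P X)"
  shows "max_DC P \<X> Y \<le> d \<longleftrightarrow> (\<forall>X\<in>\<X>. degree_constraint (P X) X Y d)"
proof -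
  have "DC (P X) X Y \<le> d \<longleftrightarrow> degree_constraint (P X) X Y d" if "X \<in> \<X>" for X
  proof
    have "degree_constraint (P X) X Y (card (P X))"
      using assms[OF that] unfolding degree_constraint_def proj_def sel_def
      by (intro allI impI order_trans[OF card_image_le card_mono]) auto
    then have "degree_constraint (P X) X Y (DC (P X) X Y)"
      unfolding DC_def by (rule LeastI)
    then show "DC (P X) X Y \<le> d \<Longrightarrow> degree_constraint (P X) X Y d"
      unfolding degree_constraint_def using le_trans by blast
  qed (auto simp: DC_def intro: Least_le)
  then show ?thesis
    using finite_\<X> \<X>_nonempty unfolding max_DC_def by (subst Max_le_iff) auto
qed

lemma max_DC_fam_le_iff: "max_DC (fam f) \<X> Y \<le> d \<longleftrightarrow> bounded f d"
  using finite_R by (subst max_DC_le_iff) (simp_all add: degree_constraint_fam bounded_def, simp add: fam_def)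

text \<open>This lets the threshold in the definition of augmenting paths be read as the counter of
  the algorithm.\<close>

lemma max_DC_fam: "tight f d \<Longrightarrow> max_DC (fam f) \<X> Y = d"
proof (rule antisym)
  assume t: "tight f d"
  then show "max_DC (fam f) \<X> Y \<le> d"
    by (simp add: max_DC_fam_le_iff tight_def)
  have "bounded f (max_DC (fam f) \<X> Y)" using max_DC_fam_le_iff by blast
  then show "d \<le> max_DC (fam f) \<X> Y"
    using t by (fastforce simp: tight_def bounded_def)
qed

lemma augmenting_path_iff:
  assumes "valid f" and "tight f d"
  shows "augmenting_path \<X> Y (fam f) y0 ys Xs \<longleftrightarrow> (\<exists>X. Xs = path_sets f ys X \<and> aug_path f d y0 ys X)"
    (is "?L \<longleftrightarrow> ?R")
proof
  assume L: ?L
  have len: "length Xs = Suc (length ys)" and sub: "set Xs \<subseteq> \<X>"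
    and f: "\<And>i. i < length ys \<Longrightarrow> f (ys ! i) = Some (Xs ! i)"
    and ag: "\<And>i. i < length ys \<Longrightarrow> agree (Xs ! i) (ys ! i) ((y0 # ys) ! i)"
    and c: "card (proj Y (sel (last Xs) (last (y0 # ys)) (fam f (last Xs)))) < d"
    using L max_DC_fam[OF assms(2)] proj_fam[OF assms(1)]
    unfolding augmenting_path_def by auto
  have lX: "last Xs \<in> \<X>" using sub len by (metis in_mono last_in_set list.size(3) nat.simps(3))
  have "Xs ! length ys = last Xs"
    using len by (metis diff_Suc_1 last_conv_nth list.size(3) nat.distinct(1))
  then have "Xs = path_sets f ys (last Xs)"
    unfolding path_sets_def using len f
    by (intro nth_equalityI) (auto simp: nth_append less_Suc_eq simp del: last.simps)
  moreover have "successively (link f) (y0 # ys)"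
    unfolding successively_conv_nth link_def using sub len f ag
    by (auto simp: subset_iff)
  ultimately show ?R using lX c
    by (auto simp: aug_path_def proj_sel_fam simp del: last.simps)
next
  assume ?R
  then obtain X where Xs: "Xs = path_sets f ys X" and su: "successively (link f) (y0 # ys)" and
    X: "X \<in> \<X>" "card (members f X (last (y0 # ys))) < d"
    by (auto simp: aug_path_def)
  have *: "\<exists>X\<in>\<X>. f (ys ! i) = Some X \<and> agree X (ys ! i) ((y0 # ys) ! i)" if "i < length ys" for i
    using su that unfolding successively_conv_nth link_def by auto
  have "set Xs \<subseteq> \<X>"
    using X(1) * by (fastforce simp: Xs path_sets_def in_set_conv_nth)
  then show ?L
    unfolding augmenting_path_def max_DC_fam[OF assms(2)] using X * proj_fam[OF assms(1)]
    by (fastforce simp: Xs path_sets_def nth_append proj_sel_fam simp del: last.simps)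
qed

section \<open>Shifting along a path without repetitions\<close>

lemma shortest_distinct:
  assumes "valid f" and "f y0 = None" and p: "aug_path f d y0 ys X"
    and min: "\<And>ys' X'. aug_path f d y0 ys' X' \<Longrightarrow> length ys \<le> length ys'"
  shows "distinct (y0 # ys)"
proof (rule ccontr)
  assume "\<not> distinct (y0 # ys)"
  then obtain as bs cs y where *: "y0 # ys = as @ [y] @ bs @ [y] @ cs"
    using not_distinct_decomp by blast
  \<comment> \<open>Cutting out the segment between the two occurrences keeps the last tuple. If
    \<open>as\<close> is empty, the repeated tuple is \<open>y0\<close>; either way the shorter list
    still starts with \<open>y0\<close>.\<close>
  obtain ys' where ys': "y0 # ys' = as @ [y] @ cs"
    using * by (cases as) auto
  have "last (y0 # ys') = last (y0 # ys)"
    unfolding * ys' by simp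
  moreover have "successively (link f) (y0 # ys')"
    using p successively_remove_cycle[of "link f" as y bs cs] unfolding aug_path_def * ys' by blast
  ultimately have "aug_path f d y0 ys' X"
    using p unfolding aug_path_def by metis
  from min[OF this] have "length (y0 # ys) \<le> length (y0 # ys')" by simp
  then show False unfolding * ys' by simp
qed

text \<open>Loss and gain stand on opposite sides to avoid subtraction of natural numbers.\<close>

lemma card_members_upd:
  assumes "y0 \<in> D"
  shows "card (members (f(y0 \<mapsto> X1)) X y) + of_bool (f y0 = Some X \<and> agree X y0 y) =
    card (members f X y) + of_bool (X1 = X \<and> agree X y0 y)"
proof -
  let ?M = "{z \<in> D - {y0}. f z = Some X \<and> agree X z y}"
  have fin: "finite ?M" using finite_D by simp
  have "members f X y = (if f y0 = Some X \<and> agree X y0 y then insert y0 ?M else ?M)"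
    and "members (f(y0 \<mapsto> X1)) X y = (if X1 = X \<and> agree X y0 y then insert y0 ?M else ?M)"
    using assms by (auto simp: members_def)
  then show ?thesis using fin by auto
qed

text \<open>The algorithm moves from the far end, but counting is easier from the near end: once
  \<open>y0\<close> has taken the set of \<open>y1\<close>, it is \<open>y1\<close> that seeks a new
  place.\<close>

lemma shift_map_Cons:
  assumes "distinct (y0 # y1 # ys)" "f y1 = Some X1"
  shows "shift_map f y0 (y1 # ys) X = shift_map (f(y0 \<mapsto> X1)) y1 ys X"
proof -
  have eq: "path_sets (f(y0 \<mapsto> X1)) ys X = path_sets f ys X"
    using assms(1) by (auto simp: path_sets_def)
  have eq2: "path_sets f (y1 # ys) X = X1 # path_sets f ys X"
    using assms(2) by (simp add: path_sets_def)
  have "y0 \<notin> dom (map_of (zip (y1 # ys) (path_sets f ys X)))"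
    using assms(1) by (subst dom_map_of_zip) (auto simp: path_sets_def)
  then show ?thesis
    unfolding shift_map_def eq eq2 by (intro ext) (auto simp: map_add_def split: option.splits)
qed

text \<open>Telescoping: each tuple that leaves its group is replaced there by its predecessor,
  because the two agree on the set concerned. The value \<open>f y0\<close> is arbitrary since in
  the induction the new head \<open>y1\<close> still has a set.\<close>

lemma card_members_shift:
  assumes "successively (link f) (y0 # ys)" "distinct (y0 # ys)" "set (y0 # ys) \<subseteq> D"
  shows "card (members (shift_map f y0 ys Xl) X y) + of_bool (f y0 = Some X \<and> agree X y0 y) =
    card (members f X y) + of_bool (Xl = X \<and> agree X (last (y0 # ys)) y)"
  using assms
proof (induction ys arbitrary: f y0)
  case Nil
  have "shift_map f y0 [] Xl = f(y0 \<mapsto> Xl)"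
    by (simp add: shift_map_def path_sets_def)
  then show ?case using card_members_upd[of y0 f Xl X y] Nil by (simp only: last_ConsL list.set insert_subset)
next
  case (Cons y1 ys)
  then obtain X1 where X1: "f y1 = Some X1" "agree X1 y1 y0"
    by (auto simp: link_def)
  have "successively (link (f(y0 \<mapsto> X1))) (y1 # ys)"
  proof (rule successively_mono)
    show "successively (link f) (y1 # ys)" using Cons.prems by simp
  qed (use Cons.prems in \<open>auto simp: link_def\<close>)
  then have "card (members (shift_map (f(y0 \<mapsto> X1)) y1 ys Xl) X y) + of_bool ((f(y0 \<mapsto> X1)) y1 = Some X \<and> agree X y1 y)
    = card (members (f(y0 \<mapsto> X1)) X y) + of_bool (Xl = X \<and> agree X (last (y1 # ys)) y)"
    using Cons.prems by (intro Cons.IH) (simp_all del: fun_upd_apply)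
  \<comment> \<open>By the link, \<open>y0\<close> and \<open>y1\<close> lie in the same group for
    \<open>X1\<close>, so the gain from \<open>y0\<close> cancels the loss from
    \<open>y1\<close>.\<close>
  moreover have "agree X1 y1 y \<longleftrightarrow> agree X1 y0 y"
    using X1(2) agree_trans agree_sym by metis
  then have "(f(y0 \<mapsto> X1)) y1 = Some X \<and> agree X y1 y \<longleftrightarrow> X1 = X \<and> agree X y0 y"
    using Cons.prems X1(1) by auto
  moreover have "shift_map f y0 (y1 # ys) Xl = shift_map (f(y0 \<mapsto> X1)) y1 ys Xl"
    using Cons.prems X1(1) by (intro shift_map_Cons) auto
  moreover have "last (y0 # y1 # ys) = last (y1 # ys)" by simp
  moreover have "y0 \<in> D" using Cons.prems by simp
  note card_members_upd[OF this, of f X1 X y]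
  ultimately show ?case by (simp only:)
qed

lemma valid_shift:
  assumes "valid f" "X \<in> \<X>" "set (y0 # ys) \<subseteq> D" "\<forall>y\<in>set ys. f y \<noteq> None"
  shows "valid (shift_map f y0 ys X)" "dom (shift_map f y0 ys X) = insert y0 (dom f)"
proof -
  have l: "length (y0 # ys) = length (path_sets f ys X)"
    by (simp add: path_sets_def)
  have s: "set (path_sets f ys X) \<subseteq> \<X>"
    using assms by (fastforce simp: path_sets_def valid_def ran_def)
  have d: "dom (map_of (zip (y0 # ys) (path_sets f ys X))) = set (y0 # ys)"
    by (rule dom_map_of_zip[OF l])
  show dd: "dom (shift_map f y0 ys X) = insert y0 (dom f)"
    unfolding shift_map_def dom_map_add d using assms(4) by auto
  have "ran (map_of (zip (y0 # ys) (path_sets f ys X))) \<subseteq> \<X>"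
    using s by (auto simp: ran_def dest!: map_of_SomeD set_zip_rightD)
  then have "ran (shift_map f y0 ys X) \<subseteq> \<X>"
    using assms(1) unfolding shift_map_def valid_def ran_def by (auto simp: map_add_Some_iff)
  then show "valid (shift_map f y0 ys X)"
    using dd assms by (auto simp: valid_def)
qed

text \<open>One group grows, by a single tuple, and it had fewer than \<open>d\<close> members; as
  \<open>y0\<close> was unassigned, no group shrinks, so the group that attains \<open>d\<close>
  keeps doing so.\<close>

lemma tight_shift:
  assumes "valid f" "f y0 = None" "y0 \<in> D" "aug_path f d y0 ys X" "distinct (y0 # ys)" "tight f d"
  shows "tight (shift_map f y0 ys X) d"
proof -
  have su: "successively (link f) (y0 # ys)" and c: "card (members f X (last (y0 # ys))) < d"
    using assms(4) by (auto simp: aug_path_def)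
  have "\<forall>y\<in>set ys. f y \<noteq> None"
    using su unfolding successively_conv_nth link_def by (fastforce simp: in_set_conv_nth)
  then have "set (y0 # ys) \<subseteq> D" using assms by (auto simp: valid_def)
  note * = card_members_shift[OF su assms(5) this, of X, unfolded assms(2)]
  have "card (members (shift_map f y0 ys X) X' y) \<le> d" if "X' \<in> \<X>" "y \<in> D" for X' y
  proof (cases "X = X' \<and> agree X' (last (y0 # ys)) y")
    case True
    then show ?thesis using *[of X' y] members_cong[of X' "last (y0 # ys)" y f] c by (simp split: if_splits)
  next
    case False
    then have "card (members (shift_map f y0 ys X) X' y) = card (members f X' y)"
      using *[of X' y] by (simp del: last.simps)
    then show ?thesis using assms(6) that by (auto simp: tight_def bounded_def)
  qed
  moreover have "card (members f X' y) \<le> card (members (shift_map f y0 ys X) X' y)" for X' y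
    using *[of X' y] by simp
  ultimately show ?thesis
    using assms(6) unfolding tight_def bounded_def by (meson order_trans)
qed


section \<open>Iterations of the algorithm in terms of maps\<close>

definition state_of :: "(('v, 'a) tuple \<rightharpoonup> 'v set) \<Rightarrow> nat \<Rightarrow> ('v, 'a) state" where
  "state_of f d = ({t \<in> R. t |` Y \<notin> dom f}, fam f, d)"

lemma add_to_fam:
  assumes "y \<in> D" "g y = None"
  shows "add_to X {t \<in> R. t |` Y = y} (fam g) = fam (g(y \<mapsto> X))"
  using assms by (intro ext) (auto simp: add_to_def fam_def)

lemma move_fam:
  assumes "y \<in> D" "g y = Some A"
  shows "move Y y A B (fam g) = fam (g(y \<mapsto> B))"
proof -
  have S: "sel Y y (fam g A) = {t \<in> R. t |` Y = y}"
    using assms by (auto simp: sel_D fam_def)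
  show ?thesis
    unfolding move_def S Let_def add_to_def using assms
    by (intro ext set_eqI) (auto simp: fam_def)
qed

lemma shift_along_fam:
  assumes "distinct ys" "set ys \<subseteq> D" "length Xs = Suc (length ys)"
    and f: "\<And>i. i < length ys \<Longrightarrow> f (ys ! i) = Some (Xs ! i)"
  shows "shift_along Y ys Xs (fam f) = fam (f ++ map_of (zip ys (tl Xs)))"
proof -
  \<comment> \<open>The map after the moves with index at least \<open>j\<close>;
    \<open>foldr\<close> performs those with large indices first, hence the downward
    induction.\<close>
  let ?g = "\<lambda>j. f ++ map_of (zip (drop j ys) (drop (Suc j) Xs))"
  have "foldr (\<lambda>i. move Y (ys ! i) (Xs ! i) (Xs ! Suc i)) [j..<length ys] (fam f) = fam (?g j)"
    if "j \<le> length ys" for j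
    using that
  proof (induction j rule: inc_induct)
    case (step j)
    \<comment> \<open>Here the absence of repetitions enters: the moves made so far have not touched
      \<open>ys ! j\<close>, so it is still in its original part.\<close>
    have "ys ! j \<notin> set (drop (Suc j) ys)"
      using assms(1) step.hyps by (metis Cons_nth_drop_Suc distinct.simps(2) distinct_drop)
    then have "map_of (zip (drop (Suc j) ys) (drop (Suc (Suc j)) Xs)) (ys ! j) = None"
      using assms(3) by (subst map_of_zip_is_None) auto
    then have "?g (Suc j) (ys ! j) = Some (Xs ! j)"
      using f step.hyps by (simp add: map_add_def)
    then have "move Y (ys ! j) (Xs ! j) (Xs ! Suc j) (fam (?g (Suc j))) = fam ((?g (Suc j))(ys ! j \<mapsto> Xs ! Suc j))"
      using assms(2) step.hyps by (intro move_fam) auto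
    also have "(?g (Suc j))(ys ! j \<mapsto> Xs ! Suc j) = ?g j"
      using step.hyps assms(3) by (simp add: Cons_nth_drop_Suc[symmetric])
    finally show ?case
      using step by (simp add: upt_conv_Cons)
  qed simp
  from this[of 0] show ?thesis
    by (simp add: shift_along_def drop_Suc)
qed

text \<open>The equation in the last claim is stated separately because it serves both to construct
  an iteration and to analyse a given one.\<close>

lemma eda_iteration_augment:
  assumes "valid f" "tight f d" "y0 \<in> D" "f y0 = None" and p: "aug_path f d y0 ys X"
    and min: "\<And>ys' X'. aug_path f d y0 ys' X' \<Longrightarrow> length ys \<le> length ys'"
  defines "f' \<equiv> shift_map f y0 ys X"
  shows "eda_iteration \<X> Y y0 (state_of f d) (state_of f' d)"
    and "valid f'" "dom f' = insert y0 (dom f)" "tight f' d"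
    and "({t \<in> R. t |` Y \<notin> dom f} - sel Y y0 {t \<in> R. t |` Y \<notin> dom f},
      add_to (hd (path_sets f ys X)) (sel Y y0 {t \<in> R. t |` Y \<notin> dom f})
        (shift_along Y ys (path_sets f ys X) (fam f)), d) = state_of f' d" (is ?eq)
proof -
  have d: "distinct (y0 # ys)"
    by (rule shortest_distinct[OF assms(1,4) p]) (rule min)
  have su: "successively (link f) (y0 # ys)" and X: "X \<in> \<X>"
    using p by (auto simp: aug_path_def)
  have f: "\<forall>y\<in>set ys. f y \<noteq> None"
    using su unfolding successively_conv_nth link_def by (fastforce simp: in_set_conv_nth)
  then have D: "set (y0 # ys) \<subseteq> D" using assms by (auto simp: valid_def)
  show f': "valid f'" "dom f' = insert y0 (dom f)" "tight f' d"
    using valid_shift[OF assms(1) X D f] tight_shift[OF assms(1,4,3) p d assms(2)]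
    by (auto simp: f'_def)
  have short: "shortest_augmenting_path \<X> Y (fam f) y0 ys (path_sets f ys X)"
    unfolding shortest_augmenting_path_def augmenting_path_iff[OF assms(1,2)]
    using p min by blast
  let ?S = "sel Y y0 {t \<in> R. t |` Y \<notin> dom f}"
  have S: "?S = {t \<in> R. t |` Y = y0}"
    using assms(3,4) by (auto simp: sel_D)
  let ?Xs = "path_sets f ys X"
  have sh: "shift_along Y ys ?Xs (fam f) = fam (f ++ map_of (zip ys (tl ?Xs)))"
    using d D f by (intro shift_along_fam) (auto simp: path_sets_def nth_append)
  have "(f ++ map_of (zip ys (tl ?Xs))) y0 = None"
    using d assms(4) by (auto simp: path_sets_def map_add_def map_of_zip_is_None split: option.splits
        dest: map_of_SomeD set_zip_leftD)
  then have "add_to (hd ?Xs) ?S (shift_along Y ys ?Xs (fam f)) =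
      fam ((f ++ map_of (zip ys (tl ?Xs)))(y0 \<mapsto> hd ?Xs))"
    unfolding S sh using assms(3) by (intro add_to_fam) auto
  also have "(f ++ map_of (zip ys (tl ?Xs)))(y0 \<mapsto> hd ?Xs) = f'"
    unfolding f'_def shift_map_def by (cases ?Xs) (auto simp: path_sets_def)
  finally show ?eq
    unfolding state_of_def S f'(2) by auto
  then show "eda_iteration \<X> Y y0 (state_of f d) (state_of f' d)"
    using eda_iteration.augment[OF short refl, of "{t \<in> R. t |` Y \<notin> dom f}" d]
    by (simp add: state_of_def)
qed

text \<open>If there is no augmenting path, even the empty one fails for every \<open>X\<close>. So
  whichever \<open>X\<close> is chosen, the group of \<open>y0\<close> already has \<open>d\<close>
  members, and adding \<open>y0\<close> attains the new bound \<open>Suc d\<close>.\<close>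

lemma tight_grow:
  assumes "valid f" "tight f d" "y0 \<in> D" "f y0 = None" "X \<in> \<X>"
    and no: "\<nexists>ys X. aug_path f d y0 ys X"
  defines "f' \<equiv> f(y0 \<mapsto> X)"
  shows "valid f'" "dom f' = insert y0 (dom f)" "tight f' (Suc d)"
    and "({t \<in> R. t |` Y \<notin> dom f} - sel Y y0 {t \<in> R. t |` Y \<notin> dom f},
      add_to X (sel Y y0 {t \<in> R. t |` Y \<notin> dom f}) (fam f), d + 1) = state_of f' (Suc d)"
proof -
  show "valid f'" "dom f' = insert y0 (dom f)"
    using assms by (auto simp: valid_def f'_def ran_def)
  have "\<not> aug_path f d y0 [] X" using no by blast
  then have "d \<le> card (members f X y0)"
    using assms(5) by (simp add: aug_path_def)
  moreover have "agree X y0 y0" by (simp add: agree_def)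
  ultimately have "Suc d \<le> card (members f' X y0)"
    using card_members_upd[OF assms(3), of f X X y0] assms(4) by (simp add: f'_def)
  moreover have "card (members f' X' y) \<le> Suc d" if "X' \<in> \<X>" "y \<in> D" for X' y
  proof -
    have "card (members f' X' y) \<le> Suc (card (members f X' y))"
      using card_members_upd[OF assms(3), of f X X' y] of_bool_less_eq_one[where 'a = nat and P = "X = X' \<and> agree X' y0 y"]
      unfolding f'_def by linarith
    also have "\<dots> \<le> Suc d" using assms(2) that by (auto simp: tight_def bounded_def)
    finally show ?thesis .
  qed
  ultimately show "tight f' (Suc d)"
    using assms(3,5) unfolding tight_def bounded_def by blast
  have S: "sel Y y0 {t \<in> R. t |` Y \<notin> dom f} = {t \<in> R. t |` Y = y0}"
    using assms(3,4) by (auto simp: sel_D)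
  show "({t \<in> R. t |` Y \<notin> dom f} - sel Y y0 {t \<in> R. t |` Y \<notin> dom f},
      add_to X (sel Y y0 {t \<in> R. t |` Y \<notin> dom f}) (fam f), d + 1) = state_of f' (Suc d)"
    unfolding S add_to_fam[of y0 f, OF assms(3,4)] state_of_def f'_def by auto
qed

lemma eda_iteration_grow:
  assumes "valid f" "tight f d" "y0 \<in> D" "f y0 = None" "X \<in> \<X>"
    and no: "\<nexists>ys X. aug_path f d y0 ys X"
  shows "eda_iteration \<X> Y y0 (state_of f d) (state_of (f(y0 \<mapsto> X)) (Suc d))"
proof -
  have no': "\<nexists>ys Xs. augmenting_path \<X> Y (fam f) y0 ys Xs"
    using no augmenting_path_iff[OF assms(1,2)] by blast
  show ?thesis
    using eda_iteration.grow[OF no' assms(5) refl, of "{t \<in> R. t |` Y \<notin> dom f}" d] tight_grow(4)[OF assms]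
    by (simp add: state_of_def)
qed

lemma eda_iteration_cases:
  assumes "valid f" "tight f d" "y0 \<in> D" "f y0 = None"
    and "eda_iteration \<X> Y y0 (state_of f d) s'"
  obtains f' d' where "s' = state_of f' d'" "valid f'" "tight f' d'" "dom f' = insert y0 (dom f)"
    "d' = d \<or> d' = Suc d \<and> (\<nexists>ys X. aug_path f d y0 ys X)"
proof -
  let ?R = "{t \<in> R. t |` Y \<notin> dom f}"
  from assms(5)[unfolded state_of_def eda_iteration_iff]
  consider (augment) ys Xs where "shortest_augmenting_path \<X> Y (fam f) y0 ys Xs"
      "s' = (?R - sel Y y0 ?R, add_to (hd Xs) (sel Y y0 ?R) (shift_along Y ys Xs (fam f)), d)"
    | (grow) X where "\<nexists>ys Xs. augmenting_path \<X> Y (fam f) y0 ys Xs" "X \<in> \<X>"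
      "s' = (?R - sel Y y0 ?R, add_to X (sel Y y0 ?R) (fam f), d + 1)"
    by (elim disjE exE conjE bexE)
  then show thesis
  proof cases
    case augment
    then obtain X where Xs: "Xs = path_sets f ys X" and p: "aug_path f d y0 ys X"
      unfolding shortest_augmenting_path_def augmenting_path_iff[OF assms(1,2)] by blast
    have min: "length ys \<le> length ys'" if "aug_path f d y0 ys' X'" for ys' X'
      using augment(1) that
      unfolding shortest_augmenting_path_def augmenting_path_iff[OF assms(1,2)] by blast
    show thesis
    proof (rule that)
      show "s' = state_of (shift_map f y0 ys X) d"
        unfolding augment(2) Xs using eda_iteration_augment(5)[OF assms(1-4) p min] .
    qed (use eda_iteration_augment(2-4)[OF assms(1-4) p min] in simp_all)
  next
    case grow
    have no: "\<nexists>ys X. aug_path f d y0 ys X"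
      using grow(1) unfolding augmenting_path_iff[OF assms(1,2)] by blast
    show thesis
    proof (rule that)
      show "s' = state_of (f(y0 \<mapsto> X)) (Suc d)"
        unfolding grow(3) using tight_grow(4)[OF assms(1-4) grow(2) no] .
    qed (use tight_grow(1-3)[OF assms(1-4) grow(2) no] no in simp_all)
  qed
qed

text \<open>Let \<open>W\<close> be the set of tuples reachable from \<open>y0\<close> and \<open>G\<close> the set of groups met by \<open>W\<close>. Each group
  in \<open>G\<close> is full and contained in \<open>W\<close>, whence \<open>d * card G < card W\<close>; but a partitioning of value at
  most \<open>d\<close> would distribute \<open>W\<close> over \<open>G\<close> with at most \<open>d\<close> tuples in each group.\<close>

lemma no_aug_path_lower_bound:
  assumes "valid f" "y0 \<in> D" "f y0 = None"
    and no: "\<nexists>ys X. aug_path f d y0 ys X" and part: "is_partitioning R \<X> P"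
  shows "d < max_DC P \<X> Y"
proof (rule ccontr)
  assume "\<not> d < max_DC P \<X> Y"
  then have le: "max_DC P \<X> Y \<le> d" by simp
  have finP: "finite (P X)" if "X \<in> \<X>" for X
  proof (rule finite_subset[OF _ finite_R])
    show "P X \<subseteq> R" using part that by (auto simp: is_partitioning_def)
  qed
  have deg: "\<forall>X\<in>\<X>. degree_constraint (P X) X Y d"
    by (rule iffD1[OF max_DC_le_iff le]) (rule finP)
  define W where "W = {last (y0 # ys) | ys. successively (link f) (y0 # ys)}"
  \<comment> \<open>A group is coded by its set together with the common restriction; the set is
    kept so that groups for different sets stay apart.\<close>
  define G where "G = (\<lambda>(X, w). (X, w |` X)) ` (\<X> \<times> W)"
  define A where "A = (\<lambda>(X, x). {z \<in> D. f z = Some X \<and> z |` X = x})"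
  define B where "B = (\<lambda>(X, x). {z \<in> proj Y (P X). z |` X = x})"
  have y0W: "y0 \<in> W"
    unfolding W_def by (auto intro: exI[of _ "[]"])
  have closed: "z \<in> W" if "w \<in> W" "link f w z" for w z
  proof -
    obtain ys where ys: "w = last (y0 # ys)" "successively (link f) (y0 # ys)"
      using \<open>w \<in> W\<close> by (auto simp: W_def)
    have "successively (link f) ((y0 # ys) @ [z])"
      using ys that(2) by (subst successively_append_iff) auto
    then show ?thesis unfolding W_def by (auto intro!: exI[of _ "ys @ [z]"])
  qed
  have WD: "W \<subseteq> D"
  proof
    fix w assume "w \<in> W"
    then obtain ys where ys: "w = last (y0 # ys)" "successively (link f) (y0 # ys)"
      by (auto simp: W_def)
    show "w \<in> D"
    proof (cases ys rule: rev_cases)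
      case (snoc as a)
      have "link f (last (y0 # as)) a"
        using ys(2) snoc successively_append_iff[of "link f" "y0 # as" "[a]"] by auto
      then show ?thesis using assms(1) ys(1) snoc by (auto simp: link_def valid_def)
    qed (use ys assms in auto)
  qed
  have finW: "finite W" using WD finite_D by (rule finite_subset)
  have finG: "finite G" using finW finite_\<X> by (simp add: G_def)
  have "d * card G = (\<Sum>g\<in>G. d)" by simp
  also have "\<dots> \<le> (\<Sum>g\<in>G. card (A g))"
  proof (rule sum_mono)
    fix g assume "g \<in> G"
    then obtain X w where g: "g = (X, w |` X)" "X \<in> \<X>" "w \<in> W" by (auto simp: G_def)
    then obtain ys where ys: "w = last (y0 # ys)" "successively (link f) (y0 # ys)"
      by (auto simp: W_def)
    have "\<not> aug_path f d y0 ys X" using no by blast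
    then have "d \<le> card (members f X w)"
      using ys g(2) by (auto simp: aug_path_def)
    also have "members f X w = A g"
      by (auto simp: members_def A_def g agree_iff_restrict_eq)
    finally show "d \<le> card (A g)" .
  qed
  \<comment> \<open>The groups of the current family are disjoint: \<open>f z\<close> determines the
    set, and then \<open>z\<close> determines the restriction.\<close>
  also have "\<dots> = card (\<Union>g\<in>G. A g)"
    using finG finite_D by (subst card_UN_disjoint) (auto simp: A_def)
  \<comment> \<open>All full groups lie in \<open>W\<close> because it is closed under links, and
    none contains the unassigned \<open>y0\<close>. This one missing tuple makes the final
    inequality strict.\<close>
  also have "\<dots> \<le> card (W - {y0})"
  proof (rule card_mono)
    have "z \<in> W - {y0}" if "X \<in> \<X>" "w \<in> W" "z \<in> D" "f z = Some X" "z |` X = w |` X" for X w z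
      using closed[of w z] that assms(3) by (auto simp: link_def agree_iff_restrict_eq)
    then show "(\<Union>g\<in>G. A g) \<subseteq> W - {y0}"
      by (auto simp: G_def A_def)
  qed (use finW in auto)
  also have "\<dots> < card W"
    using finW y0W by (meson card_Diff1_less)
  also have "\<dots> \<le> card (\<Union>g\<in>G. B g)"
  proof (rule card_mono)
    show "finite (\<Union>g\<in>G. B g)"
      using finG finP by (auto simp: B_def proj_def) (auto simp: G_def)
    show "W \<subseteq> (\<Union>g\<in>G. B g)"
    proof
      fix w assume w: "w \<in> W"
      then obtain t where t: "t \<in> R" "w = t |` Y" using WD by (auto simp: proj_def)
      then obtain X where X: "X \<in> \<X>" "t \<in> P X" using part by (auto simp: is_partitioning_def)
      show "w \<in> (\<Union>g\<in>G. B g)"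
      proof (rule UN_I)
        show "(X, w |` X) \<in> G" using X(1) w by (force simp: G_def)
        show "w \<in> B (X, w |` X)" using X(2) t by (auto simp: B_def proj_def)
      qed
    qed
  qed
  \<comment> \<open>A partitioning may split a class, so a tuple can be counted in several of these
    groups; the union bound still gives the right direction.\<close>
  also have "\<dots> \<le> (\<Sum>g\<in>G. card (B g))"
    by (rule card_UN_le[OF finG])
  also have "\<dots> \<le> (\<Sum>g\<in>G. d)"
  proof (rule sum_mono)
    fix g assume "g \<in> G"
    then obtain X w where g: "g = (X, w |` X)" "X \<in> \<X>" "w \<in> W" by (auto simp: G_def)
    have "dom (w |` X) = X"
      using dom_D[of w] WD g sub_Y[OF g(2)] by auto
    then have "card (proj Y (sel X (w |` X) (P X))) \<le> d"
      using deg g(2) unfolding degree_constraint_def by blast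
    also have "proj Y (sel X (w |` X) (P X)) = B g"
      using sub_Y[OF g(2)]
      by (auto simp: proj_def sel_def B_def g(1) agree_iff_restrict_eq Int_absorb1 Int_absorb2)
    finally show "card (B g) \<le> d" .
  qed
  also have "\<dots> = d * card G" by simp
  finally show False by simp
qed

section \<open>The invariant of a run\<close>

lemma initial_state: "(R, (\<lambda>_. {}), 0) = state_of Map.empty 0"
  by (simp add: state_of_def fam_def fun_eq_iff)

lemma valid_empty: "valid Map.empty" "tight Map.empty 0"
  by (auto simp: valid_def tight_def bounded_def members_def)

text \<open>The lower bound concerns partitionings of all of \<open>R\<close>, not of the tuples
  treated so far. It persists when \<open>d\<close> is kept and is obtained afresh by counting
  whenever \<open>d\<close> grows.\<close>

lemma eda_run_invariant:
  assumes "eda_run R \<X> Y y0s ss" "k \<le> length y0s"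
  shows "\<exists>f d. ss ! k = state_of f d \<and> valid f \<and> tight f d \<and> dom f = set (take k y0s) \<and>
    (\<forall>P. is_partitioning R \<X> P \<longrightarrow> d \<le> max_DC P \<X> Y)"
  using assms(2)
proof (induction k)
  case 0
  show ?case
    using assms(1) initial_state valid_empty
    by (intro exI[of _ Map.empty] exI[of _ 0]) (auto simp: eda_run_def)
next
  case (Suc k)
  then obtain f d where f: "ss ! k = state_of f d" "valid f" "tight f d" "dom f = set (take k y0s)"
    and le: "\<And>P. is_partitioning R \<X> P \<Longrightarrow> d \<le> max_DC P \<X> Y"
    by auto
  have k: "k < length y0s" using Suc.prems by simp
  then have it: "eda_iteration \<X> Y (y0s ! k) (state_of f d) (ss ! Suc k)"
    using assms(1) f(1) by (auto simp: eda_run_def)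
  have y0: "y0s ! k \<in> D"
    using assms(1) nth_mem[OF k] by (simp add: eda_run_def)
  have "y0s ! k \<notin> set (take k y0s)"
    using assms(1) Suc.prems unfolding eda_run_def
    by (auto simp: in_set_conv_nth nth_eq_iff_index_eq)
  then have n: "f (y0s ! k) = None" using f(4) by blast
  from eda_iteration_cases[OF f(2,3) y0 n it] obtain f' d' where
    f': "ss ! Suc k = state_of f' d'" "valid f'" "tight f' d'" "dom f' = insert (y0s ! k) (dom f)"
    and d': "d' = d \<or> d' = Suc d \<and> (\<nexists>ys X. aug_path f d (y0s ! k) ys X)"
    by metis
  have "d' \<le> max_DC P \<X> Y" if "is_partitioning R \<X> P" for P
    using d' le[OF that] no_aug_path_lower_bound[OF f(2) y0 n _ that] by (metis Suc_leI)
  moreover have "dom f' = set (take (Suc k) y0s)"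
    using f'(4) f(4) Suc.prems by (simp add: take_Suc_conv_app_nth)
  ultimately show ?case using f' by blast
qed

theorem eda_run_correct:
  assumes "eda_run R \<X> Y y0s ss" "last ss = (R', P, d)"
  shows "is_partitioning R \<X> P" "d = PC R \<X> Y" "\<forall>X\<in>\<X>. degree_constraint (P X) X Y d"
proof -
  have "last ss = ss ! length y0s"
    using assms(1) last_conv_nth[of ss] by (cases ss) (auto simp: eda_run_def)
  then obtain f where P: "P = fam f" and f: "valid f" "tight f d" "dom f = D"
    and le: "\<And>P. is_partitioning R \<X> P \<Longrightarrow> d \<le> max_DC P \<X> Y"
    using eda_run_invariant[OF assms(1) order_refl] assms unfolding state_of_def eda_run_def by auto
  show part: "is_partitioning R \<X> P"
    unfolding is_partitioning_def disjoint_family_on_def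
  proof (intro conjI ballI impI)
    show "(\<Union>X\<in>\<X>. P X) = R"
    proof (intro equalityI subsetI)
      fix t assume t: "t \<in> R"
      then have "t |` Y \<in> dom f" using f(3) by (auto simp: proj_def)
      then show "t \<in> (\<Union>X\<in>\<X>. P X)"
        using f(1) t by (auto simp: P fam_def valid_def ran_def)
    qed (auto simp: P fam_def)
  qed (auto simp: P fam_def)
  have max: "max_DC P \<X> Y = d" using max_DC_fam[OF f(2)] by (simp add: P)
  show "d = PC R \<X> Y"
    unfolding PC_def
  proof (rule antisym)
    show "d \<le> Inf {max_DC P \<X> Y |P. is_partitioning R \<X> P}"
      using part le by (intro cInf_greatest) auto
    show "Inf {max_DC P \<X> Y |P. is_partitioning R \<X> P} \<le> d"
      using part max by (intro cInf_lower) auto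
  qed
  show "\<forall>X\<in>\<X>. degree_constraint (P X) X Y d"
    using max_DC_fam_le_iff f(2) by (auto simp: P tight_def bounded_def degree_constraint_fam)
qed

end

section \<open>Total correctness with exact running time\<close>

lemma config_after_0 [simp]: "config_after 0 c = c"
  by (simp add: config_after_def)

lemma config_after_Suc: "config_after (Suc t) c = config_after t (machine_step c)"
  by (simp add: config_after_def funpow_swap1)

lemma config_after_add: "config_after (s + t) c = config_after t (config_after s c)"
  unfolding config_after_def by (subst add.commute) (simp add: funpow_add)

text \<open>The machine keeps its pending commands in one flat list; quantifying over the
  continuation \<open>rest\<close> makes runs composable.\<close>

definition run :: "'v com list \<Rightarrow> 'v memory \<Rightarrow> nat \<Rightarrow> 'v memory \<Rightarrow> bool" where
  "run cs m t m' \<longleftrightarrow> (\<forall>rest. config_after t (cs @ rest, m) = (rest, m'))"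

text \<open>The first argument of the postcondition is the exact number of steps.\<close>

definition wp :: "'v com list \<Rightarrow> (nat \<Rightarrow> 'v memory \<Rightarrow> bool) \<Rightarrow> 'v memory \<Rightarrow> bool" where
  "wp cs Q m \<longleftrightarrow> (\<exists>t m'. run cs m t m' \<and> Q t m')"

lemma wpI: "run cs m t m' \<Longrightarrow> Q t m' \<Longrightarrow> wp cs Q m"
  unfolding wp_def by blast

lemma wp_mono: "wp cs Q m \<Longrightarrow> (\<And>t m'. Q t m' \<Longrightarrow> Q' t m') \<Longrightarrow> wp cs Q' m"
  unfolding wp_def by blast

lemma wp_Nil: "Q 0 m \<Longrightarrow> wp [] Q m"
  by (rule wpI[of _ _ 0]) (simp_all add: run_def)

lemma wp_step:
  assumes "\<And>rest. machine_step (cs @ rest, m) = (cs' @ rest, m1)" and "wp cs' (\<lambda>t. Q (Suc t)) m1"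
  shows "wp cs Q m"
proof -
  obtain t m' where "run cs' m1 t m'" "Q (Suc t) m'" using assms(2) by (auto simp: wp_def)
  then show ?thesis
    by (intro wpI[of _ _ "Suc t" m']) (simp_all add: run_def config_after_Suc assms(1))
qed

lemma wp_Write:
  assumes "wp cs (\<lambda>t. Q (Suc t)) (m(a := (m a)(expr_val m e := expr_val m f)))"
  shows "wp (Write a e f # cs) Q m"
  using assms by (rule wp_step[rotated]) (simp add: fun_upd_def)

lemma wp_Cond:
  assumes "wp ((if test_val m b then cs1 else cs2) @ cs) (\<lambda>t. Q (Suc t)) m"
  shows "wp (Cond b cs1 cs2 # cs) Q m"
  using assms by (rule wp_step[rotated]) simp

lemma wp_append:
  assumes "wp cs1 (\<lambda>s m1. wp cs2 (\<lambda>t. Q (s + t)) m1) m"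
  shows "wp (cs1 @ cs2) Q m"
proof -
  obtain s m1 t m2 where "run cs1 m s m1" "run cs2 m1 t m2" "Q (s + t) m2"
    using assms by (auto simp: wp_def)
  then show ?thesis
    by (intro wpI[of _ _ "s + t" m2]) (simp_all add: run_def config_after_add)
qed

text \<open>The potential yields termination and the time bound together: each round must release
  its own steps plus one for the test. The outer \<open>Suc\<close> pays for the test that
  fails.\<close>

lemma wp_While:
  assumes inv: "I m"
    and body: "\<And>m. I m \<Longrightarrow> test_val m b \<Longrightarrow> wp cs (\<lambda>t m'. I m' \<and> Suc t + \<phi> m' \<le> \<phi> m) m"
  shows "wp [While b cs] (\<lambda>t m'. I m' \<and> \<not> test_val m' b \<and> t + \<phi> m' \<le> Suc (\<phi> m)) m"
  using inv
proof (induction "\<phi> m" arbitrary: m rule: less_induct)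
  case less
  show ?case
  proof (cases "test_val m b")
    case True
    have "wp (cs @ [While b cs]) (\<lambda>t m'. I m' \<and> \<not> test_val m' b \<and> Suc t + \<phi> m' \<le> Suc (\<phi> m)) m"
    proof (rule wp_append, rule wp_mono[OF body[OF less.prems True]])
      fix s m1 assume *: "I m1 \<and> Suc s + \<phi> m1 \<le> \<phi> m"
      show "wp [While b cs] (\<lambda>t m'. I m' \<and> \<not> test_val m' b \<and> Suc (s + t) + \<phi> m' \<le> Suc (\<phi> m)) m1"
        using * by (intro wp_mono[OF less.hyps[of m1]]) auto
    qed
    then show ?thesis using True by - (rule wp_step[where cs' = "cs @ [While b cs]" and ?m1.0 = m], auto)
  next
    case False
    then show ?thesis using less.prems
      by (intro wp_step[where cs' = "[]", OF _ wp_Nil]) auto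
  qed
qed

text \<open>Loops over the sets are unrolled in the program text, so they need a rule for
  concatenations. The potential lets single blocks exceed \<open>B\<close> at the expense of stored
  credit.\<close>

lemma wp_concat_map:
  assumes "I a m"
    and body: "\<And>k m. a \<le> k \<Longrightarrow> k < b \<Longrightarrow> I k m \<Longrightarrow> wp (cs k) (\<lambda>t m'. I (Suc k) m' \<and> t + \<phi> m' \<le> B + \<phi> m) m"
    and "a \<le> b"
  shows "wp (concat (map cs [a..<b])) (\<lambda>t m'. I b m' \<and> t + \<phi> m' \<le> (b - a) * B + \<phi> m) m"
  using assms(3,1)
proof (induction b rule: dec_induct)
  case base
  then show ?case by (auto intro: wp_Nil)
next
  case (step k)
  have "wp (concat (map cs [a..<k]) @ cs k) (\<lambda>t m'. I (Suc k) m' \<and> t + \<phi> m' \<le> (Suc k - a) * B + \<phi> m) m"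
  proof (rule wp_append, rule wp_mono[OF step.IH])
    fix s m1 assume *: "I k m1 \<and> s + \<phi> m1 \<le> (k - a) * B + \<phi> m"
    have "(Suc k - a) * B = (k - a) * B + B"
      using step.hyps by (simp add: Suc_diff_le)
    with * show "wp (cs k) (\<lambda>t m'. I (Suc k) m' \<and> s + t + \<phi> m' \<le> (Suc k - a) * B + \<phi> m) m1"
      using step.hyps by (intro wp_mono[OF body]) auto
  qed (use step in auto)
  then show ?case using step.hyps by simp
qed

section \<open>Frame rule and counting loops\<close>

fun writes :: "'v com \<Rightarrow> 'v array set" where
  "writes (Write a e f) = {a}"
| "writes (Cond b cs1 cs2) = \<Union> (set (map writes cs1)) \<union> \<Union> (set (map writes cs2))"
| "writes (While b cs) = \<Union> (set (map writes cs))"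

abbreviation writes_list :: "'v com list \<Rightarrow> 'v array set" where
  "writes_list cs \<equiv> \<Union> (set (map writes cs))"

lemma writes_list_concat:
  "writes_list (concat (map cs [a..<b])) = (\<Union>k\<in>{a..<b}. writes_list (cs k))"
  by auto

lemma frame_step:
  assumes "machine_step (cs, m) = (cs', m')"
  shows "writes_list cs' \<subseteq> writes_list cs" "a \<notin> writes_list cs \<Longrightarrow> m' a = m a"
  using assms by (induction "(cs, m)" rule: machine_step.induct) (auto split: if_split_asm, blast+)

lemma frame:
  assumes "config_after t (cs, m) = (cs', m')" "a \<notin> writes_list cs"
  shows "m' a = m a"
  using assms
proof (induction t arbitrary: cs m)
  case (Suc t)
  obtain cs1 m1 where s: "machine_step (cs, m) = (cs1, m1)" by fastforce
  then have "a \<notin> writes_list cs1" "m1 a = m a"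
    using frame_step[OF s] Suc.prems(2) by blast+
  then show ?case using Suc s by (metis config_after_Suc)
qed simp

lemma wp_frame:
  assumes "wp cs Q m"
  shows "wp cs (\<lambda>t m'. Q t m' \<and> (\<forall>a. a \<notin> writes_list cs \<longrightarrow> m' a = m a)) m"
proof -
  obtain t m' where r: "run cs m t m'" "Q t m'" using assms by (auto simp: wp_def)
  then have "config_after t (cs, m) = ([], m')"
    using append_Nil2 unfolding run_def by metis
  from frame[OF this] r show ?thesis by (intro wpI[OF r(1)]) auto
qed

lemma wp_seq:
  assumes "wp cs1 (\<lambda>t m'. t \<le> b1 \<and> Q1 m') m"
    and "\<And>m'. Q1 m' \<Longrightarrow> (\<And>a. a \<notin> writes_list cs1 \<Longrightarrow> m' a = m a) \<Longrightarrow> wp cs2 (\<lambda>t m'. t \<le> b2 \<and> Q m') m'"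
  shows "wp (cs1 @ cs2) (\<lambda>t m'. t \<le> b1 + b2 \<and> Q m') m"
proof (rule wp_append, rule wp_mono[OF wp_frame[OF assms(1)]])
  fix t1 m1 assume *: "(t1 \<le> b1 \<and> Q1 m1) \<and> (\<forall>a. a \<notin> writes_list cs1 \<longrightarrow> m1 a = m a)"
  then have "wp cs2 (\<lambda>t m'. t \<le> b2 \<and> Q m') m1" by (intro assms(2)) blast+
  then show "wp cs2 (\<lambda>t m'. t1 + t \<le> b1 + b2 \<and> Q m') m1"
    by (rule wp_mono) (use * in simp)
qed

abbreviation V :: "'v array \<Rightarrow> 'v expr" where "V a \<equiv> Read a (Const 0)"

definition for_loop :: "'v array \<Rightarrow> 'v expr \<Rightarrow> 'v com list \<Rightarrow> 'v com list" where
  "for_loop v e cs =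
     [Write v (Const 0) (Const 0), While (Less (V v) e) (cs @ [Write v (Const 0) (Succ (V v))])]"

lemma wp_concat_loop:
  assumes init: "I 0 m0"
    and body: "\<And>k m. k < K \<Longrightarrow> I k m \<Longrightarrow> (\<And>a. a \<notin> (\<Union>k<K. writes_list (cs k)) \<Longrightarrow> m a = m0 a) \<Longrightarrow>
      wp (cs k) (\<lambda>t m'. t \<le> B \<and> I (Suc k) m') m"
  shows "wp (concat (map cs [0..<K])) (\<lambda>t m'. t \<le> K * B \<and> I K m') m0"
proof (rule wp_mono[OF wp_concat_map[where \<phi> = "\<lambda>_. 0" and B = B and
        I = "\<lambda>k m. I k m \<and> (\<forall>a. a \<notin> (\<Union>k<K. writes_list (cs k)) \<longrightarrow> m a = m0 a)"]])
  fix k m assume *: "k < K" "I k m \<and> (\<forall>a. a \<notin> (\<Union>k<K. writes_list (cs k)) \<longrightarrow> m a = m0 a)"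
  then have "wp (cs k) (\<lambda>t m'. t \<le> B \<and> I (Suc k) m') m" by (intro body) auto
  from wp_frame[OF this] show "wp (cs k) (\<lambda>t m'. (I (Suc k) m' \<and>
      (\<forall>a. a \<notin> (\<Union>k<K. writes_list (cs k)) \<longrightarrow> m' a = m0 a)) \<and> t + 0 \<le> B + 0) m"
    by (rule wp_mono) (use * in auto)
qed (use init in auto)

text \<open>A round costs the body, the test and the increment, hence \<open>B + 2\<close>; the
  summand 2 covers the initialisation and the last test. The invariant is required after the update
  of the counter, since it may mention the array \<open>v\<close>.\<close>

lemma wp_for:
  assumes init: "I 0 (m0(v := (m0 v)(0 := 0)))" and v: "v \<notin> writes_list cs"
    and bound: "\<And>i m. I i m \<Longrightarrow> i \<le> N \<Longrightarrow> (\<And>a. a \<notin> insert v (writes_list cs) \<Longrightarrow> m a = m0 a) \<Longrightarrow> expr_val m e = N"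
    and body: "\<And>i m. I i m \<Longrightarrow> i < N \<Longrightarrow> m v 0 = i \<Longrightarrow> (\<And>a. a \<notin> insert v (writes_list cs) \<Longrightarrow> m a = m0 a) \<Longrightarrow>
      wp cs (\<lambda>t m'. t \<le> B \<and> I (Suc i) (m'(v := (m' v)(0 := Suc i)))) m"
  shows "wp (for_loop v e cs) (\<lambda>t m'. t \<le> 2 + N * (B + 2) \<and> I N m') m0"
proof -
  let ?J = "\<lambda>m. I (m v 0) m \<and> m v 0 \<le> N \<and> (\<forall>a. a \<notin> insert v (writes_list cs) \<longrightarrow> m a = m0 a)"
  have "wp (cs @ [Write v (Const 0) (Succ (V v))])
      (\<lambda>t m'. ?J m' \<and> Suc t + (N - m' v 0) * (B + 2) \<le> (N - m v 0) * (B + 2)) m"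
    if J: "?J m" "test_val m (Less (V v) e)" for m
  proof -
    have "expr_val m e = N" using J by (intro bound) auto
    then have lt: "m v 0 < N" using J by auto
    then obtain r where r: "N - m v 0 = Suc r" "N - Suc (m v 0) = r"
      by (metis Suc_diff_Suc)
    have "wp cs (\<lambda>t m'. t \<le> B \<and> I (Suc (m v 0)) (m'(v := (m' v)(0 := Suc (m v 0))))) m"
      using J lt by (intro body) auto
    from wp_frame[OF this] show ?thesis
      apply (intro wp_append)
      apply (erule wp_mono)
      using J lt r v by (auto intro!: wp_Write wp_Nil)
  qed
  note W = wp_While[where I = ?J and \<phi> = "\<lambda>m. (N - m v 0) * (B + 2)", OF _ this]
  show ?thesis
    unfolding for_loop_def
  proof (rule wp_Write, rule wp_mono[OF W])
    fix t m' assume *: "?J m' \<and> \<not> test_val m' (Less (V v) e) \<and>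
      t + (N - m' v 0) * (B + 2) \<le> Suc ((N - (m0(v := (m0 v)(expr_val m0 (Const 0) := expr_val m0 (Const 0)))) v 0) * (B + 2))"
    then have "expr_val m' e = N" by (intro bound) auto
    with * have "m' v 0 = N" by auto
    with * show "Suc t \<le> 2 + N * (B + 2) \<and> I N m'" by auto
  qed (use init in auto)
qed

section \<open>The program\<close>

text \<open>The value is 1 plus the largest \<open>i < j\<close> with \<open>P i\<close>, or 0 if there is none.\<close>

fun last_below :: "(nat \<Rightarrow> bool) \<Rightarrow> nat \<Rightarrow> nat" where
  "last_below P 0 = 0"
| "last_below P (Suc j) = (if P j then Suc j else last_below P j)"

text \<open>Predecessors are tabulated by a scan over all \<open>j\<close> guarded by
  \<open>j < i\<close>; this gives the same value as a scan that stops at \<open>i\<close>.\<close>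

lemma last_below_conj: "i \<le> n \<Longrightarrow> last_below (\<lambda>j. j < i \<and> P j) n = last_below P i"
proof (induction n rule: dec_induct)
  case base
  have "j \<le> i \<Longrightarrow> last_below (\<lambda>j. j < i \<and> P j) j = last_below P j" for j
    by (induction j) auto
  then show ?case by simp
qed simp

lemma last_below_le: "last_below P n \<le> n"
  by (induction n) auto

lemma last_below_witness: "0 < last_below P n \<Longrightarrow> P (last_below P n - 1)"
  by (induction n) (auto split: if_splits)

lemma last_below_upper: "P j \<Longrightarrow> j < n \<Longrightarrow> j < last_below P n"
  by (induction n) (auto simp: less_Suc_eq)

text \<open>The pairing occurs in array names only, which are constants of the program; its
  injectivity keeps the families of arrays apart.\<close>

abbreviation work :: "nat \<Rightarrow> nat \<Rightarrow> 'v array" where "work a k \<equiv> Work (prod_encode (a, k))"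
text \<open>Sets are numbered from 0, the number \<open>K\<close> standing for \<open>Y\<close>. Groups and list pointers are stored as
  1 plus the index of a tuple, 0 being the null pointer: \<open>GID k\<close> maps a tuple to the last tuple of its
  group for set \<open>k\<close>, and \<open>PRV k\<close> to the preceding tuple of that group. \<open>OWN\<close> holds 1 plus the number
  of the part that contains a tuple, or 0, and only at the last tuple of each class with respect to \<open>Y\<close>.\<close>

abbreviation GID :: "nat \<Rightarrow> 'v array" where "GID k \<equiv> work 0 k"
abbreviation PRV :: "nat \<Rightarrow> 'v array" where "PRV k \<equiv> work 8 k"
abbreviation CNT :: "nat \<Rightarrow> 'v array" where "CNT k \<equiv> work 2 k"
abbreviation VIS :: "nat \<Rightarrow> 'v array" where "VIS k \<equiv> work 3 k"
abbreviation OWN :: "'v array" where "OWN \<equiv> work 4 0"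
abbreviation QU :: "'v array" where "QU \<equiv> work 5 0"
abbreviation PA :: "'v array" where "PA \<equiv> work 6 0"
abbreviation vI :: "'v array" where "vI \<equiv> work 7 0"
abbreviation vJ :: "'v array" where "vJ \<equiv> work 7 8"
abbreviation vH :: "'v array" where "vH \<equiv> work 7 2"
abbreviation vT :: "'v array" where "vT \<equiv> work 7 3"
abbreviation vC :: "'v array" where "vC \<equiv> work 7 4"
abbreviation vG :: "'v array" where "vG \<equiv> work 7 5"
abbreviation vU :: "'v array" where "vU \<equiv> work 7 6"
abbreviation vL :: "'v array" where "vL \<equiv> work 7 7"

definition agree_test :: "'v list \<Rightarrow> 'v expr \<Rightarrow> 'v expr \<Rightarrow> 'v com list \<Rightarrow> 'v com list" where
  "agree_test vs e f cs =
     foldr (\<lambda>v cs. [Cond (Equal (Read (Column v) e) (Read (Column v) f)) cs []]) vs cs"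

lemma wp_agree_test:
  assumes "\<forall>v\<in>set vs. m (Column v) (expr_val m e) = m (Column v) (expr_val m f) \<Longrightarrow>
      wp cs (\<lambda>t m'. t \<le> B \<and> P m') m"
    and "\<not> (\<forall>v\<in>set vs. m (Column v) (expr_val m e) = m (Column v) (expr_val m f)) \<Longrightarrow> P m"
  shows "wp (agree_test vs e f cs) (\<lambda>t m'. t \<le> length vs + B \<and> P m') m"
  using assms
proof (induction vs)
  case Nil
  then show ?case by (simp add: agree_test_def)
next
  case (Cons v vs)
  show ?case
  proof (cases "m (Column v) (expr_val m e) = m (Column v) (expr_val m f)")
    case True
    then have "wp (agree_test vs e f cs) (\<lambda>t m'. t \<le> length vs + B \<and> P m') m"
      using Cons by auto
    with True show ?thesis
      by (auto simp: agree_test_def intro: wp_Cond)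
  next
    case False
    then show ?thesis using Cons.prems(2)
      by (auto simp: agree_test_def intro!: wp_Cond wp_Nil)
  qed
qed

lemma writes_agree_test [simp]: "writes_list (agree_test vs e f cs) = writes_list cs"
  by (induction vs) (auto simp: agree_test_def)

text \<open>To be instantiated so that \<open>Xs\<close> enumerates \<open>\<X>\<close>,
  \<open>vs k\<close> lists the variables of \<open>Xs ! k\<close>, and the entry of
  \<open>vs\<close> at \<open>length Xs\<close> lists those of \<open>Y\<close>.\<close>

locale machine =
  fixes Xs :: "'v set list" and vs :: "nat \<Rightarrow> 'v list"
begin

abbreviation K :: nat where "K \<equiv> length Xs"

text \<open>Later writes override earlier ones, so a scan with increasing \<open>j\<close> leaves
  the last match in both tables.\<close>

definition tabulate_pair :: "nat \<Rightarrow> 'v com list" where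
  "tabulate_pair k = agree_test (vs k) (V vI) (V vJ)
     [Write (GID k) (V vI) (Succ (V vJ)),
      Cond (Less (V vJ) (V vI)) [Write (PRV k) (V vI) (Succ (V vJ))] []]"

definition tabulate :: "'v com list" where
  "tabulate = for_loop vI (V Size) (for_loop vJ (V Size) (concat (map tabulate_pair [0..<Suc K])))"

text \<open>The cleared cells are 1 to the number of tuples: these arrays are indexed by group
  names, and 0 is the null pointer.\<close>

definition clear :: "'v com list" where
  "clear = for_loop vJ (V Size) (concat (map (\<lambda>k.
     [Write (CNT k) (Succ (V vJ)) (Const 0), Write (VIS k) (Succ (V vJ)) (Const 0)]) [0..<K]))"

definition count :: "'v com list" where
  "count = for_loop vJ (V Size) (concat (map (\<lambda>k.
     [Cond (Equal (Read OWN (V vJ)) (Const (Suc k)))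
        [Write (CNT k) (Read (GID k) (V vJ)) (Succ (Read (CNT k) (Read (GID k) (V vJ))))] []]) [0..<K]))"

text \<open>No test for membership in the queue is made: a tuple is owned by one set and can be
  appended only while its group for that set is scanned, and \<open>VIS\<close> admits each group
  once.\<close>

definition scan :: "nat \<Rightarrow> 'v com list" where
  "scan k =
     [Cond (Equal (Read OWN (Pred (V vC))) (Const (Suc k)))
        [Write QU (V vT) (Pred (V vC)), Write PA (V vT) (V vH), Write vT (Const 0) (Succ (V vT))] [],
      Write vC (Const 0) (Read (PRV k) (Pred (V vC)))]"

definition expand :: "nat \<Rightarrow> 'v com list" where
  "expand k =
     [Write vG (Const 0) (Read (GID k) (Read QU (V vH))),
      Cond (Equal (Read (VIS k) (V vG)) (Const 0))
        [Write (VIS k) (V vG) (Const 1), Write vC (Const 0) (V vG),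
         While (Less (Const 0) (V vC)) (scan k)] []]"

definition search :: "'v com list" where
  "search =
     [Write QU (Const 0) (V vI), Write vH (Const 0) (Const 0), Write vT (Const 0) (Const 1),
      While (Less (V vH) (V vT))
        (concat (map expand [0..<K]) @ [Write vH (Const 0) (Succ (V vH))])]"

text \<open>A loop cannot be left early; a nonzero \<open>vL\<close> disables the later positions
  instead. At one position any of the successful sets will do, so overwriting within the inner block
  is harmless.\<close>

definition select :: "'v com list" where
  "select =
     [Write vU (Const 0) (Const 0), Write vL (Const 0) (Const 0)] @
     for_loop vH (V vT)
       [Cond (Equal (V vL) (Const 0))
          (concat (map (\<lambda>k.
             [Cond (Less (Read (CNT k) (Read (GID k) (Read QU (V vH)))) (V Degree))
                [Write vL (Const 0) (Const (Suc k)), Write vU (Const 0) (V vH)] []]) [0..<K])) []]"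

text \<open>The arbitrary choice is resolved to the set with number 0, stored as 1. If
  \<open>select\<close> found nothing, \<open>vU\<close> is 0, so \<open>shift\<close> then only
  assigns \<open>y0\<close>.\<close>

definition grow :: "'v com list" where
  "grow =
     [Cond (Equal (V vL) (Const 0))
        [Write Degree (Const 0) (Succ (V Degree)), Write vL (Const 0) (Const 1)] []]"

text \<open>\<open>vL\<close> carries the set that the current tuple is to take, at first the last
  one of the path; each tuple hands the set it gives up to its parent.\<close>

definition shift :: "'v com list" where
  "shift =
     [While (Less (Const 0) (V vU))
        [Write vG (Const 0) (Read OWN (Read QU (V vU))),
         Write OWN (Read QU (V vU)) (V vL),
         Write vL (Const 0) (V vG),
         Write vU (Const 0) (Read PA (V vU))],
      Write OWN (Read QU (Const 0)) (V vL)]"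

text \<open>An iteration changes one cell of \<open>OWN\<close> per class; one linear pass at its
  end then rewrites the characteristic vectors, which replaces moving classes tuple by
  tuple.\<close>

definition publish :: "'v com list" where
  "publish = for_loop vJ (V Size) (concat (map (\<lambda>k.
     [Cond (Equal (Read OWN (Pred (Read (GID K) (V vJ)))) (Const (Suc k)))
        [Write (Part (Xs ! k)) (V vJ) (Const 1)] [Write (Part (Xs ! k)) (V vJ) (Const 0)]]) [0..<K]))"

definition iteration :: "'v com list" where
  "iteration = clear @ count @ search @ select @ grow @ shift @ publish"

text \<open>The test picks the last tuple of each class, so every element of the projection is
  visited exactly once.\<close>

definition program :: "'v com list" where
  "program = tabulate @
     for_loop vI (V Size) [Cond (Equal (Read (GID K) (V vI)) (Succ (V vI))) iteration []]"

end

section \<open>Tabulating the groups\<close>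

locale execution = machine Xs vs for Xs :: "'v set list" and vs :: "nat \<Rightarrow> 'v list" +
  fixes n :: nat and col :: "'v \<Rightarrow> nat \<Rightarrow> nat" and L :: nat
  assumes distinct_Xs: "distinct Xs" and L: "\<And>k. length (vs k) \<le> L"
begin

definition agr :: "nat \<Rightarrow> nat \<Rightarrow> nat \<Rightarrow> bool" where
  "agr k i j \<longleftrightarrow> (\<forall>v\<in>set (vs k). col v i = col v j)"

definition gid :: "nat \<Rightarrow> nat \<Rightarrow> nat" where "gid k i = last_below (agr k i) n"
definition prv :: "nat \<Rightarrow> nat \<Rightarrow> nat" where "prv k i = last_below (agr k i) i"

definition base :: "'v memory \<Rightarrow> bool" where
  "base m \<longleftrightarrow> m Size 0 = n \<and> (\<forall>v. m (Column v) = col v)"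

definition tables :: "'v memory \<Rightarrow> bool" where
  "tables m \<longleftrightarrow> base m \<and> (\<forall>k\<le>K. \<forall>i<n. m (GID k) i = gid k i \<and> m (PRV k) i = prv k i)"

text \<open>Row \<open>i\<close> is being filled, and \<open>J k\<close> columns of it have been
  processed for set \<open>k\<close>. The dependence on \<open>k\<close> is needed inside a column,
  where the sets are treated one after another.\<close>

definition tabulating :: "nat \<Rightarrow> (nat \<Rightarrow> nat) \<Rightarrow> 'v memory \<Rightarrow> bool" where
  "tabulating i J m \<longleftrightarrow> base m \<and> (\<forall>k\<le>K. \<forall>i'.
     m (GID k) i' = (if i' < i then gid k i' else if i' = i then last_below (agr k i) (J k) else 0) \<and>
     m (PRV k) i' = (if i' < i then prv k i' else
       if i' = i then last_below (\<lambda>j. j < i \<and> agr k i j) (J k) else 0))"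

lemma tabulating_wf: "tabulating i J m \<Longrightarrow> m Size 0 = n"
  by (simp add: tabulating_def base_def)

lemma tabulating_Suc: "i < n \<Longrightarrow> tabulating i (\<lambda>_. n) m \<Longrightarrow> tabulating (Suc i) (\<lambda>_. 0) m"
  unfolding tabulating_def gid_def prv_def
  by (auto simp: less_Suc_eq last_below_conj)

lemma tabulating_upd [simp]: "tabulating i J (m(vI := x)) = tabulating i J m"
  "tabulating i J (m(vJ := x)) = tabulating i J m"
  unfolding tabulating_def base_def by simp_all

lemma wp_tabulate_pair:
  assumes "k \<le> K" "tabulating i (\<lambda>k'. if k' < k then Suc j else j) m" "m vI 0 = i" "m vJ 0 = j"
  shows "wp (tabulate_pair k) (\<lambda>t m'. t \<le> L + 3 \<and> tabulating i (\<lambda>k'. if k' < Suc k then Suc j else j) m') m"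
proof -
  have col: "(\<forall>v\<in>set (vs k). m (Column v) (expr_val m (V vI)) = m (Column v) (expr_val m (V vJ))) \<longleftrightarrow> agr k i j"
    using assms by (simp add: agr_def tabulating_def base_def)
  have "wp (tabulate_pair k) (\<lambda>t m'. t \<le> length (vs k) + 3 \<and>
      tabulating i (\<lambda>k'. if k' < Suc k then Suc j else j) m') m"
    unfolding tabulate_pair_def
    apply (rule wp_agree_test; unfold col)
     apply (rule wp_Write wp_Cond)+
    subgoal
      using assms by (auto intro!: wp_Write wp_Nil simp: tabulating_def base_def less_Suc_eq)
    subgoal
      using assms by (auto simp: tabulating_def less_Suc_eq)
    done
  then show ?thesis by (rule wp_mono) (use L[of k] in auto)
qed

lemma writes_list_tabulate_pair: "writes_list (tabulate_pair k) = {GID k, PRV k}"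
  unfolding tabulate_pair_def writes_agree_test by auto

lemma writes_tabulate_pair: "x \<in> set (tabulate_pair k) \<Longrightarrow> writes x \<subseteq> {GID k, PRV k}"
  using writes_list_tabulate_pair[of k] by fastforce

lemma wp_tabulate:
  assumes "base m" "\<And>k i. m (GID k) i = 0" "\<And>k i. m (PRV k) i = 0"
  shows "wp tabulate (\<lambda>t m'. t \<le> 2 + n * (2 + n * (Suc K * (L + 3) + 2) + 2) \<and> tables m') m"
proof -
  have pairs: "wp (concat (map tabulate_pair [0..<Suc K])) (\<lambda>t m'. t \<le> Suc K * (L + 3) \<and> tabulating i (\<lambda>_. Suc j) m') m"
    if "tabulating i (\<lambda>_. j) m" "m vI 0 = i" "m vJ 0 = j" for i j m
  proof (rule wp_mono[OF wp_concat_loop[where B = "L + 3" and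
          I = "\<lambda>k m'. tabulating i (\<lambda>k'. if k' < k then Suc j else j) m'"]])
    fix k m1 assume *: "k < Suc K" "tabulating i (\<lambda>k'. if k' < k then Suc j else j) m1"
      "\<And>a. a \<notin> (\<Union>k<Suc K. writes_list (tabulate_pair k)) \<Longrightarrow> m1 a = m a"
    have "m1 vI = m vI" "m1 vJ = m vJ" by (rule *(3), unfold writes_list_tabulate_pair, simp)+
    then show "wp (tabulate_pair k) (\<lambda>t m'. t \<le> L + 3 \<and> tabulating i (\<lambda>k'. if k' < Suc k then Suc j else j) m') m1"
      using * that by (intro wp_tabulate_pair) auto
  qed (use that in \<open>auto simp: tabulating_def\<close>)
  show ?thesis
    unfolding tabulate_def
  proof (rule wp_mono[OF wp_for[where I = "\<lambda>i m. tabulating i (\<lambda>_. 0) m" and N = n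
        and B = "2 + n * (Suc K * (L + 3) + 2)"]])
    fix i m assume *: "tabulating i (\<lambda>_. 0) m" "i < n" "m vI 0 = i"
    show "wp (for_loop vJ (V Size) (concat (map tabulate_pair [0..<Suc K])))
          (\<lambda>t m'. t \<le> 2 + n * (Suc K * (L + 3) + 2) \<and>
             tabulating (Suc i) (\<lambda>_. 0) (m'(vI := (m' vI)(0 := Suc i)))) m"
    proof (rule wp_mono[OF wp_for[where I = "\<lambda>j m'. tabulating i (\<lambda>_. j) m'" and N = n
        and B = "Suc K * (L + 3)"]])
      fix j m1 assume **: "tabulating i (\<lambda>_. j) m1" "j < n" "m1 vJ 0 = j"
        "\<And>a. a \<notin> insert vJ (writes_list (concat (map tabulate_pair [0..<Suc K]))) \<Longrightarrow> m1 a = m a"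
      have "m1 vI = m vI"
        by (rule **(4), unfold writes_list_concat writes_list_tabulate_pair) auto
      with ** show "wp (concat (map tabulate_pair [0..<Suc K]))
        (\<lambda>t m'. t \<le> Suc K * (L + 3) \<and> tabulating i (\<lambda>_. Suc j) (m'(vJ := (m' vJ)(0 := Suc j)))) m1"
        using * by (intro wp_mono[OF pairs]) auto
    qed (use * tabulating_Suc[of i] in \<open>auto simp: tabulating_wf dest!: writes_tabulate_pair\<close>)
  qed (use assms in \<open>auto simp: tabulating_wf for_loop_def dest!: writes_tabulate_pair\<close>, auto simp: tabulating_def tables_def)
qed


section \<open>Names of groups, their linked lists and their sizes\<close>

lemma agr_refl: "agr k i i" by (simp add: agr_def)

text \<open>Agreeing tuples have the same matches, hence the same last match; conversely, a common
  last match agrees with both.\<close>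

lemma gid_eq_iff: "i < n \<Longrightarrow> j < n \<Longrightarrow> gid k i = gid k j \<longleftrightarrow> agr k i j"
proof
  assume ij: "i < n" "j < n" and eq: "gid k i = gid k j"
  have "0 < gid k i"
    using last_below_upper[of "agr k i" i n] agr_refl ij by (simp add: gid_def)
  then have "agr k i (gid k i - 1)" "agr k j (gid k i - 1)"
    using last_below_witness[of "agr k i" n] last_below_witness[of "agr k j" n] eq by (auto simp: gid_def)
  then show "agr k i j" by (simp add: agr_def)
next
  assume "agr k i j"
  then have "agr k i = agr k j" by (auto simp: agr_def fun_eq_iff)
  then show "gid k i = gid k j" by (simp add: gid_def)
qed

lemma less_gid: "i < n \<Longrightarrow> i < gid k i"
  unfolding gid_def by (rule last_below_upper[OF agr_refl])

lemma gid_le: "gid k i \<le> n"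
  by (simp add: gid_def last_below_le)

lemma gid_range: "i < n \<Longrightarrow> 0 < gid k i \<and> gid k i \<le> n"
  using less_gid[of i k] gid_le[of k i] by linarith

lemma gid_pred: "i < n \<Longrightarrow> gid k (gid k i - 1) = gid k i"
  using last_below_witness[of "agr k i" n] gid_range[of i k] gid_eq_iff[of i "gid k i - 1" k]
  by (auto simp: gid_def)

lemma prv_le: "prv k i \<le> i"
  by (simp add: prv_def last_below_le)

lemma gid_prv: "i < n \<Longrightarrow> 0 < prv k i \<Longrightarrow> gid k (prv k i - 1) = gid k i"
  using last_below_witness[of "agr k i" i] prv_le[of k i] gid_eq_iff[of i "prv k i - 1" k]
  by (auto simp: prv_def)

text \<open>With \<open>gid_prv\<close> this says that following \<open>prv\<close> from the head
  \<open>gid\<close> meets every member of the group, in decreasing order.\<close>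

lemma less_prv: "i < n \<Longrightarrow> w < i \<Longrightarrow> gid k w = gid k i \<Longrightarrow> w < prv k i"
  unfolding prv_def using gid_eq_iff[of i w k] by (intro last_below_upper) auto

definition grp :: "(nat \<Rightarrow> nat) \<Rightarrow> nat \<Rightarrow> nat \<Rightarrow> nat \<Rightarrow> nat" where
  "grp own k g N = card {z. z < N \<and> own z = Suc k \<and> gid k z = g}"

lemma grp_0 [simp]: "grp own k g 0 = 0"
  by (simp add: grp_def)

lemma grp_Suc: "grp own k g (Suc i) = grp own k g i + of_bool (own i = Suc k \<and> gid k i = g)"
proof -
  have "{z. z < Suc i \<and> own z = Suc k \<and> gid k z = g} = (if own i = Suc k \<and> gid k i = g
    then insert i {z. z < i \<and> own z = Suc k \<and> gid k z = g} else {z. z < i \<and> own z = Suc k \<and> gid k z = g})"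
    by (auto simp: less_Suc_eq)
  then show ?thesis by (simp add: grp_def)
qed

definition static :: "'v array set" where
  "static = {Size} \<union> range Column \<union> range GID \<union> range PRV"

lemma tables_frame: "tables m \<Longrightarrow> (\<And>a. a \<in> static \<Longrightarrow> m' a = m a) \<Longrightarrow> tables m'"
  unfolding tables_def base_def static_def by auto

lemma tables_upd [simp]: "a \<notin> static \<Longrightarrow> tables (m(a := f)) = tables m"
  unfolding tables_def base_def static_def by auto

lemma static_simps [simp]: "Size \<in> static" "Column v \<in> static" "GID k \<in> static" "PRV k \<in> static"
  "work a k \<in> static \<longleftrightarrow> a = 0 \<or> a = 8" "Part X \<notin> static" "Degree \<notin> static"
  by (auto simp: static_def)

lemma tablesD: "tables m \<Longrightarrow> m Size 0 = n"
  "tables m \<Longrightarrow> k \<le> K \<Longrightarrow> i < n \<Longrightarrow> m (GID k) i = gid k i"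
  "tables m \<Longrightarrow> k \<le> K \<Longrightarrow> i < n \<Longrightarrow> m (PRV k) i = prv k i"
  by (auto simp: tables_def base_def)

section \<open>Clearing the scratch arrays and counting group sizes\<close>

lemma wp_clear:
  assumes "tables m"
  shows "wp clear (\<lambda>t m'. t \<le> 2 + n * (K * 2 + 2) \<and>
    (\<forall>k<K. \<forall>g. 0 < g \<longrightarrow> g \<le> n \<longrightarrow> m' (CNT k) g = 0 \<and> m' (VIS k) g = 0)) m"
  unfolding clear_def
proof (rule wp_for[where I = "\<lambda>i m'. \<forall>k<K. \<forall>g. 0 < g \<longrightarrow> g \<le> i \<longrightarrow> m' (CNT k) g = 0 \<and> m' (VIS k) g = 0"])
  fix i :: nat and m
  assume *: "\<forall>k<K. \<forall>g. 0 < g \<longrightarrow> g \<le> i \<longrightarrow> m (CNT k) g = 0 \<and> m (VIS k) g = 0" "m vJ 0 = i"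
  show "wp (concat (map (\<lambda>k. [Write (CNT k) (Succ (V vJ)) (Const 0), Write (VIS k) (Succ (V vJ)) (Const 0)]) [0..<K]))
    (\<lambda>t m'. t \<le> K * 2 \<and> (\<forall>k<K. \<forall>g. 0 < g \<longrightarrow> g \<le> Suc i \<longrightarrow>
      (m'(vJ := (m' vJ)(0 := Suc i))) (CNT k) g = 0 \<and> (m'(vJ := (m' vJ)(0 := Suc i))) (VIS k) g = 0)) m"
  proof (rule wp_mono[OF wp_concat_loop[where B = 2 and
        I = "\<lambda>k m. m vJ 0 = i \<and> (\<forall>k'<K. \<forall>g. 0 < g \<longrightarrow> g \<le> (if k' < k then Suc i else i) \<longrightarrow> m (CNT k') g = 0 \<and> m (VIS k') g = 0)"]])
    fix k m assume "m vJ 0 = i \<and> (\<forall>k'<K. \<forall>g. 0 < g \<longrightarrow> g \<le> (if k' < k then Suc i else i) \<longrightarrow> m (CNT k') g = 0 \<and> m (VIS k') g = 0)"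
    then show "wp [Write (CNT k) (Succ (V vJ)) (Const 0), Write (VIS k) (Succ (V vJ)) (Const 0)]
      (\<lambda>t m'. t \<le> 2 \<and> m' vJ 0 = i \<and> (\<forall>k'<K. \<forall>g. 0 < g \<longrightarrow> g \<le> (if k' < Suc k then Suc i else i) \<longrightarrow> m' (CNT k') g = 0 \<and> m' (VIS k') g = 0)) m"
      by (intro wp_Write wp_Nil) (auto simp: less_Suc_eq le_Suc_eq)
  qed (use * in auto)
qed (use tablesD(1)[OF assms] in auto)

lemma wp_count:
  assumes "tables m" "\<forall>k<K. \<forall>g. 0 < g \<longrightarrow> g \<le> n \<longrightarrow> m (CNT k) g = 0"
  shows "wp count (\<lambda>t m'. t \<le> 2 + n * (K * 2 + 2) \<and>
    (\<forall>k<K. \<forall>g. 0 < g \<longrightarrow> g \<le> n \<longrightarrow> m' (CNT k) g = grp (m OWN) k g n)) m"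
  unfolding count_def
proof (rule wp_for[where I = "\<lambda>i m'. \<forall>k<K. \<forall>g. 0 < g \<longrightarrow> g \<le> n \<longrightarrow> m' (CNT k) g = grp (m OWN) k g i"])
  let ?c = "\<lambda>k. [Cond (Equal (Read OWN (V vJ)) (Const (Suc k)))
        [Write (CNT k) (Read (GID k) (V vJ)) (Succ (Read (CNT k) (Read (GID k) (V vJ))))] []]"
  fix i m1
  assume *: "\<forall>k<K. \<forall>g. 0 < g \<longrightarrow> g \<le> n \<longrightarrow> m1 (CNT k) g = grp (m OWN) k g i" "m1 vJ 0 = i" "i < n"
    and fr: "\<And>a. a \<notin> insert vJ (writes_list (concat (map ?c [0..<K]))) \<Longrightarrow> m1 a = m a"
  have own: "m1 OWN = m OWN" by (rule fr) auto
  have tab: "tables m1" by (rule tables_frame[OF assms(1)], rule fr) auto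
  show "wp (concat (map ?c [0..<K]))
    (\<lambda>t m'. t \<le> K * 2 \<and> (\<forall>k<K. \<forall>g. 0 < g \<longrightarrow> g \<le> n \<longrightarrow>
      (m'(vJ := (m' vJ)(0 := Suc i))) (CNT k) g = grp (m OWN) k g (Suc i))) m1"
  \<comment> \<open>Within a round, the counters of sets below \<open>k\<close> already include
    tuple \<open>i\<close>, the others do not.\<close>
  proof (rule wp_mono[OF wp_concat_loop[where B = 2 and
        I = "\<lambda>k m'. tables m' \<and> m' OWN = m OWN \<and> m' vJ 0 = i \<and> (\<forall>k'<K. \<forall>g. 0 < g \<longrightarrow> g \<le> n \<longrightarrow>
          m' (CNT k') g = grp (m OWN) k' g (if k' < k then Suc i else i))"]])
    fix k m2 assume **: "k < K" "tables m2 \<and> m2 OWN = m OWN \<and> m2 vJ 0 = i \<and> (\<forall>k'<K. \<forall>g. 0 < g \<longrightarrow> g \<le> n \<longrightarrow>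
          m2 (CNT k') g = grp (m OWN) k' g (if k' < k then Suc i else i))"
    let ?m3 = "if m OWN i = Suc k then m2(CNT k := (m2 (CNT k))(gid k i := Suc (m2 (CNT k) (gid k i)))) else m2"
    have m2: "tables m2" "m2 OWN = m OWN" "m2 vJ 0 = i" using **(2) by blast+
    have val: "m2 (GID k) i = gid k i" using tablesD(2)[OF m2(1) _ *(3)] **(1) by simp
    have m3: "tables ?m3" "?m3 OWN = m OWN" "?m3 vJ 0 = i" using m2 by simp_all
    have "wp (?c k) (\<lambda>t m'. t \<le> 2 \<and> m' = ?m3) m2"
      by (intro wp_Cond) (auto simp: val m2 intro!: wp_Write wp_Nil)
    then show "wp (?c k) (\<lambda>t m'. t \<le> 2 \<and> tables m' \<and> m' OWN = m OWN \<and> m' vJ 0 = i \<and> (\<forall>k'<K. \<forall>g. 0 < g \<longrightarrow> g \<le> n \<longrightarrow>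
          m' (CNT k') g = grp (m OWN) k' g (if k' < Suc k then Suc i else i))) m2"
    proof (rule wp_mono, elim conjE, intro conjI allI impI)
      fix t m' k' g assume m': "m' = ?m3" and g: "k' < K" "0 < g" "g \<le> n"
      have old: "m2 (CNT k') g = grp (m OWN) k' g (if k' < k then Suc i else i)" using **(2) g by blast
      have upd: "m' (CNT k') g = m2 (CNT k') g + of_bool (k' = k \<and> m OWN i = Suc k \<and> gid k i = g)"
      proof (cases "m OWN i = Suc k")
        case True
        then have "m' = m2(CNT k := (m2 (CNT k))(gid k i := Suc (m2 (CNT k) (gid k i))))" unfolding m' by (rule if_P)
        then show ?thesis using True by (cases "k' = k"; cases "gid k i = g"; simp only: fun_upd_apply) auto
      next
        case False
        then have "m' = m2" unfolding m' by (rule if_not_P)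
        then show ?thesis using False by (simp only:) simp
      qed
      show "m' (CNT k') g = grp (m OWN) k' g (if k' < Suc k then Suc i else i)"
      proof (cases "k' = k")
        case True
        with upd old show ?thesis by (simp add: grp_Suc)
      next
        case False
        then have "k' < Suc k \<longleftrightarrow> k' < k" by linarith
        then have "(if k' < Suc k then Suc i else i) = (if k' < k then Suc i else i)" by (simp only:)
        moreover have "m' (CNT k') g = m2 (CNT k') g" using upd False by simp
        ultimately show ?thesis using old by argo
      qed
    qed (use m3 in simp_all)
  next
    fix t m' assume "t \<le> K * 2 \<and> tables m' \<and> m' OWN = m OWN \<and> m' vJ 0 = i \<and> (\<forall>k'<K. \<forall>g. 0 < g \<longrightarrow> g \<le> n \<longrightarrow>
          m' (CNT k') g = grp (m OWN) k' g (if k' < K then Suc i else i))"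
    then show "t \<le> K * 2 \<and> (\<forall>k<K. \<forall>g. 0 < g \<longrightarrow> g \<le> n \<longrightarrow>
      (m'(vJ := (m' vJ)(0 := Suc i))) (CNT k) g = grp (m OWN) k g (Suc i))" by simp
  next
    show "tables m1 \<and> m1 OWN = m OWN \<and> m1 vJ 0 = i \<and> (\<forall>k'<K. \<forall>g. 0 < g \<longrightarrow> g \<le> n \<longrightarrow>
          m1 (CNT k') g = grp (m OWN) k' g (if k' < 0 then Suc i else i))"
      using * own tab by simp
  qed
qed (use tablesD(1)[OF assms(1)] assms(2) in auto)

section \<open>Breadth-first search\<close>

text \<open>The state of the breadth-first search: the queue \<open>Q\<close> of length \<open>T\<close>, the queue positions \<open>P\<close> of the
  parents, and the scanning position. The scan has reached queue position \<open>h\<close>, the set with number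
  \<open>kc\<close>, and the group members not below \<open>c\<close>.\<close>

definition reached :: "nat \<Rightarrow> nat \<Rightarrow> nat \<Rightarrow> nat \<Rightarrow> nat \<Rightarrow> nat \<Rightarrow> bool" where
  "reached h kc c i k w \<longleftrightarrow> i < h \<or> i = h \<and> (k < kc \<or> k = kc \<and> c \<le> w)"

text \<open>Two clauses replace distances: parent positions are nondecreasing along the queue, and
  by \<open>P j \<le> i\<close> a tuple is discovered no later than from any position that sees it.
  The bounds \<open>0 < j\<close> set the root apart, which has no parent.\<close>

definition bfs :: "(nat \<Rightarrow> nat) \<Rightarrow> nat \<Rightarrow> (nat \<Rightarrow> nat) \<Rightarrow> (nat \<Rightarrow> nat) \<Rightarrow> nat \<Rightarrow> nat \<Rightarrow> nat \<Rightarrow> nat \<Rightarrow> bool" where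
  "bfs own y0 Q P T h kc c \<longleftrightarrow>
     0 < T \<and> Q 0 = y0 \<and> inj_on Q {..<T} \<and> (\<forall>j<T. Q j < n) \<and>
     (\<forall>j. 0 < j \<and> j < T \<longrightarrow> P j < j \<and> (\<exists>k<K. own (Q j) = Suc k \<and> gid k (Q j) = gid k (Q (P j)) \<and>
        reached h kc c (P j) k (Q j))) \<and>
     (\<forall>i j. 0 < i \<and> i \<le> j \<and> j < T \<longrightarrow> P i \<le> P j) \<and>
     (\<forall>i k w. i < T \<and> k < K \<and> w < n \<and> own w = Suc k \<and> gid k w = gid k (Q i) \<and> reached h kc c i k w \<longrightarrow>
        (\<exists>j. 0 < j \<and> j < T \<and> Q j = w \<and> P j \<le> i))"

lemma bfsD:
  assumes "bfs own y0 Q P T h kc c"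
  shows "0 < T" "Q 0 = y0" "inj_on Q {..<T}" "j < T \<Longrightarrow> Q j < n"
    and "0 < j \<Longrightarrow> j < T \<Longrightarrow> P j < j"
    and "0 < j \<Longrightarrow> j < T \<Longrightarrow> \<exists>k<K. own (Q j) = Suc k \<and> gid k (Q j) = gid k (Q (P j)) \<and> reached h kc c (P j) k (Q j)"
    and "0 < i \<Longrightarrow> i \<le> j \<Longrightarrow> j < T \<Longrightarrow> P i \<le> P j"
    and "i < T \<Longrightarrow> k < K \<Longrightarrow> w < n \<Longrightarrow> own w = Suc k \<Longrightarrow> gid k w = gid k (Q i) \<Longrightarrow> reached h kc c i k w \<Longrightarrow>
      \<exists>j. 0 < j \<and> j < T \<and> Q j = w \<and> P j \<le> i"
  using assms unfolding bfs_def by simp_all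

lemma bfsI:
  assumes "0 < T" "Q 0 = y0" "inj_on Q {..<T}" "\<And>j. j < T \<Longrightarrow> Q j < n"
    and "\<And>j. 0 < j \<Longrightarrow> j < T \<Longrightarrow> P j < j"
    and "\<And>j. 0 < j \<Longrightarrow> j < T \<Longrightarrow>
      \<exists>k<K. own (Q j) = Suc k \<and> gid k (Q j) = gid k (Q (P j)) \<and> reached h kc c (P j) k (Q j)"
    and "\<And>i j. 0 < i \<Longrightarrow> i \<le> j \<Longrightarrow> j < T \<Longrightarrow> P i \<le> P j"
    and "\<And>i k w. i < T \<Longrightarrow> k < K \<Longrightarrow> w < n \<Longrightarrow> own w = Suc k \<Longrightarrow> gid k w = gid k (Q i) \<Longrightarrow>
      reached h kc c i k w \<Longrightarrow> \<exists>j. 0 < j \<and> j < T \<and> Q j = w \<and> P j \<le> i"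
  shows "bfs own y0 Q P T h kc c"
  unfolding bfs_def
  by (intro conjI allI impI; (elim conjE)?; rule assms; assumption)

text \<open>Scanning position \<open>n\<close> means that nothing has been scanned, as all indices
  lie below \<open>n\<close>.\<close>

lemma bfs_init: "y0 < n \<Longrightarrow> bfs own y0 (Q(0 := y0)) P 1 0 0 n"
  by (auto simp: bfs_def reached_def lessThan_Suc)

lemma bfs_length: "bfs own y0 Q P T h kc c \<Longrightarrow> T \<le> n"
  using card_inj_on_le[of Q "{..<T}" "{..<n}"] by (auto simp: bfs_def)

text \<open>Advances the scan while the queue stays as it is. A newly covered tuple must have been
  covered before, possibly from an earlier position in the same group; the latter justifies skipping
  a visited group.\<close>

lemma bfs_mono:
  assumes "bfs own y0 Q P T h kc c"
    and "\<And>i k w. i < T \<Longrightarrow> w < n \<Longrightarrow> reached h kc c i k w \<Longrightarrow> reached h' kc' c' i k w"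
    and "\<And>i k w. i < T \<Longrightarrow> k < K \<Longrightarrow> w < n \<Longrightarrow> own w = Suc k \<Longrightarrow> gid k w = gid k (Q i) \<Longrightarrow>
       reached h' kc' c' i k w \<Longrightarrow> reached h kc c i k w \<or> (\<exists>i'<i. gid k (Q i') = gid k (Q i) \<and> reached h kc c i' k w)"
  shows "bfs own y0 Q P T h' kc' c'"
proof (rule bfsI)
  note b = bfsD[OF assms(1)]
  fix j assume j: "0 < j" "j < T"
  show "P j < j" using b(5)[OF j] .
  obtain k where k: "k < K" "own (Q j) = Suc k" "gid k (Q j) = gid k (Q (P j))" "reached h kc c (P j) k (Q j)"
    using b(6)[OF j] by blast
  have "reached h' kc' c' (P j) k (Q j)"
    using \<open>P j < j\<close> j(2) by (intro assms(2) b(4) k(4)) auto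
  with k show "\<exists>k<K. own (Q j) = Suc k \<and> gid k (Q j) = gid k (Q (P j)) \<and> reached h' kc' c' (P j) k (Q j)"
    by blast
next
  note b = bfsD[OF assms(1)]
  fix i k w
  assume w: "i < T" "k < K" "w < n" "own w = Suc k" "gid k w = gid k (Q i)" "reached h' kc' c' i k w"
  from assms(3)[OF w] obtain i' where i': "i' \<le> i" "gid k (Q i') = gid k (Q i)" "reached h kc c i' k w"
  proof
    assume "reached h kc c i k w"
    then show thesis using that[of i] by simp
  next
    assume "\<exists>i'<i. gid k (Q i') = gid k (Q i) \<and> reached h kc c i' k w"
    then show thesis using that less_imp_le by blast
  qed
  then have "i' < T" "gid k w = gid k (Q i')" using w by simp_all
  from b(8)[OF this(1) w(2-4) this(2) i'(3)] obtain j where "0 < j" "j < T" "Q j = w" "P j \<le> i'"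
    by blast
  with i'(1) show "\<exists>j. 0 < j \<and> j < T \<and> Q j = w \<and> P j \<le> i" by (intro exI[of _ j]) auto
qed (use bfsD[OF assms(1)] in simp_all)

lemma bfs_skip:
  assumes "bfs own y0 Q P T h kc c" "c' \<le> c"
    and "\<And>w. c' \<le> w \<Longrightarrow> w < c \<Longrightarrow> w < n \<Longrightarrow> own w = Suc kc \<Longrightarrow> gid kc w = gid kc (Q h) \<Longrightarrow> False"
  shows "bfs own y0 Q P T h kc c'"
proof (rule bfs_mono[OF assms(1)])
  fix i k w assume "own w = Suc k" "gid k w = gid k (Q i)" "reached h kc c' i k w" "w < n"
  then show "reached h kc c i k w \<or> (\<exists>i'<i. gid k (Q i') = gid k (Q i) \<and> reached h kc c i' k w)"
    using assms(3)[of w] unfolding reached_def by (metis not_le)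
qed (use assms(2) in \<open>auto simp: reached_def\<close>)

lemma bfs_visited:
  assumes "bfs own y0 Q P T h kc n" "\<exists>i<h. gid kc (Q i) = gid kc (Q h)"
  shows "bfs own y0 Q P T h (Suc kc) n"
  by (rule bfs_mono[OF assms(1)]) (use assms(2) in \<open>auto simp: reached_def less_Suc_eq\<close>)

lemma bfs_next_set: "bfs own y0 Q P T h kc 0 \<Longrightarrow> bfs own y0 Q P T h (Suc kc) n"
  by (erule bfs_mono) (auto simp: reached_def less_Suc_eq)

lemma bfs_next_position: "bfs own y0 Q P T h K n \<Longrightarrow> bfs own y0 Q P T (Suc h) 0 n"
  by (erule bfs_mono) (auto simp: reached_def less_Suc_eq)

lemma bfs_add:
  assumes b: "bfs own y0 Q P T h kc (Suc z)" and z: "z < n" "own z = Suc kc" "gid kc z = gid kc (Q h)"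
    and h: "h < T" "kc < K" and new: "\<And>i. i < h \<Longrightarrow> gid kc (Q i) \<noteq> gid kc (Q h)" and "own y0 = 0"
  shows "bfs own y0 (Q(T := z)) (P(T := h)) (Suc T) h kc z"
proof -
  note b' = bfsD[OF b]
  \<comment> \<open>Were \<open>z\<close> in the queue, its parent would lie in the same group for
    \<open>kc\<close>. An earlier parent contradicts \<open>new\<close>, the parent \<open>h\<close>
    contradicts the scanning order, and the root is excluded because it has no owner.\<close>
  have new_z: "Q j \<noteq> z" if j: "j < T" for j
  proof
    assume eq: "Q j = z"
    have "0 < j" using assms(8) z(2) b'(2) eq by (cases j) auto
    then obtain k where "own z = Suc k" "gid k z = gid k (Q (P j))" "reached h kc (Suc z) (P j) k z"
      using b'(6)[of j] j unfolding eq by blast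
    then show False using z new[of "P j"] by (auto simp: reached_def)
  qed
  have inj: "inj_on (Q(T := z)) {..<Suc T}"
    unfolding lessThan_Suc using new_z b'(3) by (auto simp: inj_on_def)
  have P_le: "P j \<le> h" if "0 < j" "j < T" for j
    using b'(6)[OF that] by (auto simp: reached_def)
  have "(P(T := h)) j < j" if "0 < j" "j < Suc T" for j
    using h b'(5)[of j] that by (auto simp: less_Suc_eq)
  moreover have "\<exists>k<K. own ((Q(T := z)) j) = Suc k \<and> gid k ((Q(T := z)) j) = gid k ((Q(T := z)) ((P(T := h)) j)) \<and>
        reached h kc z ((P(T := h)) j) k ((Q(T := z)) j)" if jT: "0 < j" "j < Suc T" for j
  proof (cases "j = T")
    case True
    then show ?thesis using h z by (auto simp: reached_def)
  next
    case False
    then have j: "j < T" using jT by simp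
    obtain k where k: "k < K" "own (Q j) = Suc k" "gid k (Q j) = gid k (Q (P j))" "reached h kc (Suc z) (P j) k (Q j)"
      using b'(6)[OF jT(1) j] by blast
    have "reached h kc z (P j) k (Q j)" using k(4) by (auto simp: reached_def)
    moreover have "P j \<noteq> T" using b'(5)[OF jT(1) j] j by simp
    ultimately show ?thesis using k False by auto
  qed
  moreover have "\<exists>j. 0 < j \<and> j < Suc T \<and> (Q(T := z)) j = w \<and> (P(T := h)) j \<le> i"
    if w: "i < Suc T" "k < K" "w < n" "own w = Suc k" "gid k w = gid k ((Q(T := z)) i)" "reached h kc z i k w" for i k w
  proof (cases "i = h \<and> k = kc \<and> w = z")
    case True
    then show ?thesis using b'(1) by (intro exI[of _ T]) auto
  next
    case False
    have i: "i < T" using w(6) h by (auto simp: reached_def)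
    have "reached h kc (Suc z) i k w"
      using False w(6) by (auto simp: reached_def)
    then obtain j where "0 < j" "j < T" "Q j = w" "P j \<le> i"
      using b'(8)[OF i w(2-4)] w(5) i by auto
    then show ?thesis by (intro exI[of _ j]) auto
  qed
  moreover have "(P(T := h)) i \<le> (P(T := h)) j" if "0 < i" "i \<le> j" "j < Suc T" for i j
    using that b'(7)[of i j] P_le[of i] by (cases "j = T") auto
  moreover have "(Q(T := z)) j < n" if "j < Suc T" for j using b'(4) z that by (auto simp: less_Suc_eq)
  moreover have "(Q(T := z)) 0 = y0" using b'(1,2) by auto
  ultimately show ?thesis using inj by (intro bfsI) simp_all
qed


section \<open>The running time of the search\<close>

definition visits :: "'v memory \<Rightarrow> (nat \<Rightarrow> nat) \<Rightarrow> nat \<Rightarrow> nat \<Rightarrow> bool" where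
  "visits m Q h kc \<longleftrightarrow> (\<forall>k<K. \<forall>g. 0 < g \<longrightarrow> g \<le> n \<longrightarrow>
     (m (VIS k) g = 0 \<longleftrightarrow> \<not> (\<exists>i. (i < h \<or> i = h \<and> k < kc) \<and> gid k (Q i) = g)))"

text \<open>The potential that pays for scanning the groups.\<close>

definition unvisited :: "'v memory \<Rightarrow> nat" where
  "unvisited m = (\<Sum>k<K. card {z. z < n \<and> m (VIS k) (gid k z) = 0})"

lemma unvisited_le: "unvisited m \<le> K * n"
proof -
  have "card {z. z < n \<and> m (VIS k) (gid k z) = 0} \<le> n" for k
    using card_mono[of "{..<n}" "{z. z < n \<and> m (VIS k) (gid k z) = 0}"] by auto
  then have "unvisited m \<le> (\<Sum>k<K. n)" unfolding unvisited_def by (intro sum_mono)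
  then show ?thesis by simp
qed

text \<open>The potential released is the size of the group among all input tuples, not only the
  owned ones, because the scan walks through all of them.\<close>

lemma unvisited_mark:
  assumes "k < K" "m (VIS k) g = 0"
    and "\<And>k'. m' (VIS k') = (if k' = k then (m (VIS k))(g := 1) else m (VIS k'))"
  shows "unvisited m' + card {z. z < n \<and> gid k z = g} = unvisited m"
proof -
  have s: "(\<Sum>k'<K. f k') = f k + (\<Sum>k'\<in>{..<K} - {k}. f k')" for f :: "nat \<Rightarrow> nat"
    using assms(1) by (intro sum.remove) auto
  have "card {z. z < n \<and> m (VIS k) (gid k z) = 0} =
      card ({z. z < n \<and> m' (VIS k) (gid k z) = 0} \<union> {z. z < n \<and> gid k z = g})"
    using assms by (intro arg_cong[where f = card]) auto
  also have "\<dots> = card {z. z < n \<and> m' (VIS k) (gid k z) = 0} + card {z. z < n \<and> gid k z = g}"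
    using assms(3) by (intro card_Un_disjoint) auto
  finally show ?thesis
    unfolding unvisited_def s using assms(3) by simp
qed

definition searching :: "(nat \<Rightarrow> nat) \<Rightarrow> nat \<Rightarrow> nat \<Rightarrow> nat \<Rightarrow> nat \<Rightarrow> 'v memory \<Rightarrow> bool" where
  "searching own y0 h kc c m \<longleftrightarrow> tables m \<and> m OWN = own \<and> m vH 0 = h \<and>
     bfs own y0 (m QU) (m PA) (m vT 0) h kc c"

lemma wp_scan_loop:
  assumes s: "searching own y0 h k n m" and h: "h < m vT 0" and k: "k < K" and own: "own y0 = 0"
    and g: "m vC 0 = gid k (m QU h)"
    and new: "\<And>i. i < h \<Longrightarrow> gid k (m QU i) \<noteq> gid k (m QU h)"
  shows "wp [While (Less (Const 0) (V vC)) (scan k)]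
    (\<lambda>t m'. searching own y0 h (Suc k) n m' \<and> h < m' vT 0 \<and> (\<forall>i\<le>h. m' QU i = m QU i) \<and>
       t \<le> Suc (6 * card {z. z < n \<and> gid k z = m vC 0})) m"
proof -
  let ?g = "gid k (m QU h)"
  \<comment> \<open>A round of \<open>scan\<close> takes at most 5 steps, namely a conditional and
    four writes; with the loop test this makes 6 per member.\<close>
  let ?\<phi> = "\<lambda>m'. 6 * card {z. z < m' vC 0 \<and> gid k z = ?g}"
  define I where "I m' \<longleftrightarrow> searching own y0 h k (m' vC 0) m' \<and> h < m' vT 0 \<and> (\<forall>i\<le>h. m' QU i = m QU i) \<and>
    m' vC 0 \<le> n \<and> (0 < m' vC 0 \<longrightarrow> gid k (m' vC 0 - 1) = ?g)" for m'
  have Qh: "m QU h < n" using s h by (auto simp: searching_def bfs_def)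
  have "bfs own y0 (m QU) (m PA) (m vT 0) h k n"
    using s by (simp add: searching_def)
  \<comment> \<open>The scan may start at the head of the list: \<open>gid\<close> is one more than
    the last member, so no member lies at or above it.\<close>
  then have "bfs own y0 (m QU) (m PA) (m vT 0) h k ?g"
    using gid_le by (rule bfs_skip) (metis less_gid not_le)
  then have init: "I m"
    using s h g gid_pred[OF Qh] gid_le[of k] unfolding I_def searching_def by auto
  have body: "wp (scan k) (\<lambda>t m'. I m' \<and> Suc t + ?\<phi> m' \<le> ?\<phi> m1) m1"
    if I: "I m1" and pos: "test_val m1 (Less (Const 0) (V vC))" for m1
  proof -
    obtain z where z: "m1 vC 0 = Suc z" using pos by (cases "m1 vC 0") auto
    then have zn: "z < n" and zg: "gid k z = ?g" using I by (auto simp: I_def)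
    have QI: "m1 QU i = m QU i" if "i \<le> h" for i using I that by (auto simp: I_def)
    have b: "bfs own y0 (m1 QU) (m1 PA) (m1 vT 0) h k (Suc z)" and ow: "m1 OWN = own" and hT: "h < m1 vT 0"
      and tab: "tables m1" and H: "m1 vH 0 = h"
      using I z by (auto simp: I_def searching_def)
    have gap: False if "prv k z \<le> w" "w < z" "gid k w = ?g" for w
      using less_prv[OF zn that(2), of k] zg that by simp
    have prv_k: "m1 (PRV k) z = prv k z" using tablesD(3)[OF tab _ zn] k by simp
    \<comment> \<open>One list step removes exactly \<open>z\<close>, since no member lies between
      it and its predecessor.\<close>
    have "{z'. z' < Suc z \<and> gid k z' = ?g} = insert z {z'. z' < prv k z \<and> gid k z' = ?g}"
      using zg gap prv_le[of k z] by (auto simp: less_Suc_eq) (meson not_le)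
    then have pot: "card {z'. z' < Suc z \<and> gid k z' = ?g} = Suc (card {z'. z' < prv k z \<and> gid k z' = ?g})"
      using prv_le[of k z] by simp
    have prv_n: "prv k z \<le> n" using prv_le[of k z] zn by simp
    have prv_g: "0 < prv k z \<Longrightarrow> gid k (prv k z - 1) = ?g" using gid_prv[OF zn] zg by simp
    show ?thesis
    proof (cases "own z = Suc k")
      case True
      have "bfs own y0 ((m1 QU)(m1 vT 0 := z)) ((m1 PA)(m1 vT 0 := h)) (Suc (m1 vT 0)) h k z"
        using b zn True zg hT k own new QI by (intro bfs_add) auto
      then have "bfs own y0 ((m1 QU)(m1 vT 0 := z)) ((m1 PA)(m1 vT 0 := h)) (Suc (m1 vT 0)) h k (prv k z)"
        by (rule bfs_skip) (use prv_le gap QI hT in auto)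
      then show ?thesis
        unfolding scan_def
        using True z ow H tab hT QI prv_k pot prv_n prv_g
        by (intro wp_Cond wp_Write) (auto intro!: wp_Write wp_Nil simp: I_def searching_def)
    next
      case False
      have "bfs own y0 (m1 QU) (m1 PA) (m1 vT 0) h k (prv k z)"
        by (rule bfs_skip[OF b]) (use False prv_le[of k z] gap QI in \<open>auto simp: less_Suc_eq\<close>)
      then show ?thesis
        unfolding scan_def
        using False z ow H tab hT QI prv_k pot prv_n prv_g
        by (intro wp_Cond wp_Write) (auto intro!: wp_Write wp_Nil simp: I_def searching_def)
    qed
  qed
  have "card {z. z < m vC 0 \<and> gid k z = ?g} \<le> card {z. z < n \<and> gid k z = m vC 0}"
    using g gid_le[of k] by (intro card_mono) (auto intro: less_le_trans)
  then show ?thesis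
    by (intro wp_mono[OF wp_While[where I = I and \<phi> = ?\<phi>, OF init body]])
      (auto simp: I_def searching_def dest: bfs_next_set)
qed

text \<open>The scan is charged to the potential released by marking the group. What remains is 5:
  four steps before the loop and its failing test.\<close>

lemma wp_expand:
  assumes s: "searching own y0 h k n m" and h: "h < m vT 0" and k: "k < K" and own: "own y0 = 0"
    and v: "visits m (m QU) h k"
  shows "wp (expand k)
    (\<lambda>t m'. searching own y0 h (Suc k) n m' \<and> h < m' vT 0 \<and> visits m' (m' QU) h (Suc k) \<and>
       t + 6 * unvisited m' \<le> 5 + 6 * unvisited m) m"
proof -
  let ?g = "gid k (m QU h)"
  have tab: "tables m" and H: "m vH 0 = h" and b: "bfs own y0 (m QU) (m PA) (m vT 0) h k n"
    using s by (auto simp: searching_def)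
  have Qn: "m QU i < n" if "i \<le> h" for i using b h that by (auto simp: bfs_def)
  have Qh: "m QU h < n" using Qn by simp
  have G: "m (GID k) (m QU h) = ?g" using tab Qh k by (simp add: tablesD)
  have vis: "m (VIS k) ?g = 0 \<longleftrightarrow> (\<forall>i<h. gid k (m QU i) \<noteq> ?g)"
    using v k gid_range[OF Qh, of k] unfolding visits_def by auto
  show ?thesis
  proof (cases "m (VIS k) ?g = 0")
    case True
    define m1 where "m1 = m(vG := (m vG)(0 := ?g), VIS k := (m (VIS k))(?g := 1), vC := (m vC)(0 := ?g))"
    have m1: "searching own y0 h k n m1" "h < m1 vT 0" "m1 vC 0 = gid k (m1 QU h)" "m1 QU = m QU"
      using s h by (auto simp: m1_def searching_def)
    have pot: "unvisited m1 + card {z. z < n \<and> gid k z = ?g} = unvisited m"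
      by (rule unvisited_mark[where m = m and g = ?g, OF k True]) (simp add: m1_def)
    have "wp [While (Less (Const 0) (V vC)) (scan k)]
      (\<lambda>t m'. searching own y0 h (Suc k) n m' \<and> h < m' vT 0 \<and> (\<forall>i\<le>h. m' QU i = m1 QU i) \<and>
       t \<le> Suc (6 * card {z. z < n \<and> gid k z = m1 vC 0})) m1"
      using True vis m1(4) by (intro wp_scan_loop[OF m1(1,2) k own m1(3)]) auto
    from wp_frame[OF this]
    have "wp [While (Less (Const 0) (V vC)) (scan k)] (\<lambda>t m'. searching own y0 h (Suc k) n m' \<and> h < m' vT 0 \<and> visits m' (m' QU) h (Suc k) \<and>
       4 + t + 6 * unvisited m' \<le> 5 + 6 * unvisited m) m1"
    proof (rule wp_mono)
      fix t m'
      assume *: "(searching own y0 h (Suc k) n m' \<and> h < m' vT 0 \<and> (\<forall>i\<le>h. m' QU i = m1 QU i) \<and>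
       t \<le> Suc (6 * card {z. z < n \<and> gid k z = m1 vC 0})) \<and>
       (\<forall>a. a \<notin> writes_list [While (Less (Const 0) (V vC)) (scan k)] \<longrightarrow> m' a = m1 a)"
      have VIS: "m' (VIS k') = m1 (VIS k')" for k'
        using * by (auto simp: scan_def)
      have "unvisited m' = unvisited m1" by (simp add: unvisited_def VIS)
      moreover have "visits m' (m' QU) h (Suc k)"
        unfolding visits_def
      proof (intro allI impI)
        fix k' g assume kg: "k' < K" "0 < g" "g \<le> n"
        have "(\<exists>i. (i < h \<or> i = h \<and> k' < Suc k) \<and> gid k' (m' QU i) = g) \<longleftrightarrow>
            (\<exists>i. (i < h \<or> i = h \<and> k' < Suc k) \<and> gid k' (m QU i) = g)"
          using * m1(4) by auto
        also have "\<dots> \<longleftrightarrow> (\<exists>i. (i < h \<or> i = h \<and> k' < k) \<and> gid k' (m QU i) = g) \<or> k' = k \<and> g = ?g"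
          by (auto simp: less_Suc_eq)
        finally show "m' (VIS k') g = 0 \<longleftrightarrow> \<not> (\<exists>i. (i < h \<or> i = h \<and> k' < Suc k) \<and> gid k' (m' QU i) = g)"
          using v kg unfolding VIS m1_def visits_def by auto
      qed
      ultimately show "searching own y0 h (Suc k) n m' \<and> h < m' vT 0 \<and> visits m' (m' QU) h (Suc k) \<and>
       4 + t + 6 * unvisited m' \<le> 5 + 6 * unvisited m"
        using * pot m1 by auto
    qed
    then show ?thesis
      unfolding expand_def using True
      by (intro wp_Write wp_Cond) (auto simp: H G intro!: wp_Write simp: m1_def fun_upd_def)
  next
    case False
    then have ex: "\<exists>i<h. gid k (m QU i) = ?g" using vis by auto
    have "visits m (m QU) h (Suc k)"
      using v ex unfolding visits_def less_Suc_eq by metis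
    moreover have "bfs own y0 (m QU) (m PA) (m vT 0) h (Suc k) n"
      using bfs_visited[OF b] ex by auto
    ultimately show ?thesis
      unfolding expand_def using False s h
      by (intro wp_Write wp_Cond) (auto simp: H G searching_def visits_def unvisited_def intro!: wp_Nil)
  qed
qed

lemma wp_search:
  assumes tab: "tables m" and own: "m OWN y0 = 0" and y0: "m vI 0 = y0" "y0 < n"
    and clear: "\<forall>k<K. \<forall>g. 0 < g \<longrightarrow> g \<le> n \<longrightarrow> m (VIS k) g = 0"
  shows "wp search (\<lambda>t m'. t \<le> 4 + n * (K * 5 + 2) + 6 * (K * n) \<and>
    bfs (m OWN) y0 (m' QU) (m' PA) (m' vT 0) (m' vT 0) 0 n) m"
proof -
  define I where "I m' \<longleftrightarrow> searching (m OWN) y0 (m' vH 0) 0 n m' \<and> m' vH 0 \<le> m' vT 0 \<and>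
    visits m' (m' QU) (m' vH 0) 0" for m'
  \<comment> \<open>Each queue position costs 5 per set and 2 for loop test and increment; the
    second summand pays for all scans.\<close>
  let ?\<phi> = "\<lambda>m'. (n - m' vH 0) * (K * 5 + 2) + 6 * unvisited m'"
  let ?body = "concat (map expand [0..<K]) @ [Write vH (Const 0) (Succ (V vH))]"
  define m1 where "m1 = m(QU := (m QU)(0 := y0), vH := (m vH)(0 := 0), vT := (m vT)(0 := 1))"
  have vH: "m1 vH 0 = 0" by (simp add: m1_def)
  have init: "I m1"
    using tab y0 bfs_init[OF y0(2), of "m OWN" "m QU" "m PA"] clear
    by (auto simp: I_def searching_def m1_def visits_def)
  have body: "wp ?body (\<lambda>t m'. I m' \<and> Suc t + ?\<phi> m' \<le> ?\<phi> m2) m2"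
    if "I m2" "test_val m2 (Less (V vH) (V vT))" for m2
  proof (rule wp_append, rule wp_mono[OF wp_concat_map[where a = 0 and b = K and B = 5 and
          \<phi> = "\<lambda>m'. 6 * unvisited m'" and
          I = "\<lambda>k m'. searching (m OWN) y0 (m2 vH 0) k n m' \<and> m2 vH 0 < m' vT 0 \<and> visits m' (m' QU) (m2 vH 0) k"]])
    fix k m3 assume "k < K" "searching (m OWN) y0 (m2 vH 0) k n m3 \<and> m2 vH 0 < m3 vT 0 \<and> visits m3 (m3 QU) (m2 vH 0) k"
    then show "wp (expand k) (\<lambda>t m'. (searching (m OWN) y0 (m2 vH 0) (Suc k) n m' \<and> m2 vH 0 < m' vT 0 \<and>
        visits m' (m' QU) (m2 vH 0) (Suc k)) \<and> t + 6 * unvisited m' \<le> 5 + 6 * unvisited m3) m3"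
      using own by (intro wp_mono[OF wp_expand]) auto
  next
    fix t m3
    assume *: "(searching (m OWN) y0 (m2 vH 0) K n m3 \<and> m2 vH 0 < m3 vT 0 \<and> visits m3 (m3 QU) (m2 vH 0) K) \<and>
       t + 6 * unvisited m3 \<le> (K - 0) * 5 + 6 * unvisited m2"
    \<comment> \<open>Queue entries are distinct indices, so the head position stays below
      \<open>n\<close> and the truncated subtraction in the potential really drops.\<close>
    have "m2 vH 0 < n" using * bfs_length unfolding searching_def by (meson less_le_trans)
    then obtain r where r: "n - m2 vH 0 = Suc r" "n - Suc (m2 vH 0) = r"
      by (metis Suc_diff_Suc)
    show "wp [Write vH (Const 0) (Succ (V vH))] (\<lambda>s m'. I m' \<and> Suc (t + s) + ?\<phi> m' \<le> ?\<phi> m2) m3"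
      using * r by (intro wp_Write wp_Nil)
        (auto simp: I_def searching_def visits_def unvisited_def less_Suc_eq dest: bfs_next_position)
  qed (use that in \<open>auto simp: I_def searching_def\<close>)
  have "wp [While (Less (V vH) (V vT)) ?body] (\<lambda>t m'. Suc (Suc (Suc t)) \<le> 4 + n * (K * 5 + 2) + 6 * (K * n) \<and>
    bfs (m OWN) y0 (m' QU) (m' PA) (m' vT 0) (m' vT 0) 0 n) m1"
    by (rule wp_mono[OF wp_While[where I = I and \<phi> = ?\<phi>, OF init body]])
      (use unvisited_le[of m1] vH in \<open>auto simp: I_def searching_def algebra_simps\<close>)
  then show ?thesis
    unfolding search_def
    by (intro wp_Write) (use y0 in \<open>simp add: m1_def\<close>)
qed


section \<open>One iteration\<close>

definition found :: "(nat \<Rightarrow> nat) \<Rightarrow> nat \<Rightarrow> (nat \<Rightarrow> nat) \<Rightarrow> nat \<Rightarrow> nat \<Rightarrow> bool" where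
  "found own d Q u k \<longleftrightarrow> k < K \<and> grp own k (gid k (Q u)) n < d"

definition selected :: "(nat \<Rightarrow> nat) \<Rightarrow> nat \<Rightarrow> (nat \<Rightarrow> nat) \<Rightarrow> nat \<Rightarrow> nat \<Rightarrow> nat \<Rightarrow> bool" where
  "selected own d Q h u l \<longleftrightarrow>
     (l = 0 \<and> u = 0 \<and> (\<forall>u'<h. \<forall>k. \<not> found own d Q u' k)) \<or>
     (\<exists>k. l = Suc k \<and> u < h \<and> found own d Q u k \<and> (\<forall>u'<u. \<forall>k. \<not> found own d Q u' k))"

lemma selected_Suc:
  assumes "\<forall>u'<h. \<forall>k. \<not> found own d Q u' k"
    and "(l = 0 \<and> u = 0 \<and> (\<forall>k<K. \<not> found own d Q h k)) \<or> (\<exists>k. l = Suc k \<and> u = h \<and> found own d Q h k)"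
  shows "selected own d Q (Suc h) u l"
  using assms(2)
proof
  assume *: "l = 0 \<and> u = 0 \<and> (\<forall>k<K. \<not> found own d Q h k)"
  then have "\<not> found own d Q h k" for k by (cases "k < K") (simp_all add: found_def)
  then show ?thesis using * assms(1) by (simp add: selected_def less_Suc_eq)
next
  assume "\<exists>k. l = Suc k \<and> u = h \<and> found own d Q h k"
  then show ?thesis using assms(1) unfolding selected_def by blast
qed

lemma selected_mono: "selected own d Q h u l \<Longrightarrow> l \<noteq> 0 \<Longrightarrow> selected own d Q (Suc h) u l"
  unfolding selected_def using less_SucI by blast

lemma wp_select:
  assumes tab: "tables m" and Q: "\<forall>j<m vT 0. m QU j < n"
    and cnt: "\<forall>k<K. \<forall>g. 0 < g \<longrightarrow> g \<le> n \<longrightarrow> m (CNT k) g = grp own k g n" and T: "m vT 0 \<le> n"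
  shows "wp select (\<lambda>t m'. t \<le> 4 + n * (K * 3 + 3) \<and>
    selected own (m Degree 0) (m QU) (m vT 0) (m' vU 0) (m' vL 0)) m"
proof -
  let ?c = "\<lambda>k. [Cond (Less (Read (CNT k) (Read (GID k) (Read QU (V vH)))) (V Degree))
                [Write vL (Const 0) (Const (Suc k)), Write vU (Const 0) (V vH)] []]"
  let ?body = "[Cond (Equal (V vL) (Const 0)) (concat (map ?c [0..<K])) []]"
  let ?found = "found own (m Degree 0) (m QU)"
  let ?sel = "selected own (m Degree 0) (m QU)"
  define m0 where "m0 = m(vU := (m vU)(0 := 0), vL := (m vL)(0 := 0))"
  have w: "writes_list ?body \<subseteq> {vL, vU}" by (auto simp: writes_list_concat)
  have "wp (for_loop vH (V vT) ?body) (\<lambda>t m'. t \<le> 2 + m vT 0 * ((K * 3 + 1) + 2) \<and> ?sel (m vT 0) (m' vU 0) (m' vL 0)) m0"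
  proof (rule wp_for[where I = "\<lambda>i m'. ?sel i (m' vU 0) (m' vL 0)"])
    fix i m1
    assume *: "?sel i (m1 vU 0) (m1 vL 0)" "i < m vT 0" "m1 vH 0 = i"
      and fr: "\<And>a. a \<notin> insert vH (writes_list ?body) \<Longrightarrow> m1 a = m0 a"
    have fr': "m1 a = m a" if "a \<notin> {vH, vL, vU}" for a
    proof -
      have "m1 a = m0 a" using that w by (intro fr) blast
      then show ?thesis using that by (simp add: m0_def)
    qed
    have tab1: "tables m1" by (rule tables_frame[OF tab], rule fr') auto
    have QU: "m1 QU = m QU" and D: "m1 Degree = m Degree" and C: "\<And>k. m1 (CNT k) = m (CNT k)"
      by (rule fr'; simp)+
    have Qi: "m QU i < n" using Q *(2) by auto
    show "wp ?body (\<lambda>t m'. t \<le> K * 3 + 1 \<and> ?sel (Suc i) ((m'(vH := (m' vH)(0 := Suc i))) vU 0)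
        ((m'(vH := (m' vH)(0 := Suc i))) vL 0)) m1"
    proof (cases "m1 vL 0 = 0")
      case True
      then have none: "\<forall>u'<i. \<forall>k. \<not> ?found u' k" "m1 vU 0 = 0" using *(1) by (auto simp: selected_def)
      have "wp (concat (map ?c [0..<K])) (\<lambda>t m'. t \<le> K * 3 \<and>
          ((m' vL 0 = 0 \<and> m' vU 0 = 0 \<and> (\<forall>k<K. \<not> ?found i k)) \<or> (\<exists>k. m' vL 0 = Suc k \<and> m' vU 0 = i \<and> ?found i k))) m1"
      proof (rule wp_concat_loop[where I = "\<lambda>k0 m'. (m' vL 0 = 0 \<and> m' vU 0 = 0 \<and> (\<forall>k<k0. \<not> ?found i k)) \<or>
          (\<exists>k. m' vL 0 = Suc k \<and> m' vU 0 = i \<and> ?found i k)"])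
        fix k m2
        assume **: "k < K" "(m2 vL 0 = 0 \<and> m2 vU 0 = 0 \<and> (\<forall>k'<k. \<not> ?found i k')) \<or>
          (\<exists>k. m2 vL 0 = Suc k \<and> m2 vU 0 = i \<and> ?found i k)"
          and fr2: "\<And>a. a \<notin> (\<Union>k<K. writes_list (?c k)) \<Longrightarrow> m2 a = m1 a"
        have eq: "m2 (CNT k) = m (CNT k)" "m2 (GID k) = m (GID k)" "m2 QU = m QU" "m2 Degree = m Degree"
          "m2 vH = m1 vH"
          by (subst fr2; simp add: fr')+
        have val: "m2 (CNT k) (m2 (GID k) (m2 QU (m2 vH 0))) = grp own k (gid k (m QU i)) n"
          unfolding eq *(3) using **(1) cnt gid_range[OF Qi] tablesD(2)[OF tab _ Qi, of k] by simp
        show "wp (?c k) (\<lambda>t m'. t \<le> 3 \<and> ((m' vL 0 = 0 \<and> m' vU 0 = 0 \<and> (\<forall>k'<Suc k. \<not> ?found i k')) \<or>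
          (\<exists>k. m' vL 0 = Suc k \<and> m' vU 0 = i \<and> ?found i k))) m2"
        proof (cases "?found i k")
          case True
          have "m2 (CNT k) (m2 (GID k) (m2 QU (m2 vH 0))) < m2 Degree 0"
            unfolding val eq(4) using True by (simp add: found_def)
          moreover have "m2 vH 0 = i" using eq(5) *(3) by simp
          ultimately have "wp (?c k) (\<lambda>t m'. t \<le> 3 \<and> m' vL 0 = Suc k \<and> m' vU 0 = i) m2"
            by (intro wp_Cond) (auto intro!: wp_Write wp_Nil)
          then show ?thesis
            by (rule wp_mono) (use True in blast)
        next
          case False
          have "\<not> m2 (CNT k) (m2 (GID k) (m2 QU (m2 vH 0))) < m2 Degree 0"
            unfolding val eq(4) using False **(1) by (simp add: found_def)
          then have "wp (?c k) (\<lambda>t m'. t \<le> 3 \<and> m' = m2) m2"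
            by (intro wp_Cond) (auto intro!: wp_Nil)
          moreover have "\<forall>k'<Suc k. \<not> ?found i k'" if "\<forall>k'<k. \<not> ?found i k'"
            using that False less_Suc_eq by blast
          ultimately show ?thesis
            using **(2) by (elim wp_mono) blast
        qed
      qed (use True none in simp)
      then have "wp (concat (map ?c [0..<K])) (\<lambda>t m'. Suc t \<le> K * 3 + 1 \<and> ?sel (Suc i) (m' vU 0) (m' vL 0)) m1"
        by (rule wp_mono) (use selected_Suc[OF none(1)] in simp)
      then show ?thesis
        using True by (intro wp_Cond) simp
    next
      case False
      then show ?thesis using *(1)
        by (intro wp_Cond) (simp add: False wp_Nil selected_mono)
    qed
  next
    fix i :: nat and m1 assume "\<And>a. a \<notin> insert vH (writes_list ?body) \<Longrightarrow> m1 a = m0 a"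
    then have "m1 vT = m0 vT" by simp
    then show "expr_val m1 (V vT) = m vT 0" by (simp add: m0_def)
  next
    show "vH \<notin> writes_list ?body" using w by auto
  qed (simp add: m0_def selected_def)
  then have "wp (for_loop vH (V vT) ?body) (\<lambda>t m'. Suc (Suc t) \<le> 4 + n * (K * 3 + 3) \<and>
      ?sel (m vT 0) (m' vU 0) (m' vL 0)) m0"
  proof (rule wp_mono)
    fix t m' assume *: "t \<le> 2 + m vT 0 * ((K * 3 + 1) + 2) \<and> ?sel (m vT 0) (m' vU 0) (m' vL 0)"
    have "m vT 0 * ((K * 3 + 1) + 2) \<le> n * (K * 3 + 3)" using T by (intro mult_mono) auto
    with * show "Suc (Suc t) \<le> 4 + n * (K * 3 + 3) \<and> ?sel (m vT 0) (m' vU 0) (m' vL 0)" by linarith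
  qed
  then show ?thesis
    unfolding select_def append_Cons append_Nil
    by (intro wp_Write) (simp add: m0_def fun_upd_def)
qed

section \<open>Updating the owners and publishing the parts\<close>

lemma wp_grow:
  "wp grow (\<lambda>t m'. t \<le> 3 \<and> m' vL 0 = (if m vL 0 = 0 then 1 else m vL 0) \<and>
     m' Degree 0 = (if m vL 0 = 0 then Suc (m Degree 0) else m Degree 0)) m"
  unfolding grow_def by (intro wp_Cond) (auto intro!: wp_Write wp_Nil)

text \<open>The test \<open>P u < u\<close> makes the recursion terminate for arbitrary
  \<open>P\<close>; the parent positions of a search satisfy it.\<close>

fun shifted :: "(nat \<Rightarrow> nat) \<Rightarrow> (nat \<Rightarrow> nat) \<Rightarrow> (nat \<Rightarrow> nat) \<Rightarrow> nat \<Rightarrow> nat \<Rightarrow> (nat \<Rightarrow> nat)" where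
  "shifted Q P own u l =
     (if 0 < u \<and> P u < u then shifted Q P (own(Q u := l)) (P u) (own (Q u)) else own(Q 0 := l))"

declare shifted.simps [simp del]

lemma wp_shift:
  assumes "\<forall>j. 0 < j \<and> j \<le> m vU 0 \<longrightarrow> m PA j < j"
  shows "wp shift (\<lambda>t m'. t \<le> 2 + 5 * m vU 0 \<and> m' OWN = shifted (m QU) (m PA) (m OWN) (m vU 0) (m vL 0)) m"
proof -
  let ?cs = "[Write vG (Const 0) (Read OWN (Read QU (V vU))),
         Write OWN (Read QU (V vU)) (V vL),
         Write vL (Const 0) (V vG),
         Write vU (Const 0) (Read PA (V vU))] :: 'v com list"
  define I where "I m' \<longleftrightarrow> m' QU = m QU \<and> m' PA = m PA \<and> m' vU 0 \<le> m vU 0 \<and>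
    shifted (m QU) (m PA) (m' OWN) (m' vU 0) (m' vL 0) = shifted (m QU) (m PA) (m OWN) (m vU 0) (m vL 0)" for m' :: "'v memory"
  have body: "wp ?cs (\<lambda>t m'. I m' \<and> Suc t + 5 * m' vU 0 \<le> 5 * m1 vU 0) m1"
    if I: "I m1" and "test_val m1 (Less (Const 0) (V vU))" for m1
  proof -
    have pos: "0 < m1 vU 0" using that by simp
    have lt: "m PA (m1 vU 0) < m1 vU 0" using assms pos I by (auto simp: I_def)
    show ?thesis
      using I lt pos shifted.simps[of "m QU" "m PA" "m1 OWN" "m1 vU 0" "m1 vL 0"]
      by (intro wp_Write wp_Nil) (auto simp: I_def)
  qed
  have "wp [While (Less (Const 0) (V vU)) ?cs] (\<lambda>t m'. I m' \<and> \<not> test_val m' (Less (Const 0) (V vU)) \<and>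
      t + 5 * m' vU 0 \<le> Suc (5 * m vU 0)) m"
    using body by (intro wp_While) (auto simp: I_def)
  then have "wp ([While (Less (Const 0) (V vU)) ?cs] @ [Write OWN (Read QU (Const 0)) (V vL)])
    (\<lambda>t m'. t \<le> 2 + 5 * m vU 0 \<and> m' OWN = shifted (m QU) (m PA) (m OWN) (m vU 0) (m vL 0)) m"
    apply (intro wp_append)
    apply (erule wp_mono)
    apply (intro wp_Write wp_Nil)
    subgoal for t m'
      using shifted.simps[of "m QU" "m PA" "m' OWN" "m' vU 0" "m' vL 0"] by (auto simp: I_def)
    done
  then show ?thesis by (simp add: shift_def)
qed

definition published :: "'v memory \<Rightarrow> bool" where
  "published m \<longleftrightarrow> (\<forall>k<K. \<forall>i<n. m (Part (Xs ! k)) i = (if m OWN (gid K i - 1) = Suc k then 1 else 0))"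

lemma wp_publish:
  assumes tab: "tables m"
  shows "wp publish (\<lambda>t m'. t \<le> 2 + n * (K * 2 + 2) \<and> published m') m"
proof -
  let ?c = "\<lambda>k. [Cond (Equal (Read OWN (Pred (Read (GID K) (V vJ)))) (Const (Suc k)))
        [Write (Part (Xs ! k)) (V vJ) (Const 1)] [Write (Part (Xs ! k)) (V vJ) (Const 0)]]"
  let ?v = "\<lambda>k i. if m OWN (gid K i - 1) = Suc k then 1 else 0 :: nat"
  \<comment> \<open>Different set numbers mean different output arrays, so no block overwrites the
    result of another.\<close>
  have inj: "Xs ! k = Xs ! k' \<longleftrightarrow> k = k'" if "k < K" "k' < K" for k k'
    using that distinct_Xs by (simp add: nth_eq_iff_index_eq)
  have "wp publish (\<lambda>t m'. t \<le> 2 + n * (K * 2 + 2) \<and> (\<forall>k<K. \<forall>i<n. m' (Part (Xs ! k)) i = ?v k i)) m"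
    unfolding publish_def
  proof (rule wp_for[where I = "\<lambda>j m'. \<forall>k<K. \<forall>i<j. m' (Part (Xs ! k)) i = ?v k i"])
    fix j m1
    assume *: "\<forall>k<K. \<forall>i<j. m1 (Part (Xs ! k)) i = ?v k i" "j < n" "m1 vJ 0 = j"
      and fr: "\<And>a. a \<notin> insert vJ (writes_list (concat (map ?c [0..<K]))) \<Longrightarrow> m1 a = m a"
    have own: "m1 OWN = m OWN" by (rule fr) auto
    have tab1: "tables m1" by (rule tables_frame[OF tab], rule fr) auto
    show "wp (concat (map ?c [0..<K])) (\<lambda>t m'. t \<le> K * 2 \<and>
      (\<forall>k<K. \<forall>i<Suc j. (m'(vJ := (m' vJ)(0 := Suc j))) (Part (Xs ! k)) i = ?v k i)) m1"
    proof (rule wp_mono[OF wp_concat_loop[where B = 2 and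
          I = "\<lambda>k0 m'. \<forall>k<K. \<forall>i<(if k < k0 then Suc j else j). m' (Part (Xs ! k)) i = ?v k i"]])
      fix k m2
      assume **: "k < K" "\<forall>k'<K. \<forall>i<(if k' < k then Suc j else j). m2 (Part (Xs ! k')) i = ?v k' i"
        and fr2: "\<And>a. a \<notin> (\<Union>k<K. writes_list (?c k)) \<Longrightarrow> m2 a = m1 a"
      have eq: "m2 OWN = m OWN" "m2 (GID K) j = gid K j" "m2 vJ 0 = j"
        using own *(2,3) tablesD(2)[OF tab1, of K j] by (subst fr2; simp)+
      have "wp (?c k) (\<lambda>t m'. t \<le> 2 \<and> m' = m2(Part (Xs ! k) := (m2 (Part (Xs ! k)))(j := ?v k j))) m2"
        using eq by (intro wp_Cond) (auto intro!: wp_Write wp_Nil)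
      then show "wp (?c k) (\<lambda>t m'. t \<le> 2 \<and> (\<forall>k'<K. \<forall>i<(if k' < Suc k then Suc j else j). m' (Part (Xs ! k')) i = ?v k' i)) m2"
        by (rule wp_mono) (use ** inj in \<open>auto simp: less_Suc_eq split: if_splits\<close>)
    qed (use * in \<open>auto simp: less_Suc_eq\<close>)
  qed (use tablesD(1)[OF tab] in auto)
  from wp_frame[OF this] show ?thesis
  proof (rule wp_mono)
    fix t m' assume *: "(t \<le> 2 + n * (K * 2 + 2) \<and> (\<forall>k<K. \<forall>i<n. m' (Part (Xs ! k)) i = ?v k i)) \<and>
      (\<forall>a. a \<notin> writes_list publish \<longrightarrow> m' a = m a)"
    have "m' OWN = m OWN" using *[THEN conjunct2] by (auto simp: publish_def for_loop_def)
    then show "t \<le> 2 + n * (K * 2 + 2) \<and> published m'" using * by (simp add: published_def)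
  qed
qed

lemma writes_blocks:
  "writes_list clear \<subseteq> {vJ} \<union> range CNT \<union> range VIS"
  "writes_list count \<subseteq> {vJ} \<union> range CNT"
  "writes_list search \<subseteq> {QU, PA, vH, vT, vG, vC} \<union> range VIS"
  "writes_list select \<subseteq> {vH, vU, vL}"
  "writes_list grow \<subseteq> {Degree, vL}"
  "writes_list shift \<subseteq> {OWN, vU, vL, vG}"
  "writes_list publish \<subseteq> {vJ} \<union> range Part"
  by (auto simp: clear_def count_def search_def expand_def scan_def select_def grow_def shift_def
      publish_def for_loop_def)

lemma not_static:
  "a \<in> static \<Longrightarrow> a \<notin> {QU, PA, OWN, vI, vJ, vH, vT, vC, vG, vU, vL, Degree} \<union> range CNT \<union> range VIS \<union> range Part"
  by (auto simp: static_def)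

text \<open>The existential quantifiers hide the scratch data of the search; what matters for the
  next iteration is the new \<open>OWN\<close> and \<open>Degree\<close>.\<close>

lemma wp_iteration:
  assumes tab: "tables m" and own: "m OWN y0 = 0" and y0: "m vI 0 = y0" "y0 < n"
  shows "wp iteration (\<lambda>t m'. t \<le> 50 * (K + 1) * (n + 1) \<and> tables m' \<and> m' vI = m vI \<and> published m' \<and>
    (\<exists>Q P T u l. bfs (m OWN) y0 Q P T T 0 n \<and> selected (m OWN) (m Degree 0) Q T u l \<and>
       m' OWN = shifted Q P (m OWN) u (if l = 0 then 1 else l) \<and>
       m' Degree 0 = (if l = 0 then Suc (m Degree 0) else m Degree 0))) m"
proof -
  define post where "post m' \<longleftrightarrow> tables m' \<and> m' vI = m vI \<and> published m' \<and>
    (\<exists>Q P T u l. bfs (m OWN) y0 Q P T T 0 n \<and> selected (m OWN) (m Degree 0) Q T u l \<and>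
       m' OWN = shifted Q P (m OWN) u (if l = 0 then 1 else l) \<and>
       m' Degree 0 = (if l = 0 then Suc (m Degree 0) else m Degree 0))" for m'
  have "wp iteration (\<lambda>t m'. t \<le> (2 + n * (K * 2 + 2)) + ((2 + n * (K * 2 + 2)) +
      ((4 + n * (K * 5 + 2) + 6 * (K * n)) + ((4 + n * (K * 3 + 3)) + (3 + ((2 + 5 * n) +
      (2 + n * (K * 2 + 2))))))) \<and> post m') m"
    unfolding iteration_def
  proof (rule wp_seq[OF wp_clear[OF tab]])
    fix m1 assume m1: "\<forall>k<K. \<forall>g. 0 < g \<longrightarrow> g \<le> n \<longrightarrow> m1 (CNT k) g = 0 \<and> m1 (VIS k) g = 0"
      and "\<And>a. a \<notin> writes_list clear \<Longrightarrow> m1 a = m a"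
    then have f1: "m1 a = m a" if "a \<notin> {vJ} \<union> range CNT \<union> range VIS" for a
      using writes_blocks(1) that by blast
    have tab1: "tables m1" by (rule tables_frame[OF tab], rule f1) (use not_static in blast)
    have e1: "m1 OWN = m OWN" "m1 vI = m vI" "m1 Degree = m Degree" by (rule f1; simp add: image_iff)+
    show "wp (count @ search @ select @ grow @ shift @ publish) (\<lambda>t m'. t \<le> (2 + n * (K * 2 + 2)) +
      ((4 + n * (K * 5 + 2) + 6 * (K * n)) + ((4 + n * (K * 3 + 3)) + (3 + ((2 + 5 * n) +
      (2 + n * (K * 2 + 2)))))) \<and> post m') m1"
    proof (rule wp_seq[OF wp_count[OF tab1]])
      show "\<forall>k<K. \<forall>g. 0 < g \<longrightarrow> g \<le> n \<longrightarrow> m1 (CNT k) g = 0" using m1 by blast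
    next
      fix m2 assume m2: "\<forall>k<K. \<forall>g. 0 < g \<longrightarrow> g \<le> n \<longrightarrow> m2 (CNT k) g = grp (m1 OWN) k g n"
        and "\<And>a. a \<notin> writes_list count \<Longrightarrow> m2 a = m1 a"
      then have f2: "m2 a = m1 a" if "a \<notin> {vJ} \<union> range CNT" for a
        using writes_blocks(2) that by blast
      have tab2: "tables m2" by (rule tables_frame[OF tab1], rule f2) (use not_static in blast)
      have "m2 OWN = m1 OWN" "m2 vI = m1 vI" "m2 Degree = m1 Degree" and V2: "\<And>k. m2 (VIS k) = m1 (VIS k)"
        by (rule f2; simp add: image_iff)+
      note e2 = this(1-3)[unfolded e1]
      show "wp (search @ select @ grow @ shift @ publish) (\<lambda>t m'. t \<le>
        (4 + n * (K * 5 + 2) + 6 * (K * n)) + ((4 + n * (K * 3 + 3)) + (3 + ((2 + 5 * n) +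
        (2 + n * (K * 2 + 2))))) \<and> post m') m2"
      proof (rule wp_seq[OF wp_search[OF tab2]])
        show "m2 OWN y0 = 0" "m2 vI 0 = y0" "y0 < n" using own y0 e2 by simp_all
        show "\<forall>k<K. \<forall>g. 0 < g \<longrightarrow> g \<le> n \<longrightarrow> m2 (VIS k) g = 0" using m1 unfolding V2 by blast
      next
        fix m3 assume m3: "bfs (m2 OWN) y0 (m3 QU) (m3 PA) (m3 vT 0) (m3 vT 0) 0 n"
          and "\<And>a. a \<notin> writes_list search \<Longrightarrow> m3 a = m2 a"
        then have f3: "m3 a = m2 a" if "a \<notin> {QU, PA, vH, vT, vG, vC} \<union> range VIS" for a
          using writes_blocks(3) that by blast
        have tab3: "tables m3" by (rule tables_frame[OF tab2], rule f3) (use not_static in blast)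
        have "m3 OWN = m2 OWN" "m3 vI = m2 vI" "m3 Degree = m2 Degree" and C3: "\<And>k. m3 (CNT k) = m2 (CNT k)"
          by (rule f3; simp add: image_iff)+
        note e3 = this(1-3)[unfolded e2]
        note b = m3[unfolded e2]
        show "wp (select @ grow @ shift @ publish) (\<lambda>t m'. t \<le>
          (4 + n * (K * 3 + 3)) + (3 + ((2 + 5 * n) + (2 + n * (K * 2 + 2)))) \<and> post m') m3"
        proof (rule wp_seq[OF wp_select[OF tab3, of "m OWN"]])
          show "\<forall>j<m3 vT 0. m3 QU j < n" using bfsD(4)[OF b] by blast
          show "\<forall>k<K. \<forall>g. 0 < g \<longrightarrow> g \<le> n \<longrightarrow> m3 (CNT k) g = grp (m OWN) k g n"
            using m2 unfolding C3 e1 .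
          show "m3 vT 0 \<le> n" using bfs_length[OF b] .
        next
          fix m4 assume m4: "selected (m OWN) (m3 Degree 0) (m3 QU) (m3 vT 0) (m4 vU 0) (m4 vL 0)"
            and "\<And>a. a \<notin> writes_list select \<Longrightarrow> m4 a = m3 a"
          then have f4: "m4 a = m3 a" if "a \<notin> {vH, vU, vL}" for a
            using writes_blocks(4) that by blast
          have tab4: "tables m4" by (rule tables_frame[OF tab3], rule f4) (use not_static in blast)
          have "m4 OWN = m3 OWN" "m4 vI = m3 vI" "m4 Degree = m3 Degree" and q4: "m4 QU = m3 QU" "m4 PA = m3 PA"
            by (rule f4; simp)+
          note e4 = this(1-3)[unfolded e3]
          show "wp (grow @ shift @ publish) (\<lambda>t m'. t \<le> 3 + ((2 + 5 * n) + (2 + n * (K * 2 + 2))) \<and> post m') m4"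
          proof (rule wp_seq[OF wp_grow])
            fix m5 assume m5: "m5 vL 0 = (if m4 vL 0 = 0 then 1 else m4 vL 0) \<and>
                m5 Degree 0 = (if m4 vL 0 = 0 then Suc (m4 Degree 0) else m4 Degree 0)"
              and "\<And>a. a \<notin> writes_list grow \<Longrightarrow> m5 a = m4 a"
            then have f5: "m5 a = m4 a" if "a \<notin> {Degree, vL}" for a
              using writes_blocks(5) that by blast
            have tab5: "tables m5" by (rule tables_frame[OF tab4], rule f5) (use not_static in blast)
            have "m5 OWN = m4 OWN" "m5 vI = m4 vI" and q5: "m5 QU = m4 QU" "m5 PA = m4 PA" "m5 vU = m4 vU"
              by (rule f5; simp)+
            note e5 = this(1,2)[unfolded e4]
            have u: "m5 vU 0 < m3 vT 0 \<and> m5 vU 0 < n"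
              using m4 bfsD(1)[OF b] bfs_length[OF b] unfolding q5 selected_def by auto
            have "wp shift (\<lambda>t m'. t \<le> 2 + 5 * n \<and> m' OWN = shifted (m3 QU) (m3 PA) (m OWN) (m5 vU 0) (m5 vL 0)) m5"
            proof (rule wp_mono[OF wp_shift])
              show "\<forall>j. 0 < j \<and> j \<le> m5 vU 0 \<longrightarrow> m5 PA j < j"
                using bfsD(5)[OF b] u unfolding q4 q5 by auto
            qed (use u q4 q5 e5 in auto)
            then show "wp (shift @ publish) (\<lambda>t m'. t \<le> (2 + 5 * n) + (2 + n * (K * 2 + 2)) \<and> post m') m5"
            proof (rule wp_seq)
              fix m6 assume m6: "m6 OWN = shifted (m3 QU) (m3 PA) (m OWN) (m5 vU 0) (m5 vL 0)"
                and "\<And>a. a \<notin> writes_list shift \<Longrightarrow> m6 a = m5 a"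
              then have f6: "m6 a = m5 a" if "a \<notin> {OWN, vU, vL, vG}" for a
                using writes_blocks(6) that by blast
              have tab6: "tables m6" by (rule tables_frame[OF tab5], rule f6) (use not_static in blast)
              have e6: "m6 vI = m5 vI" "m6 Degree = m5 Degree"
                by (rule f6; simp)+
              show "wp publish (\<lambda>t m'. t \<le> 2 + n * (K * 2 + 2) \<and> post m') m6"
              proof (rule wp_mono[OF wp_frame[OF wp_publish[OF tab6]]], elim conjE, intro conjI)
                fix t m7 assume m7: "published m7" and "\<forall>a. a \<notin> writes_list publish \<longrightarrow> m7 a = m6 a"
                then have f7: "m7 a = m6 a" if "a \<notin> {vJ} \<union> range Part" for a
                  using writes_blocks(7) that by blast
                have tab7: "tables m7" by (rule tables_frame[OF tab6], rule f7) (use not_static in blast)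
                have e7: "m7 OWN = m6 OWN" "m7 vI = m6 vI" "m7 Degree = m6 Degree"
                  by (rule f7; simp add: image_iff)+
                have "m7 vI = m vI" using e7 e6 e5 by simp
                moreover have "m7 OWN = shifted (m3 QU) (m3 PA) (m OWN) (m4 vU 0) (if m4 vL 0 = 0 then 1 else m4 vL 0)"
                  unfolding e7 m6 q5 using m5 by simp
                moreover have "m7 Degree 0 = (if m4 vL 0 = 0 then Suc (m Degree 0) else m Degree 0)"
                  unfolding e7 e6 using m5 e4 by simp
                ultimately show "post m7"
                  unfolding post_def using tab7 m7 b m4[unfolded e3] by blast
              qed
            qed
          qed
        qed
      qed
    qed
  qed
  \<comment> \<open>The bounds of the blocks add up to \<open>19 + 16 * n + 20 * K * n\<close>, for
    which 50 is a generous common factor.\<close>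
  then show ?thesis
    by (rule wp_mono) (auto simp: post_def algebra_simps)
qed

end

section \<open>Correctness of the program\<close>

text \<open>This becomes the list \<open>ys\<close> of an augmenting path; the root at position 0 is
  left out, matching the separate \<open>y0\<close>.\<close>

fun trace :: "(nat \<Rightarrow> nat) \<Rightarrow> (nat \<Rightarrow> 'b) \<Rightarrow> nat \<Rightarrow> 'b list" where
  "trace P g u = (if 0 < u \<and> P u < u then trace P g (P u) @ [g u] else [])"

declare trace.simps [simp del]

locale eda_execution =
  decomposition Z Y \<X> R + execution Xs vs "length ts" col L
  for Z Y :: "'v set" and \<X> :: "'v set set" and R :: "('v, 'a) rel" and ts :: "('v, 'a) tuple list"
    and Xs :: "'v set list" and vs :: "nat \<Rightarrow> 'v list" and col :: "'v \<Rightarrow> nat \<Rightarrow> nat" and L :: nat +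
  assumes set_Xs: "set Xs = \<X>" and distinct_ts: "distinct ts" and set_ts: "set ts = R"
    and agr_set: "\<And>k i j. k < length Xs \<Longrightarrow> i < length ts \<Longrightarrow> j < length ts \<Longrightarrow>
      agr k i j \<longleftrightarrow> agree (Xs ! k) (ts ! i) (ts ! j)"
    and agr_Y: "\<And>i j. i < length ts \<Longrightarrow> j < length ts \<Longrightarrow> agr (length Xs) i j \<longleftrightarrow> agree Y (ts ! i) (ts ! j)"
begin

abbreviation n :: nat where "n \<equiv> length ts"

section \<open>Indices, representatives and owners\<close>

definition key :: "nat \<Rightarrow> ('v, 'a) tuple" where "key i = (ts ! i) |` Y"

definition reps :: "nat set" where "reps = {z. z < n \<and> gid K z = Suc z}"

definition part_of :: "nat \<Rightarrow> 'v set option" where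
  "part_of l = (case l of 0 \<Rightarrow> None | Suc k \<Rightarrow> Some (Xs ! k))"

lemma part_of_simps [simp]: "part_of 0 = None" "part_of (Suc k) = Some (Xs ! k)"
  by (simp_all add: part_of_def)

definition encodes :: "(nat \<Rightarrow> nat) \<Rightarrow> (('v, 'a) tuple \<rightharpoonup> 'v set) \<Rightarrow> bool" where
  "encodes own f \<longleftrightarrow> (\<forall>z<n. own z \<noteq> 0 \<longrightarrow> z \<in> reps) \<and> (\<forall>z\<in>reps. own z \<le> K \<and> f (key z) = part_of (own z)) \<and> dom f \<subseteq> D"

lemma K_pos: "0 < K"
  using \<X>_nonempty set_Xs by auto

lemma nth_Xs: "k < K \<Longrightarrow> Xs ! k \<in> \<X>"
  using set_Xs by auto

lemma key_D: "i < n \<Longrightarrow> key i \<in> D"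
  using set_ts by (auto simp: key_def proj_def)

lemma key_eq_iff: "i < n \<Longrightarrow> j < n \<Longrightarrow> key i = key j \<longleftrightarrow> gid K i = gid K j"
  by (simp add: key_def gid_eq_iff agr_Y agree_iff_restrict_eq)

lemma gid_eq_iff_agree:
  assumes "k < K" "i < n" "j < n"
  shows "gid k i = gid k j \<longleftrightarrow> agree (Xs ! k) (key i) (key j)"
proof -
  have sub: "Xs ! k \<subseteq> Y" using sub_Y nth_Xs assms(1) by blast
  show ?thesis
    using assms sub by (simp add: key_def gid_eq_iff agr_set agree_iff_restrict_eq Int_absorb1)
qed

lemma reps_less: "z \<in> reps \<Longrightarrow> z < n"
  by (simp add: reps_def)

lemma rep_reps: "i < n \<Longrightarrow> gid K i - 1 \<in> reps" and key_rep: "i < n \<Longrightarrow> key (gid K i - 1) = key i"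
proof -
  assume i: "i < n"
  then have lt: "gid K i - 1 < n" using gid_range[OF i, of K] by linarith
  show "gid K i - 1 \<in> reps" using lt gid_pred[OF i, of K] gid_range[OF i, of K] by (simp add: reps_def)
  show "key (gid K i - 1) = key i" using key_eq_iff[OF lt i] gid_pred[OF i] by simp
qed

lemma inj_key: "inj_on key reps"
  by (rule inj_onI) (simp add: reps_def key_eq_iff)

lemma D_cases:
  assumes "y \<in> D" obtains z where "z \<in> reps" "y = key z"
proof -
  obtain i where "i < n" "y = key i"
    using assms set_ts by (auto simp: proj_def key_def in_set_conv_nth)
  then show thesis using that rep_reps key_rep by metis
qed

lemma key_reps: "key ` reps = D"
  using D_cases key_D reps_less by blast

lemma encodes_valid:
  assumes "encodes own f"
  shows "valid f"
proof -
  have "X \<in> \<X>" if "f y = Some X" for y X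
  proof -
    have "y \<in> D" using that assms by (auto simp: encodes_def)
    then obtain z where z: "z \<in> reps" "y = key z" by (rule D_cases)
    then have "own z \<le> K" "part_of (own z) = Some X" using assms that by (auto simp: encodes_def)
    then show ?thesis using nth_Xs by (cases "own z") auto
  qed
  then show ?thesis using assms by (auto simp: valid_def encodes_def ran_def)
qed

lemma encodes_Some:
  assumes "encodes own f" "z \<in> reps" "k < K"
  shows "f (key z) = Some (Xs ! k) \<longleftrightarrow> own z = Suc k"
proof -
  have le: "own z \<le> K" and f: "f (key z) = part_of (own z)" using assms by (auto simp: encodes_def)
  show ?thesis
  proof (cases "own z")
    case (Suc k')
    then have "Xs ! k' = Xs ! k \<longleftrightarrow> k' = k"
      using le assms(3) distinct_Xs by (simp add: nth_eq_iff_index_eq)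
    then show ?thesis using f Suc by simp
  qed (use f in simp)
qed

lemma encodes_own:
  assumes "encodes own f" "z < n" "own z = Suc k"
  shows "z \<in> reps" "k < K" "f (key z) = Some (Xs ! k)"
proof -
  show "z \<in> reps" using assms by (simp add: encodes_def)
  then have "own z \<le> K" "f (key z) = part_of (own z)" using assms(1) by (auto simp: encodes_def)
  then show "k < K" "f (key z) = Some (Xs ! k)" using assms(3) by simp_all
qed

lemma encodes_upd:
  assumes "encodes own f" "z \<in> reps" "k < K"
  shows "encodes (own(z := Suc k)) (f(key z \<mapsto> Xs ! k))"
proof -
  have "key z' = key z \<longleftrightarrow> z' = z" if "z' \<in> reps" for z'
    using inj_key assms(2) that by (meson inj_on_eq_iff)
  then show ?thesis
    using assms key_D[OF reps_less] by (auto simp: encodes_def)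
qed

text \<open>Only representatives have owners, and \<open>key\<close> is injective on them, so
  counting owned indices counts each projected tuple once, however large its class is.\<close>

lemma grp_eq:
  assumes "encodes own f" "k < K" "u < n"
  shows "grp own k (gid k u) n = card (members f (Xs ! k) (key u))"
proof -
  let ?A = "{z. z < n \<and> own z = Suc k \<and> gid k z = gid k u}"
  have sub: "?A \<subseteq> reps" using encodes_own(1)[OF assms(1)] by auto
  have "members f (Xs ! k) (key u) = key ` ?A"
  proof (intro equalityI subsetI)
    fix y assume y: "y \<in> members f (Xs ! k) (key u)"
    then have "y \<in> D" by (simp add: members_def)
    then obtain z where z: "z \<in> reps" "y = key z" by (rule D_cases)
    have "own z = Suc k" using y z encodes_Some[OF assms(1) z(1) assms(2)] by (simp add: members_def)
    moreover have "gid k z = gid k u"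
      using y z gid_eq_iff_agree[OF assms(2) reps_less[OF z(1)] assms(3)] by (simp add: members_def)
    ultimately show "y \<in> key ` ?A" using z reps_less by auto
  next
    fix y assume "y \<in> key ` ?A"
    then obtain z where z: "z < n" "own z = Suc k" "gid k z = gid k u" "y = key z" by auto
    then show "y \<in> members f (Xs ! k) (key u)"
      using encodes_own(3)[OF assms(1) z(1,2)] gid_eq_iff_agree[OF assms(2) z(1) assms(3)] key_D[OF z(1)]
      by (simp add: members_def)
  qed
  moreover have "card (key ` ?A) = card ?A"
    by (rule card_image) (rule inj_on_subset[OF inj_key sub])
  ultimately show ?thesis by (simp add: grp_def)
qed

section \<open>The search tree yields shortest augmenting paths\<close>

context
  fixes own f y0 Q P T
  assumes enc: "encodes own f" and y0: "y0 \<in> reps" "own y0 = 0" and b: "bfs own y0 Q P T T 0 n"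
begin

abbreviation tr :: "nat \<Rightarrow> ('v, 'a) tuple list" where "tr \<equiv> trace P (\<lambda>u. key (Q u))"

lemma tr_0: "tr 0 = []" by (simp add: trace.simps)

lemma tr_step: "0 < u \<Longrightarrow> u < T \<Longrightarrow> tr u = tr (P u) @ [key (Q u)]"
  using bfsD(5)[OF b] by (subst trace.simps) simp

lemma tree_edge:
  assumes "0 < u" "u < T"
  obtains k where "k < K" "own (Q u) = Suc k" "f (key (Q u)) = Some (Xs ! k)" "Q u \<in> reps"
    "link f (key (Q (P u))) (key (Q u))"
proof -
  obtain k where k: "k < K" "own (Q u) = Suc k" "gid k (Q u) = gid k (Q (P u))"
    using bfsD(6)[OF b assms] by blast
  have Qu: "Q u < n" using bfsD(4)[OF b assms(2)] .
  have QP: "Q (P u) < n" using bfsD(4)[OF b] bfsD(5)[OF b assms] assms(2) by simp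
  have f: "Q u \<in> reps" "f (key (Q u)) = Some (Xs ! k)" using encodes_own[OF enc Qu k(2)] by simp_all
  then have "link f (key (Q (P u))) (key (Q u))"
    unfolding link_def using nth_Xs[OF k(1)] gid_eq_iff_agree[OF k(1) Qu QP] k(3) by blast
  with k f show thesis by (intro that)
qed

lemma tr_path: "u < T \<Longrightarrow> successively (link f) (key y0 # tr u) \<and> last (key y0 # tr u) = key (Q u)"
proof (induction u rule: less_induct)
  case (less u)
  show ?case
  proof (cases "u = 0")
    case True
    then show ?thesis using bfsD(2)[OF b] by (simp add: tr_0)
  next
    case False
    then have u: "0 < u" "u < T" using less.prems by simp_all
    have P: "P u < u" using bfsD(5)[OF b u] .
    from less.IH[OF this] P u have IH: "successively (link f) (key y0 # tr (P u))"
      "last (key y0 # tr (P u)) = key (Q (P u))" by simp_all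
    have e: "link f (key (Q (P u))) (key (Q u))" using tree_edge[OF u] by blast
    have "successively (link f) ((key y0 # tr (P u)) @ [key (Q u)])"
      unfolding successively_append_iff using IH e by simp
    then show ?thesis unfolding tr_step[OF u] by simp
  qed
qed

text \<open>Depth never decreases along the queue: compare the parents, whose positions are
  monotone, and add one on both sides.\<close>

lemma length_tr_mono: "i \<le> j \<Longrightarrow> j < T \<Longrightarrow> length (tr i) \<le> length (tr j)"
proof (induction j arbitrary: i rule: less_induct)
  case (less j)
  show ?case
  proof (cases "i = 0")
    case False
    then have ij: "0 < i" "i < T" "0 < j" using less.prems by simp_all
    have "length (tr (P i)) \<le> length (tr (P j))"
      using bfsD(5)[OF b ij(3) less.prems(2)] bfsD(7)[OF b ij(1) less.prems] less.prems(2)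
      by (intro less.IH) auto
    then show ?thesis using tr_step[OF ij(1,2)] tr_step[OF ij(3) less.prems(2)] by simp
  qed (simp add: tr_0)
qed

text \<open>Completeness and minimality in one induction. The next tuple of a walk was discovered
  from a position not later than that of its predecessor, so its depth exceeds the predecessor's by
  at most one.\<close>

lemma reachable_position:
  "successively (link f) (key y0 # ys) \<Longrightarrow> \<exists>u<T. key (Q u) = last (key y0 # ys) \<and> length (tr u) \<le> length ys"
proof (induction ys rule: rev_induct)
  case Nil
  then show ?case using bfsD(1,2)[OF b] by (intro exI[of _ 0]) (simp add: tr_0)
next
  case (snoc z ys)
  have s: "successively (link f) ((key y0 # ys) @ [z])" using snoc.prems by simp
  then have s': "successively (link f) (key y0 # ys)" "link f (last (key y0 # ys)) z"
    unfolding successively_append_iff by simp_all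
  from snoc.IH[OF s'(1)] obtain u where u: "u < T" "key (Q u) = last (key y0 # ys)" "length (tr u) \<le> length ys"
    by blast
  from s'(2) obtain X where X: "X \<in> \<X>" "f z = Some X" "agree X z (key (Q u))"
    unfolding link_def u(2) by blast
  obtain k where k: "k < K" "X = Xs ! k" using X(1) set_Xs by (metis in_set_conv_nth)
  have "z \<in> D" using X(2) enc by (auto simp: encodes_def)
  then obtain w where w: "w \<in> reps" "z = key w" by (rule D_cases)
  have own: "own w = Suc k" using encodes_Some[OF enc w(1) k(1)] X(2) w(2) k(2) by simp
  have g: "gid k w = gid k (Q u)"
    using gid_eq_iff_agree[OF k(1) reps_less[OF w(1)] bfsD(4)[OF b u(1)]] X(3) w(2) k(2) by simp
  have "reached T 0 n u k w" using u(1) by (simp add: reached_def)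
  from bfsD(8)[OF b u(1) k(1) reps_less[OF w(1)] own g this]
  obtain j where j: "0 < j" "j < T" "Q j = w" "P j \<le> u" by blast
  have "length (tr j) \<le> Suc (length ys)"
    using length_tr_mono[OF j(4) u(1)] u(3) tr_step[OF j(1,2)] by simp
  then show ?case using j w(2) by (intro exI[of _ j]) simp
qed

lemma aug_path_found:
  assumes "aug_path f d (key y0) ys X"
  obtains u k where "u < T" "found own d Q u k" "length (tr u) \<le> length ys"
proof -
  have p: "successively (link f) (key y0 # ys)" "X \<in> \<X>" "card (members f X (last (key y0 # ys))) < d"
    using assms by (simp_all add: aug_path_def)
  obtain u where u: "u < T" "key (Q u) = last (key y0 # ys)" "length (tr u) \<le> length ys"
    using reachable_position[OF p(1)] by blast
  obtain k where k: "k < K" "X = Xs ! k" using p(2) set_Xs by (metis in_set_conv_nth)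
  have "found own d Q u k"
    unfolding found_def using k(1) grp_eq[OF enc k(1) bfsD(4)[OF b u(1)]] p(3) unfolding u(2) k(2) by simp
  with u show thesis by (intro that)
qed

lemma found_aug_path:
  assumes "u < T" "found own d Q u k"
  shows "aug_path f d (key y0) (tr u) (Xs ! k)"
proof -
  have k: "k < K" using assms(2) by (simp add: found_def)
  then show ?thesis
    unfolding aug_path_def using tr_path[OF assms(1)] nth_Xs grp_eq[OF enc k bfsD(4)[OF b assms(1)]] assms(2)
    by (simp add: found_def)
qed

text \<open>Generalised to a partly performed shift: positions beyond \<open>u\<close> may be
  overwritten, while those up to \<open>u\<close> still hold the original owners, which
  \<open>path_sets\<close> takes from the unchanged \<open>f\<close>.\<close>

lemma encodes_shifted_aux:
  assumes "u < T" "encodes own' f'" "k < K" "\<And>j. 0 < j \<Longrightarrow> j \<le> u \<Longrightarrow> own' (Q j) = own (Q j)"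
  shows "encodes (shifted Q P own' u (Suc k)) (f' ++ map_of (zip (key y0 # tr u) (path_sets f (tr u) (Xs ! k))))"
  using assms
proof (induction u arbitrary: own' f' k rule: less_induct)
  case (less u)
  show ?case
  proof (cases "u = 0")
    case True
    have "shifted Q P own' u (Suc k) = own'(y0 := Suc k)"
      using True bfsD(2)[OF b] by (subst shifted.simps) simp
    moreover have "f' ++ map_of (zip (key y0 # tr u) (path_sets f (tr u) (Xs ! k))) = f'(key y0 \<mapsto> Xs ! k)"
      using True by (simp add: tr_0 path_sets_def)
    ultimately show ?thesis using encodes_upd[OF less.prems(2) y0(1) less.prems(3)] by metis
  next
    case False
    then have u: "0 < u" "u < T" using less.prems by simp_all
    have P: "P u < u" using bfsD(5)[OF b u] .
    obtain k1 where k1: "k1 < K" "own (Q u) = Suc k1" "f (key (Q u)) = Some (Xs ! k1)" "Q u \<in> reps"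
      using tree_edge[OF u] by blast
    have own_u: "own' (Q u) = Suc k1" using less.prems(4)[OF u(1)] k1(2) by simp
    have sh: "shifted Q P own' u (Suc k) = shifted Q P (own'(Q u := Suc k)) (P u) (Suc k1)"
      using u(1) P own_u by (subst shifted.simps) simp
    \<comment> \<open>Distinct queue entries ensure that the write at \<open>Q u\<close> leaves the
      owners at earlier positions intact.\<close>
    have "Q j \<noteq> Q u" if "j < u" for j
      using bfsD(3)[OF b] that u(2) by (auto dest: inj_onD)
    then have "encodes (shifted Q P (own'(Q u := Suc k)) (P u) (Suc k1))
      (f'(key (Q u) \<mapsto> Xs ! k) ++ map_of (zip (key y0 # tr (P u)) (path_sets f (tr (P u)) (Xs ! k1))))"
      using less.prems(4) P u k1(1)
      by (intro less.IH encodes_upd[OF less.prems(2) k1(4) less.prems(3)]) auto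
    moreover have "f'(key (Q u) \<mapsto> Xs ! k) ++ map_of (zip (key y0 # tr (P u)) (path_sets f (tr (P u)) (Xs ! k1))) =
      f' ++ map_of (zip (key y0 # tr u) (path_sets f (tr u) (Xs ! k)))"
    proof -
      have "zip (key y0 # tr u) (path_sets f (tr u) (Xs ! k)) =
        zip (key y0 # tr (P u)) (path_sets f (tr (P u)) (Xs ! k1)) @ [(key (Q u), Xs ! k)]"
        unfolding tr_step[OF u] path_sets_def using k1(3)
        using zip_append[of "key y0 # tr (P u)" "map (the \<circ> f) (tr (P u)) @ [Xs ! k1]" "[key (Q u)]" "[Xs ! k]"]
        by simp
      then show ?thesis by (simp only: map_of_append map_add_assoc) simp
    qed
    ultimately show ?thesis unfolding sh by metis
  qed
qed

lemma encodes_shifted: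
  assumes "u < T" "k < K"
  shows "encodes (shifted Q P own u (Suc k)) (shift_map f (key y0) (tr u) (Xs ! k))"
  unfolding shift_map_def using encodes_shifted_aux[OF assms(1) enc assms(2)] by simp

lemma iteration_correct:
  assumes "tight f d" and sel: "selected own d Q T u l"
  obtains f' d' where "encodes (shifted Q P own u (if l = 0 then 1 else l)) f'"
    "d' = (if l = 0 then Suc d else d)" "tight f' d'" "dom f' = insert (key y0) (dom f)"
    "eda_iteration \<X> Y (key y0) (state_of f d) (state_of f' d')"
proof -
  have v: "valid f" using enc by (rule encodes_valid)
  have y0D: "key y0 \<in> D" using key_D reps_less y0(1) by blast
  have none: "f (key y0) = None" using enc y0 by (auto simp: encodes_def)
  show thesis
  proof (cases "l = 0")
    case True
    then have "u = 0" and nf: "\<forall>u'<T. \<forall>k. \<not> found own d Q u' k" using sel by (auto simp: selected_def)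
    have no: "\<nexists>ys X. aug_path f d (key y0) ys X"
      using aug_path_found nf by metis
    have sh: "shifted Q P own u 1 = own(y0 := Suc 0)"
      using \<open>u = 0\<close> bfsD(2)[OF b] by (subst shifted.simps) simp
    show thesis
    proof (rule that)
      show "encodes (shifted Q P own u (if l = 0 then 1 else l)) (f(key y0 \<mapsto> Xs ! 0))"
        using True sh encodes_upd[OF enc y0(1) K_pos] by simp
      show "Suc d = (if l = 0 then Suc d else d)" using True by simp
      show "tight (f(key y0 \<mapsto> Xs ! 0)) (Suc d)" "dom (f(key y0 \<mapsto> Xs ! 0)) = insert (key y0) (dom f)"
        using tight_grow(2,3)[OF v assms(1) y0D none nth_Xs[OF K_pos] no] by simp_all
      show "eda_iteration \<X> Y (key y0) (state_of f d) (state_of (f(key y0 \<mapsto> Xs ! 0)) (Suc d))"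
        by (rule eda_iteration_grow[OF v assms(1) y0D none nth_Xs[OF K_pos] no])
    qed
  next
    case False
    then obtain k where k: "l = Suc k" "u < T" "found own d Q u k" "\<forall>u'<u. \<forall>k. \<not> found own d Q u' k"
      using sel by (auto simp: selected_def)
    have kK: "k < K" using k(3) by (simp add: found_def)
    have p: "aug_path f d (key y0) (tr u) (Xs ! k)" by (rule found_aug_path[OF k(2,3)])
    \<comment> \<open>Every augmenting path leads to a successful position whose depth is at most
      the length of the path; \<open>u\<close> is the first successful position and depth is
      monotone.\<close>
    have min: "length (tr u) \<le> length ys'" if p': "aug_path f d (key y0) ys' X'" for ys' X'
    proof -
      obtain u' k' where u': "u' < T" "found own d Q u' k'" "length (tr u') \<le> length ys'"
        using aug_path_found[OF p'] by blast
      have "u \<le> u'" using k(4) u'(2) not_less by blast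
      from length_tr_mono[OF this u'(1)] u'(3) show ?thesis by simp
    qed
    show thesis
    proof (rule that)
      show "encodes (shifted Q P own u (if l = 0 then 1 else l)) (shift_map f (key y0) (tr u) (Xs ! k))"
        using encodes_shifted[OF k(2) kK] k(1) by simp
      show "d = (if l = 0 then Suc d else d)" using False by simp
    qed (use eda_iteration_augment[OF v assms(1) y0D none p min] in simp_all)
  qed
qed

end


lemma represents_state:
  assumes "encodes (m OWN) f" "published m" "m Degree 0 = d"
  shows "represents \<X> ts m (state_of f d)"
proof -
  have v: "valid f" using assms(1) by (rule encodes_valid)
  have "m (Part X) i = (if ts ! i \<in> fam f X then 1 else 0)" if Xi: "X \<in> \<X>" "i < n" for X i
  proof -
    obtain k where k: "k < K" "X = Xs ! k" using Xi(1) set_Xs by (metis in_set_conv_nth)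
    have "ts ! i \<in> fam f X \<longleftrightarrow> f (key i) = Some (Xs ! k)"
      using nth_mem[OF Xi(2)] unfolding set_ts k(2) by (simp add: fam_def key_def)
    also have "\<dots> \<longleftrightarrow> m OWN (gid K i - 1) = Suc k"
      using encodes_Some[OF assms(1) rep_reps[OF Xi(2)] k(1)] key_rep[OF Xi(2)] by simp
    finally show ?thesis using assms(2) k Xi(2) by (simp add: published_def)
  qed
  moreover have "{t \<in> R. t |` Y \<notin> dom f} = set ts - (\<Union>X\<in>\<X>. fam f X)"
  proof -
    have "t |` Y \<in> dom f \<longleftrightarrow> (\<exists>X\<in>\<X>. f (t |` Y) = Some X)" for t :: "('v, 'a) tuple"
      using v by (auto simp: valid_def ran_def)
    then show ?thesis using set_ts by (auto simp: fam_def)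
  qed
  ultimately show ?thesis using assms(3) by (simp add: represents_def state_of_def)
qed

section \<open>The main loop and its snapshots\<close>

definition order :: "nat \<Rightarrow> ('v, 'a) tuple list" where
  "order i = map key (filter (\<lambda>z. gid K z = Suc z) [0..<i])"

text \<open>All values of \<open>\<tau>\<close> are bounded by the present time \<open>t\<close>, so
  the next snapshot can be appended without destroying monotonicity.\<close>

definition reaches :: "'v config \<Rightarrow> nat \<Rightarrow> nat \<Rightarrow> 'v memory \<Rightarrow> bool" where
  "reaches c i t m \<longleftrightarrow> (\<exists>f d ss \<tau>.
     tables m \<and> m vI 0 = i \<and> published m \<and> encodes (m OWN) f \<and> m Degree 0 = d \<and> tight f d \<and>
     dom f = set (order i) \<and> length ss = Suc (length (order i)) \<and> ss ! 0 = (R, (\<lambda>_. {}), 0) \<and>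
     last ss = state_of f d \<and>
     (\<forall>k<length (order i). eda_iteration \<X> Y (order i ! k) (ss ! k) (ss ! Suc k)) \<and>
     mono \<tau> \<and> (\<forall>k. \<tau> k \<le> t) \<and> (\<forall>k<length ss. represents \<X> ts (snd (config_after (\<tau> k) c)) (ss ! k)))"

lemma reaches_init:
  assumes "tables m" "m vI 0 = 0" "m OWN = (\<lambda>_. 0)" "m Degree 0 = 0" "\<And>X i. m (Part X) i = 0"
    and "snd (config_after t c) = m"
  shows "reaches c 0 t m"
proof -
  have enc: "encodes (m OWN) Map.empty" using assms(3) by (simp add: encodes_def)
  have pub: "published m" using assms(3,5) by (simp add: published_def)
  have "represents \<X> ts m (state_of Map.empty 0)"
    using represents_state[OF enc pub assms(4)] .
  then show ?thesis
    unfolding reaches_def using assms enc pub valid_empty(2) initial_state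
    by (intro exI[of _ Map.empty] exI[of _ 0] exI[of _ "[(R, (\<lambda>_. {}), 0)]"] exI[of _ "\<lambda>_. t"])
      (simp add: order_def mono_def)
qed

definition loop_body :: "'v com list" where
  "loop_body = [Cond (Equal (Read (GID K) (V vI)) (Succ (V vI))) iteration [], Write vI (Const 0) (Succ (V vI))]"

definition loop_body_time :: nat where
  "loop_body_time = 50 * (K + 1) * (n + 1) + 2"

lemma wp_loop_body:
  assumes tab: "tables m" and i: "m vI 0 = i" "i < n" and own: "i \<in> reps \<Longrightarrow> m OWN i = 0"
  shows "wp loop_body (\<lambda>t m'. t \<le> loop_body_time \<and> m' vI 0 = Suc i \<and> tables m' \<and>
    (if i \<in> reps then published m' \<and>
      (\<exists>Q P T u l. bfs (m OWN) i Q P T T 0 n \<and> selected (m OWN) (m Degree 0) Q T u l \<and>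
         m' OWN = shifted Q P (m OWN) u (if l = 0 then 1 else l) \<and>
         m' Degree 0 = (if l = 0 then Suc (m Degree 0) else m Degree 0))
     else m' = m(vI := (m vI)(0 := Suc i)))) m"
proof (cases "i \<in> reps")
  case True
  have test: "test_val m (Equal (Read (GID K) (V vI)) (Succ (V vI)))"
    using tablesD(2)[OF tab order_refl i(2)] i True by (simp add: reps_def)
  define post where "post m' \<longleftrightarrow> published m' \<and>
      (\<exists>Q P T u l. bfs (m OWN) i Q P T T 0 n \<and> selected (m OWN) (m Degree 0) Q T u l \<and>
         m' OWN = shifted Q P (m OWN) u (if l = 0 then 1 else l) \<and>
         m' Degree 0 = (if l = 0 then Suc (m Degree 0) else m Degree 0))" for m'
  have post_upd: "post (m1(vI := x)) \<longleftrightarrow> post m1" for m1 x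
  proof -
    have "(m1(vI := x)) OWN = m1 OWN" "(m1(vI := x)) Degree = m1 Degree" "published (m1(vI := x)) = published m1"
      by (simp_all add: published_def)
    then show ?thesis by (simp only: post_def)
  qed
  have it: "wp iteration (\<lambda>t m'. t \<le> 50 * (K + 1) * (n + 1) \<and> (tables m' \<and> m' vI = m vI \<and> post m')) m"
    unfolding post_def by (rule wp_iteration[OF tab own[OF True] i])
  have "wp (iteration @ [Write vI (Const 0) (Succ (V vI))]) (\<lambda>t m'. t \<le> 50 * (K + 1) * (n + 1) + 1 \<and>
      (m' vI 0 = Suc i \<and> tables m' \<and> post m')) m"
  proof (rule wp_seq[OF it])
    fix m1 assume *: "tables m1 \<and> m1 vI = m vI \<and> post m1"
    show "wp [Write vI (Const 0) (Succ (V vI))] (\<lambda>t m'. t \<le> 1 \<and> (m' vI 0 = Suc i \<and> tables m' \<and> post m')) m1"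
      using * i by (intro wp_Write wp_Nil) (simp add: post_upd)
  qed
  then have "wp (iteration @ [Write vI (Const 0) (Succ (V vI))]) (\<lambda>t m'. Suc t \<le> loop_body_time \<and>
      m' vI 0 = Suc i \<and> tables m' \<and> (if i \<in> reps then post m' else m' = m(vI := (m vI)(0 := Suc i)))) m"
    unfolding if_P[OF True] by (rule wp_mono) (simp add: loop_body_time_def)
  then show ?thesis
    unfolding loop_body_def post_def by (intro wp_Cond) (simp only: if_P[OF test])
next
  case False
  have test: "\<not> test_val m (Equal (Read (GID K) (V vI)) (Succ (V vI)))"
    using tablesD(2)[OF tab order_refl i(2)] i False by (simp add: reps_def)
  have "wp loop_body (\<lambda>t m'. t = 2 \<and> m' = m(vI := (m vI)(0 := Suc i))) m"
    unfolding loop_body_def using test i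
    by (intro wp_Cond) (auto intro!: wp_Write wp_Nil)
  then show ?thesis
    by (rule wp_mono) (use False tab in \<open>simp add: loop_body_time_def\<close>)
qed

lemma order_Suc: "order (Suc i) = order i @ (if gid K i = Suc i then [key i] else [])"
  by (simp add: order_def)

lemma order_notin: "i \<in> reps \<Longrightarrow> key i \<notin> set (order i)"
proof
  assume i: "i \<in> reps" and "key i \<in> set (order i)"
  then obtain z where z: "z < i" "gid K z = Suc z" "key i = key z" by (auto simp: order_def)
  then have "z \<in> reps" using reps_less[OF i] by (simp add: reps_def)
  then have "i = z" by (rule inj_onD[OF inj_key z(3) i])
  then show False using z(1) by simp
qed

lemma reaches_step:
  assumes r: "reaches c i t m" and i: "i < n" and c: "config_after t c = (While b loop_body # cs, m)"
    and b: "test_val m b"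
  obtains t' m' where "t' \<le> t + loop_body_time + 1" "config_after t' c = (While b loop_body # cs, m')" "reaches c (Suc i) t' m'"
proof -
  from r obtain f d ss \<tau> where
    tab: "tables m" and vI: "m vI 0 = i" and pub: "published m" and enc: "encodes (m OWN) f"
    and d: "m Degree 0 = d" and tight: "tight f d" and dom: "dom f = set (order i)"
    and len: "length ss = Suc (length (order i))" and ss0: "ss ! 0 = (R, (\<lambda>_. {}), 0)"
    and last: "last ss = state_of f d"
    and run: "\<And>k. k < length (order i) \<Longrightarrow> eda_iteration \<X> Y (order i ! k) (ss ! k) (ss ! Suc k)"
    and \<tau>: "mono \<tau>" "\<And>k. \<tau> k \<le> t" "\<And>k. k < length ss \<Longrightarrow> represents \<X> ts (snd (config_after (\<tau> k) c)) (ss ! k)"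
    unfolding reaches_def by blast
  \<comment> \<open>The key of a representative is not among those treated so far, so
    \<open>f\<close> is undefined there and the owner is the null value.\<close>
  have own: "m OWN i = 0" if reps: "i \<in> reps"
  proof -
    have "f (key i) = None" using order_notin[OF reps] dom by blast
    then have "part_of (m OWN i) = None" using enc reps by (auto simp: encodes_def)
    then show ?thesis by (cases "m OWN i") simp_all
  qed
  from wp_loop_body[OF tab vI i own] obtain s m' where s: "run loop_body m s m'" "s \<le> loop_body_time"
    and m': "m' vI 0 = Suc i" "tables m'"
    and post: "if i \<in> reps then published m' \<and>
      (\<exists>Q P T u l. bfs (m OWN) i Q P T T 0 n \<and> selected (m OWN) (m Degree 0) Q T u l \<and>
         m' OWN = shifted Q P (m OWN) u (if l = 0 then 1 else l) \<and>
         m' Degree 0 = (if l = 0 then Suc (m Degree 0) else m Degree 0))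
     else m' = m(vI := (m vI)(0 := Suc i))"
    unfolding wp_def by blast
  \<comment> \<open>The additional step is the loop test.\<close>
  define t' where "t' = t + Suc s"
  have c': "config_after t' c = (While b loop_body # cs, m')"
    unfolding t'_def config_after_add c config_after_Suc using b s(1) by (simp add: run_def)
  have "reaches c (Suc i) t' m'"
  proof (cases "i \<in> reps")
    case False
    then have eq: "m' = m(vI := (m vI)(0 := Suc i))" using post by simp
    have "published m'" "m' OWN = m OWN" "m' Degree 0 = d"
      using pub d unfolding eq by (simp_all add: published_def)
    moreover have "order (Suc i) = order i" using False i by (simp add: order_Suc reps_def)
    moreover have "\<tau> k \<le> t'" for k using \<tau>(2)[of k] by (simp add: t'_def)
    ultimately show ?thesis
      unfolding reaches_def using m' enc tight dom len ss0 last run \<tau>(1,3)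
      by (intro exI[of _ f] exI[of _ d] exI[of _ ss] exI[of _ \<tau>]) simp
  next
    case True
    then obtain Q P T u l where pub': "published m'" and bfs: "bfs (m OWN) i Q P T T 0 n"
      and sel: "selected (m OWN) d Q T u l"
      and own': "m' OWN = shifted Q P (m OWN) u (if l = 0 then 1 else l)"
      and deg: "m' Degree 0 = (if l = 0 then Suc d else d)"
      using post d by auto
    from iteration_correct[OF enc True own[OF True] bfs tight sel] obtain f' d' where
      f': "encodes (shifted Q P (m OWN) u (if l = 0 then 1 else l)) f'" "d' = (if l = 0 then Suc d else d)"
      "tight f' d'" "dom f' = insert (key i) (dom f)"
      "eda_iteration \<X> Y (key i) (state_of f d) (state_of f' d')"
      by blast
    have ord: "order (Suc i) = order i @ [key i]" using True by (simp add: order_Suc reps_def)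
    let ?ss = "ss @ [state_of f' d']" and ?\<tau> = "\<lambda>k. if k < length ss then \<tau> k else t'"
    have enc': "encodes (m' OWN) f'" using f'(1) own' by simp
    have deg': "m' Degree 0 = d'" using deg f'(2) by simp
    have rep: "represents \<X> ts m' (state_of f' d')"
      by (rule represents_state[OF enc' pub' deg'])
    have le: "\<tau> k \<le> t'" for k using \<tau>(2)[of k] by (simp add: t'_def)
    have lastss: "ss ! length (order i) = state_of f d"
      using last len last_conv_nth[of ss] by (cases "ss = []") simp_all
    have it: "eda_iteration \<X> Y (order (Suc i) ! k) (?ss ! k) (?ss ! Suc k)" if "k < length (order (Suc i))" for k
    proof (cases "k < length (order i)")
      case True
      then show ?thesis using run[OF True] len by (simp add: ord nth_append)
    next
      case False
      then have "k = length (order i)" using that ord by simp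
      then show ?thesis using f'(5) lastss len by (simp add: ord nth_append)
    qed
    have "mono ?\<tau>"
      using \<tau>(1) le by (auto simp: mono_def)
    moreover have "?\<tau> k \<le> t'" for k using le by simp
    moreover have "represents \<X> ts (snd (config_after (?\<tau> k) c)) (?ss ! k)" if "k < length ?ss" for k
    proof (cases "k < length ss")
      case True
      then show ?thesis using \<tau>(3)[OF True] by (simp add: nth_append)
    next
      case False
      then have "k = length ss" using that by simp
      then show ?thesis using rep c' by simp
    qed
    moreover have "length ?ss = Suc (length (order (Suc i)))" using len ord by simp
    moreover have "?ss ! 0 = (R, (\<lambda>_. {}), 0)" using ss0 len by (simp add: nth_append)
    moreover have "last ?ss = state_of f' d'" by simp
    moreover have "dom f' = set (order (Suc i))" using f'(4) dom ord by simp
    ultimately show ?thesis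
      unfolding reaches_def using m' pub' enc' deg' f'(3) it by blast
  qed
  then show thesis using c' s(2) by (intro that[of t' m']) (simp_all add: t'_def)
qed

text \<open>The two single steps are the initialisation of \<open>vI\<close> and the failing last
  test.\<close>

definition total_time :: nat where
  "total_time = (2 + n * (2 + n * (Suc K * (L + 3) + 2) + 2)) + 1 + n * (loop_body_time + 1) + 1"

theorem program_correct:
  assumes init: "m0 Size 0 = n" "\<And>v. m0 (Column v) = col v" "\<And>k i. m0 (Work k) i = 0"
    "\<And>X i. m0 (Part X) i = 0" "m0 Degree 0 = 0"
  shows "\<exists>y0s ss. eda_run R \<X> Y y0s ss \<and> carries_out_within \<X> ts (program, m0) ss total_time"
proof -
  let ?c = "(program, m0)" and ?W = "While (Less (V vI) (V Size)) loop_body"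
  have prog: "program = tabulate @ [Write vI (Const 0) (Const 0), ?W]"
    by (simp add: program_def for_loop_def loop_body_def)
  have base: "base m0" using init by (auto simp: base_def)
  from wp_frame[OF wp_tabulate[OF base init(3) init(3)]] obtain t0 m1 where
    t0: "run tabulate m0 t0 m1" "t0 \<le> 2 + n * (2 + n * (Suc K * (L + 3) + 2) + 2)"
    and tab1: "tables m1" and fr: "\<And>a. a \<notin> writes_list tabulate \<Longrightarrow> m1 a = m0 a"
    unfolding wp_def by blast
  have w: "writes_list tabulate \<subseteq> {vI, vJ} \<union> range GID \<union> range PRV"
    unfolding tabulate_def for_loop_def by (auto dest!: writes_tabulate_pair)
  have fr': "m1 a = m0 a" if "a \<notin> {vI, vJ} \<union> range GID \<union> range PRV" for a
    using fr w that by blast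
  let ?m2 = "m1(vI := (m1 vI)(0 := 0))"
  have c2: "config_after (Suc t0) ?c = ([?W], ?m2)"
  proof -
    have "config_after t0 ?c = ([Write vI (Const 0) (Const 0), ?W], m1)"
      using t0(1) unfolding prog run_def by blast
    then have "config_after (t0 + 1) ?c = config_after 1 ([Write vI (Const 0) (Const 0), ?W], m1)"
      unfolding config_after_add by simp
    then show ?thesis by (simp add: config_after_def fun_upd_def)
  qed
  have "m1 OWN = m0 OWN" "m1 Degree = m0 Degree" "\<And>X. m1 (Part X) = m0 (Part X)"
    by (rule fr'; simp add: image_iff)+
  then have start: "reaches ?c 0 (Suc t0) ?m2"
    using init tab1 c2 by (intro reaches_init) (simp_all add: fun_eq_iff)
  obtain m2 where start': "reaches ?c 0 (Suc t0) m2" "config_after (Suc t0) ?c = ([?W], m2)"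
    using start c2 by blast
  have loop: "\<exists>t m. t \<le> Suc t0 + i * (loop_body_time + 1) \<and> config_after t ?c = ([?W], m) \<and> reaches ?c i t m"
    if "i \<le> n" for i
    using that
  proof (induction i)
    case 0
    show ?case using start' by (intro exI[of _ "Suc t0"] exI[of _ m2]) simp
  next
    case (Suc i)
    then obtain t m where t: "t \<le> Suc t0 + i * (loop_body_time + 1)" and c: "config_after t ?c = ([?W], m)"
      and r: "reaches ?c i t m" by auto
    have tm: "tables m" "m vI 0 = i" using r by (auto simp: reaches_def)
    then have "test_val m (Less (V vI) (V Size))" using tablesD(1)[OF tm(1)] Suc.prems by simp
    from reaches_step[OF r _ c this] Suc.prems obtain t' m' where
      "t' \<le> t + loop_body_time + 1" "config_after t' ?c = ([?W], m')" "reaches ?c (Suc i) t' m'"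
      by (metis Suc_le_lessD)
    then show ?case using t by (intro exI[of _ t'] exI[of _ m']) simp
  qed
  from loop[OF order_refl] obtain t m where t: "t \<le> Suc t0 + n * (loop_body_time + 1)"
    and c: "config_after t ?c = ([?W], m)" and r: "reaches ?c n t m" by blast
  from r obtain f d ss \<tau> where tab: "tables m" and vI: "m vI 0 = n"
    and len: "length ss = Suc (length (order n))" and ss0: "ss ! 0 = (R, (\<lambda>_. {}), 0)"
    and enc: "encodes (m OWN) f" and pub: "published m" and d: "m Degree 0 = d"
    and last: "last ss = state_of f d"
    and run: "\<And>k. k < length (order n) \<Longrightarrow> eda_iteration \<X> Y (order n ! k) (ss ! k) (ss ! Suc k)"
    and \<tau>: "mono \<tau>" "\<And>k. \<tau> k \<le> t" "\<And>k. k < length ss \<Longrightarrow> represents \<X> ts (snd (config_after (\<tau> k) ?c)) (ss ! k)"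
    unfolding reaches_def by blast
  have halt: "config_after (Suc t) ?c = ([], m)"
  proof -
    have "\<not> test_val m (Less (V vI) (V Size))" using vI tablesD(1)[OF tab] by simp
    then have "machine_step ([?W], m) = ([], m)" by simp
    then show ?thesis using c by (simp add: config_after_def)
  qed
  have "distinct (order n)"
    unfolding order_def distinct_map using inj_key by (auto simp: reps_def)
  moreover have "set (order n) = D"
    using key_reps by (auto simp: order_def reps_def)
  ultimately have "eda_run R \<X> Y (order n) ss"
    using len ss0 run by (simp add: eda_run_def)
  moreover have "carries_out_within \<X> ts ?c ss total_time"
    unfolding carries_out_within_def
  \<comment> \<open>The last snapshot is postponed to the halting step, where the same memory still
    represents the final state.\<close>
  proof (intro exI[of _ "\<lambda>k. if k < length ss - 1 then \<tau> k else Suc t"] conjI allI impI)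
    show "mono (\<lambda>k. if k < length ss - 1 then \<tau> k else Suc t)"
      using \<tau>(1,2) by (auto simp: mono_def le_SucI)
    show "fst (config_after (if length ss - 1 < length ss - 1 then \<tau> (length ss - 1) else Suc t) ?c) = []"
      using halt by simp
    show "(if length ss - 1 < length ss - 1 then \<tau> (length ss - 1) else Suc t) \<le> total_time"
      using t t0(2) by (simp add: total_time_def)
    fix k assume k: "k < length ss"
    show "represents \<X> ts (snd (config_after (if k < length ss - 1 then \<tau> k else Suc t) ?c)) (ss ! k)"
    proof (cases "k < length ss - 1")
      case True
      then show ?thesis using \<tau>(3)[OF k] by simp
    next
      case False
      then have "k = length ss - 1" "ss \<noteq> []" using k by auto
      then have "ss ! k = last ss" by (simp add: last_conv_nth)
      then show ?thesis using False halt represents_state[OF enc pub d] last by simp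
    qed
  qed
  ultimately show ?thesis by blast
qed

end

lemma quadratic_bound:
  "(\<lambda>n. real ((2 + n * (2 + n * a + 2)) + 1 + n * ((b * (n + 1) + 2) + 1) + 1)) \<in> O(\<lambda>n. real n ^ 2)"
proof (rule bigoI[where c = "real (11 + a + 2 * b)"])
  show "\<forall>\<^sub>F n in at_top. norm (real ((2 + n * (2 + n * a + 2)) + 1 + n * ((b * (n + 1) + 2) + 1) + 1))
      \<le> real (11 + a + 2 * b) * norm (real n ^ 2)"
    using eventually_ge_at_top[of 1]
  proof eventually_elim
    case (elim n)
    then obtain k where k: "n = Suc k" by (cases n) auto
    \<comment> \<open>Multiplied out, the left side is
      \<open>4 + (7 + b) * n + (a + b) * n ^ 2\<close>; for positive \<open>n\<close> the sum of the
      coefficients suffices as a factor.\<close>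
    have "(2 + n * (2 + n * a + 2)) + 1 + n * ((b * (n + 1) + 2) + 1) + 1 \<le> (11 + a + 2 * b) * n ^ 2"
      unfolding k by (simp add: power2_eq_square algebra_simps)
    then have "real ((2 + n * (2 + n * a + 2)) + 1 + n * ((b * (n + 1) + 2) + 1) + 1) \<le> real ((11 + a + 2 * b) * n ^ 2)"
      by (rule of_nat_mono)
    then show ?case by simp
  qed
qed

theorem theorem16:
  fixes Z Y :: "'v set" and \<X> :: "'v set set"
  assumes "finite Z" and "Y \<subseteq> Z" and "\<X> \<subseteq> Pow Y" and "\<X> \<noteq> {}"
  shows
    "(\<forall>(R :: ('v, 'a) rel) y0s ss R' P d.
        relation Z R \<and> eda_run R \<X> Y y0s ss \<and> last ss = (R', P, d) \<longrightarrow>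
          is_partitioning R \<X> P \<and>
          d = PC R \<X> Y \<and>
          (\<forall>X\<in>\<X>. degree_constraint (P X) X Y d)) \<and>
     (\<exists>prog T. (\<lambda>n. real (T n)) \<in> O(\<lambda>n. real n ^ 2) \<and>
        implements_eda prog TYPE('a) Z Y \<X> T)"
proof (intro conjI allI impI)
  fix R :: "('v, 'a) rel" and y0s ss R' P d
  assume *: "relation Z R \<and> eda_run R \<X> Y y0s ss \<and> last ss = (R', P, d)"
  then interpret decomposition Z Y \<X> R
    using assms by unfold_locales auto
  show "is_partitioning R \<X> P" "d = PC R \<X> Y" "\<forall>X\<in>\<X>. degree_constraint (P X) X Y d"
    using eda_run_correct * by blast+
next
  have "finite \<X>" using assms finite_subset by (metis finite_Pow_iff)
  then obtain Xs where Xs: "set Xs = \<X>" "distinct Xs" using finite_distinct_list by blast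
  have "\<exists>xs. set xs = S" if "S \<subseteq> Z" for S
    using finite_list finite_subset[OF that assms(1)] by blast
  then obtain enum where enum: "\<And>S. S \<subseteq> Z \<Longrightarrow> set (enum S) = S" by metis
  define vs where "vs k = (if k < Suc (length Xs) then enum ((Xs @ [Y]) ! k) else [])" for k
  \<comment> \<open>Some common bound on the lengths is needed; outside the range the lists are
    empty, so the sum bounds them all.\<close>
  define L where "L = (\<Sum>k<Suc (length Xs). length (vs k))"
  have L: "length (vs k) \<le> L" for k
  proof (cases "k < Suc (length Xs)")
    case True
    then show ?thesis unfolding L_def by (intro member_le_sum) auto
  qed (simp add: vs_def)
  have set_vs: "k < length Xs \<Longrightarrow> set (vs k) = Xs ! k" "set (vs (length Xs)) = Y" for k
  proof -
    show "set (vs (length Xs)) = Y" using assms(2) by (simp add: vs_def enum)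
    assume k: "k < length Xs"
    then have "Xs ! k \<subseteq> Z" using Xs(1) assms(2,3) by (metis PowD nth_mem subset_iff)
    then show "set (vs k) = Xs ! k" using k by (simp add: vs_def nth_append enum)
  qed
  \<comment> \<open>Both constants are fixed by \<open>Xs\<close> and \<open>vs\<close> before any
    relation is given, as data complexity demands.\<close>
  let ?a = "Suc (length Xs) * (L + 3) + 2" and ?b = "50 * (length Xs + 1)"
  define T where "T n = (2 + n * (2 + n * ?a + 2)) + 1 + n * ((?b * (n + 1) + 2) + 1) + 1" for n
  have "implements_eda (machine.program Xs vs) TYPE('a) Z Y \<X> T"
    unfolding implements_eda_def
  proof (intro allI impI)
    fix R :: "('v, 'a) rel" and ts and enc :: "'a \<Rightarrow> nat"
    assume *: "relation Z R \<and> distinct ts \<and> set ts = R \<and> inj_on enc (active_domain R)"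
    define col where "col v = input_memory enc ts (Column v)" for v
    have ex: "execution Xs vs L"
      using Xs(2) L by unfold_locales
    have agr: "execution.agr vs col k i j \<longleftrightarrow> agree (set (vs k)) (ts ! i) (ts ! j)"
      if sub: "set (vs k) \<subseteq> Z" and ij: "i < length ts" "j < length ts" for k i j
    proof -
      have "col v i = col v j \<longleftrightarrow> (ts ! i) v = (ts ! j) v" if v: "v \<in> set (vs k)" for v
      proof -
        have R: "ts ! i \<in> R" "ts ! j \<in> R" using * nth_mem ij by blast+
        \<comment> \<open>Tuples are defined on all of \<open>Z\<close>, so the default code 0 for
          an undefined value cannot be confused with the code of a value.\<close>
        then have "dom (ts ! i) = Z" "dom (ts ! j) = Z" using * by (auto simp: relation_def)
        then have "v \<in> dom (ts ! i)" "v \<in> dom (ts ! j)" using sub v by auto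
        then obtain a b where ab: "(ts ! i) v = Some a" "(ts ! j) v = Some b" by blast
        then have "a \<in> active_domain R" "b \<in> active_domain R"
          using R by (auto simp: active_domain_def ran_def)
        then have "enc a = enc b \<longleftrightarrow> a = b" using * inj_on_eq_iff[of enc "active_domain R" a b] by simp
        then show ?thesis using ab ij by (simp add: col_def)
      qed
      then show ?thesis by (auto simp: execution.agr_def[OF ex] agree_def)
    qed
    interpret eda_execution Z Y \<X> R ts Xs vs col L
    proof (intro eda_execution.intro eda_execution_axioms.intro decomposition.intro ex)
      show "execution.agr vs col k i j = agree (Xs ! k) (ts ! i) (ts ! j)"
        if "k < length Xs" "i < length ts" "j < length ts" for k i j
        using agr[of k i j] that set_vs(1)[OF that(1)] Xs(1) assms(2,3) nth_mem[OF that(1)] by auto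
      show "execution.agr vs col (length Xs) i j = agree Y (ts ! i) (ts ! j)"
        if "i < length ts" "j < length ts" for i j
        using agr[of "length Xs" i j] that set_vs(2) assms(2) by simp
    qed (use * assms Xs(1) in simp_all)
    have "T (card R) = total_time"
      using * distinct_card[of ts] by (simp add: T_def total_time_def loop_body_time_def)
    then show "\<exists>y0s ss. eda_run R \<X> Y y0s ss \<and>
        carries_out_within \<X> ts (machine.program Xs vs, input_memory enc ts) ss (T (card R))"
      using program_correct[of "input_memory enc ts"] by (simp add: col_def fun_eq_iff)
  qed
  moreover have "(\<lambda>n. real (T n)) \<in> O(\<lambda>n. real n ^ 2)"
    unfolding T_def by (rule quadratic_bound)
  ultimately show "\<exists>prog T. (\<lambda>n. real (T n)) \<in> O(\<lambda>n. real n ^ 2) \<and> implements_eda prog TYPE('a) Z Y \<X> T"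
    by blast
qed

end
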